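(* Let $E$ be a Banach lattice, let $\mu$ be a measure, and let $T:E\to L_1(\mu)$ be a bounded linear operator. Then $T$ is LSS if and only if $T$ is DSS.
   Context: For a sequence $(x_n)$ in a Banach space, $[x_n]$ denotes its closed linear span. Let $E$ be a Banach lattice, $X$ a Banach space and $T:E\to X$ a bounded linear operator. $T$ is disjointly strictly singular (DSS) if there is no infinite sequence $(x_n)_n$ of pairwise disjoint (non-zero) vectors in $E$ such that the restriction of $T$ to $[x_n]$ is an isomorphism onto its image. $T$ is lattice strictly singular (LSS) if for every infinite-dimensional closed sublattice $S\subset E$ the restriction $T|_S$ is not an isomorphism onto its image; equivalently, there is no infinite sequence $(x_n)_n$ of positive pairwise disjoint (non-zero) vectors in $E$ such that the restriction of $T$ to $[x_n]$ is an isomorphism onto its image. *)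

theory Defs
  imports "HOL-Analysis.Analysis" "HOL-Library.Lattice_Algebras"
begin

text \<open>Real Banach lattices: the class \<open>lattice_ab_group_add_abs\<close> provides the compatible lattice order
  and the modulus \<open>\<bar>x\<bar> = sup x (- x)\<close>.\<close>

class banach_lattice = banach + ordered_real_vector + lattice_ab_group_add_abs +
  assumes norm_mono_abs: "\<bar>x\<bar> \<le> \<bar>y\<bar> \<Longrightarrow> norm x \<le> norm y"

instance real :: banach_lattice
  by standard (auto simp: sup_real_def)

text \<open>The space \<open>L\<^sub>1(\<mu>)\<close> depends on the measure, so it is a set of almost-everywhere equivalence
  classes of real integrable functions with explicit operations, not a type.\<close>

definition L1_rel :: "'b measure \<Rightarrow> (('b \<Rightarrow> real) \<times> ('b \<Rightarrow> real)) set" where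
  "L1_rel M = {(f, g). integrable M f \<and> integrable M g \<and> (AE x in M. f x = g x)}"

definition L1 :: "'b measure \<Rightarrow> ('b \<Rightarrow> real) set set" where
  "L1 M = {f. integrable M f} // L1_rel M"

definition L1_add :: "'b measure \<Rightarrow> ('b \<Rightarrow> real) set \<Rightarrow> ('b \<Rightarrow> real) set \<Rightarrow> ('b \<Rightarrow> real) set" where
  "L1_add M F G = (\<Union>f\<in>F. \<Union>g\<in>G. L1_rel M `` {\<lambda>x. f x + g x})"

definition L1_scale :: "'b measure \<Rightarrow> real \<Rightarrow> ('b \<Rightarrow> real) set \<Rightarrow> ('b \<Rightarrow> real) set" where
  "L1_scale M c F = (\<Union>f\<in>F. L1_rel M `` {\<lambda>x. c * f x})"

definition L1_norm :: "'b measure \<Rightarrow> ('b \<Rightarrow> real) set \<Rightarrow> real" where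
  "L1_norm M F = the_elem ((\<lambda>f. \<integral>x. \<bar>f x\<bar> \<partial>M) ` F)"

lemma equiv_L1_rel: "equiv {f. integrable M f} (L1_rel M)"
proof (rule equivI)
  show "L1_rel M \<subseteq> {f. integrable M f} \<times> {f. integrable M f}"
    by (auto simp: L1_rel_def)
  show "refl_on {f. integrable M f} (L1_rel M)"
    by (auto simp: L1_rel_def refl_on_def)
  show "sym (L1_rel M)"
    by (auto simp: L1_rel_def sym_def elim!: eventually_mono)
  show "trans (L1_rel M)"
    by (auto simp: L1_rel_def trans_def elim!: eventually_elim2)
qed

lemma L1_rel_class_eqI: "(f, g) \<in> L1_rel M \<Longrightarrow> L1_rel M `` {f} = L1_rel M `` {g}"
  by (rule equiv_class_eq[OF equiv_L1_rel])

lemma L1_add_class: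
  assumes "integrable M f" "integrable M g"
  shows "L1_add M (L1_rel M `` {f}) (L1_rel M `` {g}) = L1_rel M `` {\<lambda>x. f x + g x}"
proof -
  have "L1_rel M `` {\<lambda>x. f' x + g' x} = L1_rel M `` {\<lambda>x. f x + g x}"
    if "(f, f') \<in> L1_rel M" "(g, g') \<in> L1_rel M" for f' g'
    by (rule L1_rel_class_eqI) (use that in \<open>auto simp: L1_rel_def elim!: eventually_elim2\<close>)
  moreover have "(f, f) \<in> L1_rel M" "(g, g) \<in> L1_rel M"
    using assms by (auto simp: L1_rel_def)
  ultimately show ?thesis
    unfolding L1_add_def by blast
qed

lemma L1_scale_class:
  assumes "integrable M f"
  shows "L1_scale M c (L1_rel M `` {f}) = L1_rel M `` {\<lambda>x. c * f x}"
proof -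
  have "L1_rel M `` {\<lambda>x. c * f' x} = L1_rel M `` {\<lambda>x. c * f x}" if "(f, f') \<in> L1_rel M" for f'
    by (rule L1_rel_class_eqI[symmetric]) (use that in \<open>auto simp: L1_rel_def elim: eventually_mono\<close>)
  moreover have "(f, f) \<in> L1_rel M"
    using assms by (auto simp: L1_rel_def)
  ultimately show ?thesis
    unfolding L1_scale_def by blast
qed

lemma L1_norm_class:
  assumes "integrable M f"
  shows "L1_norm M (L1_rel M `` {f}) = (\<integral>x. \<bar>f x\<bar> \<partial>M)"
proof -
  have "(\<integral>x. \<bar>f' x\<bar> \<partial>M) = (\<integral>x. \<bar>f x\<bar> \<partial>M)" if "(f, f') \<in> L1_rel M" for f'
    by (rule integral_cong_AE) (use that in \<open>auto simp: L1_rel_def elim!: eventually_mono\<close>)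
  moreover have "(f, f) \<in> L1_rel M"
    using assms by (auto simp: L1_rel_def)
  ultimately have "(\<lambda>f. \<integral>x. \<bar>f x\<bar> \<partial>M) ` (L1_rel M `` {f}) = {\<integral>x. \<bar>f x\<bar> \<partial>M}"
    by blast
  then show ?thesis
    by (simp add: L1_norm_def)
qed

definition bounded_linear_L1 :: "'b measure \<Rightarrow> ('a::real_normed_vector \<Rightarrow> ('b \<Rightarrow> real) set) \<Rightarrow> bool" where
  "bounded_linear_L1 M T \<longleftrightarrow>
    (\<forall>x. T x \<in> L1 M) \<and>
    (\<forall>x y. T (x + y) = L1_add M (T x) (T y)) \<and>
    (\<forall>c x. T (c *\<^sub>R x) = L1_scale M c (T x)) \<and>
    (\<exists>K. \<forall>x. L1_norm M (T x) \<le> K * norm x)"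

text \<open>In the following definitions \<open>nrm\<close> is the norm of the codomain of \<open>T\<close>, and \<open>T\<close> is meant to be a
  bounded linear operator.\<close>

definition isomorphism_onto_image ::
    "('x \<Rightarrow> real) \<Rightarrow> 'a::real_normed_vector set \<Rightarrow> ('a \<Rightarrow> 'x) \<Rightarrow> bool" where
  "isomorphism_onto_image nrm Y T \<longleftrightarrow>
    inj_on T Y \<and>
    (\<exists>K. \<forall>x\<in>Y. nrm (T x) \<le> K * norm x) \<and>
    (\<exists>K. \<forall>z\<in>T ` Y. norm (inv_into Y T z) \<le> K * nrm z)"

definition closed_span :: "'a::real_normed_vector set \<Rightarrow> 'a set" where
  "closed_span A = closure (span A)"

definition disjoint_vectors :: "(nat \<Rightarrow> 'a::banach_lattice) \<Rightarrow> bool" where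
  "disjoint_vectors x \<longleftrightarrow> (\<forall>m n. m \<noteq> n \<longrightarrow> inf \<bar>x m\<bar> \<bar>x n\<bar> = 0)"

definition closed_sublattice :: "'a::banach_lattice set \<Rightarrow> bool" where
  "closed_sublattice S \<longleftrightarrow>
    closed S \<and> subspace S \<and> (\<forall>x\<in>S. \<forall>y\<in>S. sup x y \<in> S \<and> inf x y \<in> S)"

definition infinite_dimensional :: "'a::real_vector set \<Rightarrow> bool" where
  "infinite_dimensional S \<longleftrightarrow> \<not> (\<exists>B. finite B \<and> S \<subseteq> span B)"

definition disjointly_strictly_singular ::
    "('x \<Rightarrow> real) \<Rightarrow> ('a::banach_lattice \<Rightarrow> 'x) \<Rightarrow> bool" where
  "disjointly_strictly_singular nrm T \<longleftrightarrow>
    \<not> (\<exists>x :: nat \<Rightarrow> 'a. (\<forall>n. x n \<noteq> 0) \<and> disjoint_vectors x \<and>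
         isomorphism_onto_image nrm (closed_span (range x)) T)"

definition lattice_strictly_singular ::
    "('x \<Rightarrow> real) \<Rightarrow> ('a::banach_lattice \<Rightarrow> 'x) \<Rightarrow> bool" where
  "lattice_strictly_singular nrm T \<longleftrightarrow>
    (\<forall>S :: 'a set. closed_sublattice S \<longrightarrow> infinite_dimensional S \<longrightarrow>
       \<not> isomorphism_onto_image nrm S T)"

end

theory Submission
  imports Defs
begin

text \<open>An infinite-dimensional sublattice contains an infinite disjoint sequence, which gives the
  implication from DSS to LSS.  For the converse, assume that \<open>T\<close> is LSS and bounded below on the span of a
  normalised disjoint sequence \<open>p\<^sub>n - q\<^sub>n\<close>, where \<open>p\<^sub>n\<close> and \<open>q\<^sub>n\<close> are the positive and negative parts.
  An LSS operator maps bounded disjoint positive sequences to equi-integrable ones, because a bounded sequence in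
  \<open>L\<^sub>1\<close> which is not equi-integrable has a subsequence equivalent to the unit vector basis of \<open>\<ell>\<^sub>1\<close>; hence
  \<open>T p\<^sub>n\<close> is weakly null (otherwise \<open>p\<^sub>n - q\<^sub>n\<close> would be equivalent to the basis of \<open>\<ell>\<^sub>1\<close>, against the
  equi-integrability of its image).  LSS yields signed combinations of the \<open>p\<^sub>n\<close> with small image; along a
  subsequence, Burkholder's weak type inequality for martingale transforms and equi-integrability make the
  image small also for the absolute values of the coefficients.  Positive combinations act on \<open>p\<close> and \<open>q\<close>
  at the same time, so a block sequence of \<open>p\<^sub>n - q\<^sub>n\<close> has small image on its positive parts, and a second
  application, to the negative parts of the blocks, contradicts the lower bound.\<close>

section \<open>Disjointness in Banach lattices\<close>

text \<open>The proof is shaped by an asymmetry between domain and range. Disjoint vectors in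
  \<open>E\<close> are 1-unconditional, so the signs of coefficients can be changed there at no
  cost. Their images are not: a weakly null sequence in L_1 need not have an unconditional
  subsequence, and martingale transforms are unbounded on L_1. What survives is the weak type bound,
  whence the detour through smallness in measure; uniform control of the mass on small sets turns
  this back into smallness in norm.

  Nonnegative coefficients are wanted because the combination of the p_n - q_n with such
  coefficients has the same combinations of p_n and of q_n as its two parts, so blocks keep the form
  of the original sequence. Signed coefficients would mix the two parts. Lattice strict singularity
  applied to the p_n gives no information on the q_n, so the two smallness requirements are met one
  after the other, the first one in a summable way so that it survives the second.

  Only countably many images of p_n and q_n occur. They live on a common sigma-finite set, and
  dividing by an integrable density makes the measure finite.\<close>

lemma abs_scaleR_lattice: "\<bar>c *\<^sub>R x\<bar> = \<bar>c\<bar> *\<^sub>R \<bar>x\<bar>" for x :: "'a::banach_lattice"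
proof -
  have le: "\<bar>c *\<^sub>R x\<bar> \<le> c *\<^sub>R \<bar>x\<bar>" if "c \<ge> 0" for c and x :: 'a
    using scaleR_left_mono[OF abs_ge_self that, of x] scaleR_left_mono[OF abs_ge_minus_self that, of x]
    by (intro abs_leI) simp_all
  have eq: "\<bar>c *\<^sub>R x\<bar> = c *\<^sub>R \<bar>x\<bar>" if "c > 0" for c and x :: 'a
  proof (rule antisym)
    have "\<bar>x\<bar> \<le> inverse c *\<^sub>R \<bar>c *\<^sub>R x\<bar>"
      using le[of "inverse c" "c *\<^sub>R x"] that by simp
    then have "c *\<^sub>R \<bar>x\<bar> \<le> c *\<^sub>R (inverse c *\<^sub>R \<bar>c *\<^sub>R x\<bar>)"
      using that by (intro scaleR_left_mono) auto
    then show "c *\<^sub>R \<bar>x\<bar> \<le> \<bar>c *\<^sub>R x\<bar>" using that by simp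
  qed (use le that in auto)
  consider "c > 0" | "c = 0" | "c < 0" by linarith
  then show ?thesis
  proof cases
    case 3
    have "\<bar>c *\<^sub>R x\<bar> = \<bar>(-c) *\<^sub>R x\<bar>" by simp
    then show ?thesis using eq[of "-c" x] 3 by simp
  qed (use eq in auto)
qed

lemma norm_abs_lattice [simp]: "norm \<bar>x\<bar> = norm x" for x :: "'a::banach_lattice"
  by (rule antisym) (auto intro: norm_mono_abs)

lemma norm_mono_lattice: "0 \<le> x \<Longrightarrow> x \<le> y \<Longrightarrow> norm x \<le> norm y" for x :: "'a::banach_lattice"
  by (rule norm_mono_abs) (auto simp: abs_of_nonneg)

text \<open>The lattice operations are recovered from the modulus, so closure of a subspace under
  \<open>abs\<close> is enough for a sublattice. The modulus is 1-Lipschitz and explicit on disjoint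
  sums, hence easy to follow through spans and closures.\<close>

lemma sup_eq_abs: "sup x y = (1/2) *\<^sub>R (x + y + \<bar>x - y\<bar>)" for x y :: "'a::banach_lattice"
proof -
  have "x + y + \<bar>x - y\<bar> = sup (x + x) (y + y)"
    by (simp add: abs_lattice add_sup_distrib_left)
  also have "\<dots> = 2 *\<^sub>R sup x y"
  proof (rule antisym)
    show "sup (x + x) (y + y) \<le> 2 *\<^sub>R sup x y"
      by (simp add: scaleR_2 add_mono)
    have "(1/2) *\<^sub>R (x + x) \<le> (1/2) *\<^sub>R sup (x + x) (y + y)"
      "(1/2) *\<^sub>R (y + y) \<le> (1/2) *\<^sub>R sup (x + x) (y + y)"
      by (intro scaleR_left_mono; simp)+
    then have "sup x y \<le> (1/2) *\<^sub>R sup (x + x) (y + y)"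
      by (simp flip: scaleR_2)
    from scaleR_left_mono[OF this, of 2] show "2 *\<^sub>R sup x y \<le> sup (x + x) (y + y)" by simp
  qed
  finally show ?thesis by simp
qed

lemma inf_eq_abs: "inf x y = (1/2) *\<^sub>R (x + y - \<bar>x - y\<bar>)" for x y :: "'a::banach_lattice"
proof -
  have "inf x y = - sup (-x) (-y)" by simp
  also have "\<dots> = (1/2) *\<^sub>R (x + y - \<bar>x - y\<bar>)"
    unfolding sup_eq_abs
    by (simp add: algebra_simps abs_minus_commute)
  finally show ?thesis .
qed

lemma sublattice_if_abs_closed:
  assumes "subspace S" "\<And>x. x \<in> S \<Longrightarrow> \<bar>x\<bar> \<in> S" "x \<in> S" "y \<in> S"
  shows "sup x y \<in> S" "inf x y \<in> (S :: 'a::banach_lattice set)"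
  unfolding sup_eq_abs inf_eq_abs using assms by (auto intro!: subspace_scale subspace_add subspace_diff)

lemma norm_abs_diff_le: "norm (\<bar>x\<bar> - \<bar>y\<bar>) \<le> norm (x - y)" for x y :: "'a::banach_lattice"
  by (rule norm_mono_abs) (rule abs_triangle_ineq3)

lemma continuous_on_abs_lattice: "continuous_on S (abs :: 'a::banach_lattice \<Rightarrow> 'a)"
  unfolding continuous_on_iff dist_norm using norm_abs_diff_le le_less_trans by blast

definition lat_disjoint :: "'a::banach_lattice \<Rightarrow> 'a \<Rightarrow> bool" where
  "lat_disjoint x y \<longleftrightarrow> inf \<bar>x\<bar> \<bar>y\<bar> = 0"

lemma lat_disjoint_sym: "lat_disjoint x y \<Longrightarrow> lat_disjoint y x"
  by (simp add: lat_disjoint_def inf_commute)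

text \<open>The test element \<open>w\<close> ranges over all elements, negative ones included. This
  lets \<open>lat_disjoint_add\<close> insert \<open>w - \<bar>z\<bar>\<close> without any
  decomposition property.\<close>

lemma lat_disjoint_iff: "lat_disjoint x y \<longleftrightarrow> (\<forall>w. w \<le> \<bar>x\<bar> \<longrightarrow> w \<le> \<bar>y\<bar> \<longrightarrow> w \<le> 0)"
proof
  assume "lat_disjoint x y"
  then show "\<forall>w. w \<le> \<bar>x\<bar> \<longrightarrow> w \<le> \<bar>y\<bar> \<longrightarrow> w \<le> 0"
    unfolding lat_disjoint_def by (metis inf.boundedI)
next
  assume "\<forall>w. w \<le> \<bar>x\<bar> \<longrightarrow> w \<le> \<bar>y\<bar> \<longrightarrow> w \<le> 0"
  then show "lat_disjoint x y"
    unfolding lat_disjoint_def by (intro antisym) auto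
qed

lemma lat_disjoint_mono: "lat_disjoint x y \<Longrightarrow> \<bar>x'\<bar> \<le> \<bar>x\<bar> \<Longrightarrow> lat_disjoint x' y"
  unfolding lat_disjoint_iff using order_trans by blast

lemma lat_disjoint_0 [simp]: "lat_disjoint 0 y" "lat_disjoint y 0"
  by (auto simp: lat_disjoint_def inf_absorb1 inf_absorb2)

lemma lat_disjoint_add:
  assumes "lat_disjoint x y" "lat_disjoint x z"
  shows "lat_disjoint x (y + z)"
  unfolding lat_disjoint_iff
proof (intro allI impI)
  fix w assume w: "w \<le> \<bar>x\<bar>" "w \<le> \<bar>y + z\<bar>"
  then have "w \<le> \<bar>y\<bar> + \<bar>z\<bar>" using abs_triangle_ineq order_trans by blast
  then have "w - \<bar>z\<bar> \<le> \<bar>y\<bar>" by (simp add: algebra_simps)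
  moreover have "w - \<bar>z\<bar> \<le> \<bar>x\<bar>" using w(1) by (metis abs_ge_zero diff_left_mono diff_zero order_trans)
  ultimately have "w - \<bar>z\<bar> \<le> 0" using assms(1) unfolding lat_disjoint_iff by blast
  then have "w \<le> \<bar>z\<bar>" by simp
  then show "w \<le> 0" using assms(2) w(1) unfolding lat_disjoint_iff by blast
qed

lemma lat_disjoint_scaleR:
  assumes "lat_disjoint x y"
  shows "lat_disjoint x (c *\<^sub>R y)"
  unfolding lat_disjoint_iff
proof (intro allI impI)
  fix w assume w: "w \<le> \<bar>x\<bar>" "w \<le> \<bar>c *\<^sub>R y\<bar>"
  \<comment> \<open>With a factor that is at least 1 and dominates \<bar>c\<bar>, the element
    \<open>inverse C *\<^sub>R w\<close> lies below both moduli. Dividing by \<bar>c\<bar> would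
    lose the bound by \<bar>x\<bar> for small \<open>c\<close>.\<close>
  define C where "C = max 1 \<bar>c\<bar>"
  have C: "C \<ge> 1" "\<bar>c\<bar> \<le> C" by (auto simp: C_def)
  have "w \<le> C *\<^sub>R \<bar>y\<bar>"
    using w(2) scaleR_right_mono[OF C(2), of "\<bar>y\<bar>"] by (auto simp: abs_scaleR_lattice)
  then have "inverse C *\<^sub>R w \<le> inverse C *\<^sub>R C *\<^sub>R \<bar>y\<bar>"
    using C by (intro scaleR_left_mono) auto
  then have 1: "inverse C *\<^sub>R w \<le> \<bar>y\<bar>" using C by simp
  have "w \<le> C *\<^sub>R \<bar>x\<bar>"
    using w(1) scaleR_right_mono[OF C(1), of "\<bar>x\<bar>"] by auto
  then have "inverse C *\<^sub>R w \<le> inverse C *\<^sub>R C *\<^sub>R \<bar>x\<bar>"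
    using C by (intro scaleR_left_mono) auto
  then have "inverse C *\<^sub>R w \<le> \<bar>x\<bar>" using C by simp
  with 1 have "inverse C *\<^sub>R w \<le> 0" using assms by (simp add: lat_disjoint_iff)
  then have "C *\<^sub>R (inverse C *\<^sub>R w) \<le> C *\<^sub>R 0" using C by (intro scaleR_left_mono) auto
  then show "w \<le> 0" using C by simp
qed

lemma lat_disjoint_scaleR2: "lat_disjoint x y \<Longrightarrow> lat_disjoint (b *\<^sub>R x) (c *\<^sub>R y)"
  by (rule lat_disjoint_scaleR[OF lat_disjoint_sym[OF lat_disjoint_scaleR[OF lat_disjoint_sym]]])

lemma lat_disjoint_sum: "(\<And>i. i \<in> I \<Longrightarrow> lat_disjoint x (y i)) \<Longrightarrow> lat_disjoint x (\<Sum>i\<in>I. y i)"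
  by (induction I rule: infinite_finite_induct) (auto intro: lat_disjoint_add)

text \<open>Disjointness turns \<bar>\<bar>x\<bar> - \<bar>y\<bar>\<bar> into \<bar>x\<bar> +
  \<bar>y\<bar>; the nontrivial inequality is then the reverse triangle inequality for
  \<open>x\<close> and \<open>- y\<close>.\<close>

lemma abs_add_disjoint:
  assumes "lat_disjoint x y" shows "\<bar>x + y\<bar> = \<bar>x\<bar> + \<bar>y\<bar>"
proof (rule antisym)
  have "\<bar>x\<bar> + \<bar>y\<bar> - (\<bar>(\<bar>x\<bar>) - (\<bar>y\<bar>)\<bar>) = 2 *\<^sub>R inf \<bar>x\<bar> \<bar>y\<bar>"
    unfolding inf_eq_abs by simp
  then have "\<bar>x\<bar> + \<bar>y\<bar> = \<bar>(\<bar>x\<bar>) - (\<bar>- y\<bar>)\<bar>" using assms by (simp add: lat_disjoint_def)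
  also have "\<dots> \<le> \<bar>x - - y\<bar>" by (rule abs_triangle_ineq3)
  finally show "\<bar>x\<bar> + \<bar>y\<bar> \<le> \<bar>x + y\<bar>" by simp
qed (rule abs_triangle_ineq)

lemma disjoint_vectors_iff: "disjoint_vectors x \<longleftrightarrow> (\<forall>m n. m \<noteq> n \<longrightarrow> lat_disjoint (x m) (x n))"
  by (auto simp: disjoint_vectors_def lat_disjoint_def)

section \<open>Unconditionality of disjoint sequences\<close>

lemma abs_sum_disjoint:
  assumes "disjoint_vectors x" "finite I"
  shows "\<bar>\<Sum>i\<in>I. a i *\<^sub>R x i\<bar> = (\<Sum>i\<in>I. \<bar>a i\<bar> *\<^sub>R \<bar>x i\<bar>)"
  using assms(2)
proof induction
  case (insert j I)
  have "lat_disjoint (a j *\<^sub>R x j) (\<Sum>i\<in>I. a i *\<^sub>R x i)"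
  proof (rule lat_disjoint_sum)
    fix i assume "i \<in> I"
    then have "lat_disjoint (x j) (x i)" using insert(2) assms(1) unfolding disjoint_vectors_iff by metis
    then show "lat_disjoint (a j *\<^sub>R x j) (a i *\<^sub>R x i)"
      by (rule lat_disjoint_scaleR2)
  qed
  then show ?case using insert by (simp add: abs_add_disjoint abs_scaleR_lattice)
qed simp

text \<open>The triangle inequality bounds the modulus of the left sum by the sum of moduli, and
  disjointness of \<open>z\<close> makes the modulus of the right sum equal to such a sum. All
  comparisons between combinations of \<open>p\<close>, \<open>q\<close> and \<open>p + q\<close>,
  and all changes of sign in the domain, go through this lemma.\<close>

lemma norm_sum_disjoint_mono:
  assumes "disjoint_vectors z" "finite I"
    and "\<And>i. i \<in> I \<Longrightarrow> \<bar>y i\<bar> \<le> \<bar>z i\<bar>" "\<And>i. i \<in> I \<Longrightarrow> \<bar>a i\<bar> \<le> \<bar>b i\<bar>"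
  shows "norm (\<Sum>i\<in>I. a i *\<^sub>R y i) \<le> norm (\<Sum>i\<in>I. b i *\<^sub>R z i)"
proof (rule norm_mono_abs)
  have "\<bar>\<Sum>i\<in>I. a i *\<^sub>R y i\<bar> \<le> (\<Sum>i\<in>I. \<bar>a i *\<^sub>R y i\<bar>)" by (rule sum_abs)
  also have "\<dots> \<le> (\<Sum>i\<in>I. \<bar>b i\<bar> *\<^sub>R \<bar>z i\<bar>)"
  proof (rule sum_mono)
    fix i assume i: "i \<in> I"
    have "\<bar>a i *\<^sub>R y i\<bar> = \<bar>a i\<bar> *\<^sub>R \<bar>y i\<bar>" by (rule abs_scaleR_lattice)
    also have "\<dots> \<le> \<bar>a i\<bar> *\<^sub>R \<bar>z i\<bar>" by (intro scaleR_left_mono assms i) auto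
    also have "\<dots> \<le> \<bar>b i\<bar> *\<^sub>R \<bar>z i\<bar>" by (intro scaleR_right_mono assms i) auto
    finally show "\<bar>a i *\<^sub>R y i\<bar> \<le> \<bar>b i\<bar> *\<^sub>R \<bar>z i\<bar>" .
  qed
  also have "\<dots> = \<bar>\<Sum>i\<in>I. b i *\<^sub>R z i\<bar>" using abs_sum_disjoint[OF assms(1,2)] by simp
  finally show "\<bar>\<Sum>i\<in>I. a i *\<^sub>R y i\<bar> \<le> \<bar>\<Sum>i\<in>I. b i *\<^sub>R z i\<bar>" .
qed

lemma norm_sum_disjoint_mono_subset:
  assumes "disjoint_vectors z" "finite I" "J \<subseteq> I"
  shows "norm (\<Sum>i\<in>J. b i *\<^sub>R z i) \<le> norm (\<Sum>i\<in>I. b i *\<^sub>R z i)"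
proof -
  have "(\<Sum>i\<in>J. b i *\<^sub>R z i) = (\<Sum>i\<in>I. (if i \<in> J then b i else 0) *\<^sub>R z i)"
    using assms by (intro sum.mono_neutral_cong_left) auto
  also have "norm \<dots> \<le> norm (\<Sum>i\<in>I. b i *\<^sub>R z i)"
    by (rule norm_sum_disjoint_mono[OF assms(1,2)]) auto
  finally show ?thesis .
qed

lemma norm_coeff_le_norm_sum:
  assumes "disjoint_vectors z" "finite I" "j \<in> I"
  shows "\<bar>b j\<bar> * norm (z j) \<le> norm (\<Sum>i\<in>I. b i *\<^sub>R z i)"
  using norm_sum_disjoint_mono_subset[OF assms(1,2), of "{j}" b] assms(3) by simp

lemma disjoint_vectors_mono:
  assumes "disjoint_vectors z" "\<And>i. \<bar>y i\<bar> \<le> \<bar>z i\<bar>"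
  shows "disjoint_vectors y"
  using assms unfolding disjoint_vectors_iff by (metis lat_disjoint_mono lat_disjoint_sym)

lemma disjoint_vectors_comp:
  assumes "disjoint_vectors z" "inj r"
  shows "disjoint_vectors (\<lambda>i. z (r i))"
  using assms unfolding disjoint_vectors_iff by (auto simp: inj_def)

lemma disjoint_vectors_blocks:
  assumes "disjoint_vectors z" "\<And>k l. k \<noteq> l \<Longrightarrow> I k \<inter> I l = {}"
  shows "disjoint_vectors (\<lambda>k. \<Sum>i\<in>I k. a k i *\<^sub>R z i)"
  unfolding disjoint_vectors_iff
proof (intro allI impI)
  fix k l :: nat assume kl: "k \<noteq> l"
  have "lat_disjoint (z i) (z j)" if "i \<in> I k" "j \<in> I l" for i j
  proof -
    have "i \<noteq> j" using assms(2)[OF kl] that by auto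
    then show ?thesis using assms(1) unfolding disjoint_vectors_iff by metis
  qed
  then have "lat_disjoint (a k i *\<^sub>R z i) (\<Sum>i\<in>I l. a l i *\<^sub>R z i)" if "i \<in> I k" for i
    using that by (intro lat_disjoint_sum lat_disjoint_scaleR2) auto
  then have "lat_disjoint (\<Sum>i\<in>I l. a l i *\<^sub>R z i) (\<Sum>i\<in>I k. a k i *\<^sub>R z i)"
    by (intro lat_disjoint_sum) (rule lat_disjoint_sym)
  then show "lat_disjoint (\<Sum>i\<in>I k. a k i *\<^sub>R z i) (\<Sum>i\<in>I l. a l i *\<^sub>R z i)"
    by (rule lat_disjoint_sym)
qed

section \<open>Spans of disjoint sequences\<close>

lemma span_range_finite_sum:
  assumes "v \<in> span (range u)" "inj u"
  obtains I a where "finite I" "v = (\<Sum>i\<in>I. a i *\<^sub>R u i)"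
proof -
  from assms(1) obtain S r where S: "finite S" "S \<subseteq> range u" "v = (\<Sum>s\<in>S. r s *\<^sub>R s)"
    unfolding span_explicit by blast
  have "v = (\<Sum>i\<in>u -` S. r (u i) *\<^sub>R u i)"
    unfolding S(3) using S(2) assms(2)
    by (intro sum.reindex_cong[of u]) (auto intro: inj_on_subset)
  then show ?thesis using that[of "u -` S" "\<lambda>i. r (u i)"] S(1) assms(2) by (simp add: finite_vimageI)
qed

lemma disjoint_nonzero_inj:
  assumes "disjoint_vectors u" "\<And>n. u n \<noteq> 0"
  shows "inj u"
proof (rule injI)
  fix m n assume "u m = u n"
  then show "m = n" using assms by (auto simp: disjoint_vectors_def) (metis abs_eq_0 inf.idem)
qed

lemma disjoint_nonzero_independent:
  assumes "disjoint_vectors u" "\<And>n. u n \<noteq> 0"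
  shows "independent (range u)"
  unfolding dependent_explicit
proof (safe)
  fix S r v assume S: "finite S" "S \<subseteq> range u" "(\<Sum>v\<in>S. r v *\<^sub>R v) = 0" "v \<in> S" "r v \<noteq> (0::real)"
  note inj = disjoint_nonzero_inj[OF assms]
  have fin: "finite (u -` S)" using S(1) inj by (simp add: finite_vimageI)
  have eq: "(\<Sum>i\<in>u -` S. r (u i) *\<^sub>R u i) = 0"
    unfolding S(3)[symmetric] using S(2) inj
    by (intro sum.reindex_cong[symmetric, of u]) (auto intro: inj_on_subset)
  obtain j where j: "v = u j" using S by auto
  have "\<bar>r (u j)\<bar> * norm (u j) \<le> norm (\<Sum>i\<in>u -` S. r (u i) *\<^sub>R u i)"
    using norm_coeff_le_norm_sum[OF assms(1) fin, of j "\<lambda>i. r (u i)"] S j by auto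
  then show False using eq S j assms by (simp add: mult_le_0_iff)
qed

lemma infinite_dimensional_span_disjoint:
  assumes "disjoint_vectors u" "\<And>n. u n \<noteq> 0" "range u \<subseteq> S"
  shows "infinite_dimensional S"
  unfolding infinite_dimensional_def
proof
  assume "\<exists>B. finite B \<and> S \<subseteq> span B"
  then obtain B where B: "finite B" "range u \<subseteq> span B" using assms(3) by blast
  then have "finite (range u)"
    using independent_span_bound disjoint_nonzero_independent[OF assms(1,2)] by blast
  then show False using disjoint_nonzero_inj[OF assms(1,2)] finite_imageD by blast
qed

lemma subspace_closure_span: "subspace (closure (span A))" for A :: "'a::real_normed_vector set"
proof (rule subspaceI)
  show "0 \<in> closure (span A)" using closure_subset span_zero by blast
  show "x + y \<in> closure (span A)" if xy: "x \<in> closure (span A)" "y \<in> closure (span A)" for x y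
  proof -
    obtain f where f: "\<forall>n::nat. f n \<in> span A" "f \<longlonglongrightarrow> x" using xy(1) unfolding closure_sequential by metis
    obtain g where g: "\<forall>n::nat. g n \<in> span A" "g \<longlonglongrightarrow> y" using xy(2) unfolding closure_sequential by metis
    have "\<forall>n. f n + g n \<in> span A" "(\<lambda>n. f n + g n) \<longlonglongrightarrow> x + y"
      using f g by (auto intro: span_add tendsto_add)
    then show ?thesis unfolding closure_sequential by metis
  qed
  show "c *\<^sub>R x \<in> closure (span A)" if x: "x \<in> closure (span A)" for c x
  proof -
    obtain f where f: "\<forall>n::nat. f n \<in> span A" "f \<longlonglongrightarrow> x" using x unfolding closure_sequential by metis
    have "\<forall>n. c *\<^sub>R f n \<in> span A" "(\<lambda>n. c *\<^sub>R f n) \<longlonglongrightarrow> c *\<^sub>R x"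
      using f by (auto intro: span_scale tendsto_scaleR)
    then show ?thesis unfolding closure_sequential by metis
  qed
qed

text \<open>Positivity is essential: the modulus of a combination of positive disjoint vectors is
  again a combination of the same vectors. Continuity of the modulus carries this over to the
  closure. Through this lemma lattice strict singularity becomes a statement about positive disjoint
  sequences.\<close>

lemma closed_sublattice_span_disjoint:
  assumes "disjoint_vectors u" "\<And>n. u n \<ge> 0" "\<And>n. u n \<noteq> 0"
  shows "closed_sublattice (closed_span (range u))"
proof -
  have sub: "subspace (closed_span (range u))"
    unfolding closed_span_def by (rule subspace_closure_span)
  have "\<bar>v\<bar> \<in> span (range u)" if v: "v \<in> span (range u)" for v
  proof -
    obtain I a where I: "finite I" "v = (\<Sum>i\<in>I. a i *\<^sub>R u i)"
      using span_range_finite_sum[OF v disjoint_nonzero_inj] assms by blast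
    have "\<bar>v\<bar> = (\<Sum>i\<in>I. \<bar>a i\<bar> *\<^sub>R u i)"
      using I abs_sum_disjoint[OF assms(1) I(1)] assms(2) by (simp add: abs_of_nonneg)
    also have "\<dots> \<in> span (range u)" by (intro span_sum span_scale span_base) auto
    finally show ?thesis .
  qed
  then have "abs ` span (range u) \<subseteq> closed_span (range u)"
    using closure_subset unfolding closed_span_def by blast
  then have "abs ` closed_span (range u) \<subseteq> closed_span (range u)"
    unfolding closed_span_def
    by (intro image_closure_subset continuous_on_abs_lattice) auto
  then have "\<bar>x\<bar> \<in> closed_span (range u)" if "x \<in> closed_span (range u)" for x
    using that by blast
  then show ?thesis
    unfolding closed_sublattice_def using sub sublattice_if_abs_closed[OF sub]
    by (auto simp: closed_span_def)
qed

section \<open>Disjoint sequences in infinite-dimensional sublattices\<close>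

text \<open>A monotone norm makes the order Archimedean: the positive part of \<open>y\<close> lies
  below every \<open>d *\<^sub>R e\<close>, so its norm is arbitrarily small.\<close>

lemma le_zero_archimedean:
  fixes y e :: "'a::banach_lattice"
  assumes "\<And>d::real. d > 0 \<Longrightarrow> y \<le> d *\<^sub>R e" "0 \<le> e"
  shows "y \<le> 0"
proof -
  have le: "norm (pprt y) \<le> d * norm e" if "d > 0" for d
  proof -
    have "0 \<le> d *\<^sub>R e" using assms(2) that by (simp add: scaleR_nonneg_nonneg)
    then have "pprt y \<le> d *\<^sub>R e" using assms(1)[OF that] by (simp add: pprt_def)
    then have "norm (pprt y) \<le> norm (d *\<^sub>R e)" by (intro norm_mono_lattice) auto
    then show ?thesis using that by simp
  qed
  have "norm (pprt y) \<le> 0 + d" if "d > 0" for d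
  proof -
    \<comment> \<open>The added 1 covers the case \<open>e = 0\<close>.\<close>
    have "norm (pprt y) \<le> d / (norm e + 1) * norm e"
      by (rule le) (use that in \<open>auto intro!: divide_pos_pos add_nonneg_pos\<close>)
    also have "\<dots> \<le> d"
    proof -
      have "norm e + 1 > 0" by (simp add: add_nonneg_pos)
      then show ?thesis using that by (simp add: pos_divide_le_eq distrib_left)
    qed
    finally show ?thesis by simp
  qed
  then have "norm (pprt y) \<le> 0" by (rule field_le_epsilon)
  then show ?thesis by (simp add: le_zero_iff_zero_pprt)
qed

text \<open>The splitting parts range over \<open>S\<close> only: an atom of \<open>S\<close> may be
  divisible in the ambient lattice.\<close>

definition lat_atom :: "'a::banach_lattice set \<Rightarrow> 'a \<Rightarrow> bool" where
  "lat_atom S e \<longleftrightarrow> e \<in> S \<and> 0 < e \<and>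
    \<not> (\<exists>v\<in>S. \<exists>w\<in>S. 0 < v \<and> 0 < w \<and> v \<le> e \<and> w \<le> e \<and> inf v w = 0)"

lemma inf_pprt_nprt: "inf (pprt a) (- nprt a) = 0" for a :: "'a::banach_lattice"
proof -
  have "pprt a - (- nprt a) = a" using prts[of a] by simp
  moreover have "\<bar>a\<bar> = pprt a + - nprt a" by (simp add: abs_prts)
  ultimately show ?thesis unfolding inf_eq_abs by simp
qed

lemma max_multiple_below:
  fixes x e :: "'a::banach_lattice"
  assumes "0 \<le> x" "0 < e"
  obtains c where "0 \<le> c" "c *\<^sub>R e \<le> x" "\<And>d. d *\<^sub>R e \<le> x \<Longrightarrow> d \<le> c"
proof -
  define A where "A = {d. 0 \<le> d \<and> d *\<^sub>R e \<le> x}"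
  have "0 \<in> A" using assms by (simp add: A_def)
  have bdd: "d \<le> norm x / norm e" if "d \<in> A" for d
  proof -
    have "norm (d *\<^sub>R e) \<le> norm x"
      using that assms by (intro norm_mono_lattice) (auto simp: A_def intro!: scaleR_nonneg_nonneg)
    then show ?thesis using assms that by (auto simp: A_def field_simps)
  qed
  then have bdd': "bdd_above A" by (auto simp: bdd_above_def)
  have "Sup A *\<^sub>R e - x \<le> 0"
  proof (rule le_zero_archimedean)
    fix d :: real assume "d > 0"
    then obtain l where l: "l \<in> A" "l > Sup A - d"
      using less_cSupD[of A "Sup A - d"] \<open>0 \<in> A\<close> by auto
    have "(Sup A - d) *\<^sub>R e \<le> l *\<^sub>R e" using l assms by (intro scaleR_right_mono) auto
    also have "\<dots> \<le> x" using l by (simp add: A_def)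
    finally show "Sup A *\<^sub>R e - x \<le> d *\<^sub>R e" by (simp add: algebra_simps)
  qed (use assms in auto)
  moreover have "0 \<le> Sup A" using \<open>0 \<in> A\<close> bdd' by (rule cSup_upper)
  moreover have "d \<le> Sup A" if "d *\<^sub>R e \<le> x" for d
  proof (cases "d \<ge> 0")
    case True
    then show ?thesis using that bdd' by (intro cSup_upper) (auto simp: A_def)
  qed (use \<open>0 \<le> Sup A\<close> in auto)
  ultimately show ?thesis using that[of "Sup A"] by simp
qed

text \<open>Let \<open>c\<close> be the largest multiple of \<open>e\<close> below \<open>y\<close>,
  and let \<open>l\<close> be slightly larger. The positive and negative parts of
  \<open>y - l *\<^sub>R e\<close> are disjoint elements of \<open>S\<close> below \<open>e\<close>,
  so one of them vanishes. A vanishing negative part would contradict the maximality of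
  \<open>c\<close>; hence \<open>y\<close> lies below every such \<open>l *\<^sub>R e\<close>. The
  case distinction on \<open>l \<le> 1\<close> is there because only then is the negative part below
  \<open>e\<close>.\<close>

lemma lat_atom_multiple:
  fixes S :: "'a::banach_lattice set"
  assumes S: "subspace S" "\<And>x y. x \<in> S \<Longrightarrow> y \<in> S \<Longrightarrow> sup x y \<in> S"
    and e: "lat_atom S e" and y: "y \<in> S" "0 \<le> y" "y \<le> e"
  obtains c where "0 \<le> c" "y = c *\<^sub>R e"
proof -
  have e0: "0 < e" "e \<in> S" using e by (auto simp: lat_atom_def)
  obtain c where c: "0 \<le> c" "c *\<^sub>R e \<le> y" "\<And>d. d *\<^sub>R e \<le> y \<Longrightarrow> d \<le> c"
    using max_multiple_below[OF y(2) e0(1)] by blast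
  have "y - c *\<^sub>R e \<le> 0"
  proof (rule le_zero_archimedean)
    fix d :: real assume d: "d > 0"
    define l where "l = c + d"
    show "y - c *\<^sub>R e \<le> d *\<^sub>R e"
    proof (cases "l \<le> 1")
      case False
      have "y \<le> 1 *\<^sub>R e" using y by simp
      also have "\<dots> \<le> l *\<^sub>R e" using False e0 by (intro scaleR_right_mono) auto
      finally show ?thesis by (simp add: l_def algebra_simps)
    next
      case True
      define v w where "v = pprt (y - l *\<^sub>R e)" and "w = - nprt (y - l *\<^sub>R e)"
      have w': "w = pprt (l *\<^sub>R e - y)" unfolding w_def by (simp flip: pprt_neg)
      have l0: "0 \<le> l *\<^sub>R e" using c d e0 by (auto simp: l_def intro!: scaleR_nonneg_nonneg)
      have "v \<in> S" "w \<in> S" unfolding v_def w' pprt_def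
        using S(1) y e0 by (auto intro!: S(2) subspace_diff subspace_scale subspace_0)
      moreover have "v \<le> e"
      proof -
        have "y - l *\<^sub>R e \<le> y" using l0 by simp
        then have "y - l *\<^sub>R e \<le> e" using y(3) by (rule order_trans)
        then show ?thesis unfolding v_def pprt_def using e0 by auto
      qed
      moreover have "w \<le> e"
      proof -
        have "l *\<^sub>R e - y \<le> l *\<^sub>R e" using y by simp
        also have "\<dots> \<le> 1 *\<^sub>R e" using True e0 by (intro scaleR_right_mono) auto
        finally show ?thesis unfolding w' pprt_def using e0 by auto
      qed
      moreover have "inf v w = 0" unfolding v_def w_def by (rule inf_pprt_nprt)
      moreover have "0 \<le> v" "0 \<le> w" by (auto simp: v_def w')
      ultimately have "v = 0 \<or> w = 0" using e unfolding lat_atom_def by (metis order_le_imp_less_or_eq)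
      then show ?thesis
      proof
        assume "v = 0"
        then have "y - l *\<^sub>R e \<le> 0" by (simp add: v_def le_zero_iff_zero_pprt)
        then show ?thesis by (simp add: l_def algebra_simps)
      next
        assume "w = 0"
        then have "l *\<^sub>R e \<le> y" by (simp add: w' flip: le_zero_iff_zero_pprt)
        then show ?thesis using c(3)[of l] d by (simp add: l_def)
      qed
    qed
  qed (use e0 in auto)
  then have "y = c *\<^sub>R e" using c(2) by simp
  then show ?thesis using that c(1) by blast
qed

text \<open>For disjoint positive elements the sum coincides with the supremum.\<close>

lemma add_le_if_disjoint:
  fixes x y z :: "'a::banach_lattice"
  assumes "lat_disjoint y z" "0 \<le> y" "0 \<le> z" "y \<le> x" "z \<le> x"
  shows "y + z \<le> x"
proof -
  have "y + z = inf y z + sup y z" using add_eq_inf_sup[of y z] by (simp add: add.commute)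
  also have "\<dots> = sup y z" using assms by (simp add: lat_disjoint_def abs_of_nonneg)
  finally show ?thesis using assms by simp
qed

lemma sum_le_if_disjoint:
  fixes x :: "'a::banach_lattice"
  assumes "finite I" "0 \<le> x" "\<And>i. i \<in> I \<Longrightarrow> 0 \<le> y i" "\<And>i. i \<in> I \<Longrightarrow> y i \<le> x"
    "\<And>i j. i \<in> I \<Longrightarrow> j \<in> I \<Longrightarrow> i \<noteq> j \<Longrightarrow> lat_disjoint (y i) (y j)"
  shows "(\<Sum>i\<in>I. y i) \<le> x"
  using assms
proof induction
  case (insert i I)
  have "y i + (\<Sum>j\<in>I. y j) \<le> x"
  proof (rule add_le_if_disjoint)
    show "lat_disjoint (y i) (\<Sum>j\<in>I. y j)"
    proof (rule lat_disjoint_sum)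
      fix j assume "j \<in> I"
      then show "lat_disjoint (y i) (y j)" using insert(2) by (intro insert.prems(4)) auto
    qed
    show "(\<Sum>j\<in>I. y j) \<le> x" using insert.prems by (intro insert.IH) auto
  qed (use insert.prems in \<open>auto intro: sum_nonneg\<close>)
  then show ?case using insert by simp
qed simp

text \<open>Subtract from a positive \<open>x\<close> the maximal multiples of all the atoms. A
  nonzero remainder would dominate an atom \<open>a\<close>, which meets some \<open>e i\<close>.
  Then \<open>inf a (e i)\<close> is a positive multiple of \<open>e i\<close> and could be added to
  the multiple already subtracted, against its maximality.\<close>

lemma span_atoms:
  fixes S :: "'a::banach_lattice set" and e :: "nat \<Rightarrow> 'a"
  assumes S: "subspace S" "\<And>x y. x \<in> S \<Longrightarrow> y \<in> S \<Longrightarrow> sup x y \<in> S"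
      "\<And>x y. x \<in> S \<Longrightarrow> y \<in> S \<Longrightarrow> inf x y \<in> S"
    and atoms: "\<And>i. i < n \<Longrightarrow> lat_atom S (e i)"
    and disj: "\<And>i j. i < n \<Longrightarrow> j < n \<Longrightarrow> i \<noteq> j \<Longrightarrow> lat_disjoint (e i) (e j)"
    and maximal: "\<And>a. lat_atom S a \<Longrightarrow> \<exists>i<n. inf a (e i) \<noteq> 0"
    and below: "\<And>u. u \<in> S \<Longrightarrow> 0 < u \<Longrightarrow> \<exists>a\<le>u. lat_atom S a"
  shows "S \<subseteq> span (e ` {..<n})"
proof
  have pos: "x \<in> span (e ` {..<n})" if x: "x \<in> S" "0 \<le> x" for x
  proof -
    have e: "0 < e i" "e i \<in> S" if "i < n" for i
      using atoms[OF that] by (auto simp: lat_atom_def)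
    have "\<exists>c. 0 \<le> c \<and> c *\<^sub>R e i \<le> x \<and> (\<forall>d. d *\<^sub>R e i \<le> x \<longrightarrow> d \<le> c)" if "i < n" for i
      using max_multiple_below[OF x(2) e(1)[OF that]] by metis
    then obtain c where c: "\<And>i. i < n \<Longrightarrow> 0 \<le> c i" "\<And>i. i < n \<Longrightarrow> c i *\<^sub>R e i \<le> x"
      "\<And>i d. i < n \<Longrightarrow> d *\<^sub>R e i \<le> x \<Longrightarrow> d \<le> c i"
      by metis
    define y where "y = (\<Sum>i<n. c i *\<^sub>R e i)"
    have "y \<le> x" unfolding y_def
      using x c e disj by (intro sum_le_if_disjoint lat_disjoint_scaleR2)
        (auto intro!: scaleR_nonneg_nonneg intro: less_imp_le)
    have yS: "y \<in> S" unfolding y_def using e S(1) by (intro subspace_sum subspace_scale) auto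
    have "x - y = 0"
    proof (rule ccontr)
      assume "x - y \<noteq> 0"
      then have "0 < x - y" using \<open>y \<le> x\<close> by auto
      moreover have "x - y \<in> S" using S(1) x yS by (intro subspace_diff) auto
      ultimately obtain a where a: "a \<le> x - y" "lat_atom S a" using below by metis
      then obtain i where i: "i < n" "inf a (e i) \<noteq> 0" using maximal by metis
      have a0: "0 < a" "a \<in> S" using a by (auto simp: lat_atom_def)
      obtain m where m: "0 \<le> m" "inf a (e i) = m *\<^sub>R e i"
        using lat_atom_multiple[OF S(1,2) atoms[OF i(1)], of "inf a (e i)"] S(3) a0 e[OF i(1)]
        by (metis inf.cobounded2 le_inf_iff less_imp_le)
      have "m > 0" using m i(2) by (cases "m = 0") auto
      have "c i *\<^sub>R e i \<le> y"
      proof -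
        have "sum (\<lambda>i. c i *\<^sub>R e i) {i} \<le> (\<Sum>i<n. c i *\<^sub>R e i)"
          using c e i(1) by (intro sum_mono2) (auto intro!: scaleR_nonneg_nonneg intro: less_imp_le)
        then show ?thesis by (simp add: y_def)
      qed
      moreover have "m *\<^sub>R e i \<le> x - y" using m(2) a(1) by (metis inf.cobounded1 order_trans)
      ultimately have "c i *\<^sub>R e i + m *\<^sub>R e i \<le> y + (x - y)" by (rule add_mono)
      then have "(c i + m) *\<^sub>R e i \<le> x" by (simp add: scaleR_add_left)
      then show False using c(3)[OF i(1)] \<open>m > 0\<close> by force
    qed
    then have "x = y" by simp
    also have "y \<in> span (e ` {..<n})" unfolding y_def by (intro span_sum span_scale span_base) auto
    finally show ?thesis .
  qed
  fix x assume x: "x \<in> S"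
  have "pprt x \<in> S" "- nprt x \<in> S" unfolding pprt_neg[symmetric] unfolding pprt_def
    using x S(1) by (auto intro!: S(2) subspace_0 subspace_neg)
  then have "pprt x - (- nprt x) \<in> span (e ` {..<n})"
    by (intro span_diff pos) auto
  then show "x \<in> span (e ` {..<n})" using prts[of x] by simp
qed

text \<open>There are two cases. If some positive element of \<open>S\<close> dominates no atom, it
  can be split again and again into disjoint pieces. Otherwise every positive element dominates an
  atom, and a finite disjoint family of atoms can always be enlarged, for a maximal one would span
  \<open>S\<close>.\<close>

lemma infinite_dimensional_disjoint_sequence:
  fixes S :: "'a::banach_lattice set"
  assumes S: "subspace S" "\<And>x y. x \<in> S \<Longrightarrow> y \<in> S \<Longrightarrow> sup x y \<in> S"
      "\<And>x y. x \<in> S \<Longrightarrow> y \<in> S \<Longrightarrow> inf x y \<in> S"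
    and inf: "infinite_dimensional S"
  obtains u :: "nat \<Rightarrow> 'a" where "disjoint_vectors u" "\<And>n. u n \<in> S" "\<And>n. 0 < u n"
proof (rule ccontr)
  assume *: "\<not> thesis"
  note found = that
  have none: False if u: "\<And>m n. m < n \<Longrightarrow> inf (u m) (u n) = 0" "\<And>n. u n \<in> S" "\<And>n. 0 < u n"
    for u :: "nat \<Rightarrow> 'a"
  proof -
    have "inf (u m) (u n) = 0" if "m \<noteq> n" for m n
    proof (cases "m < n")
      case False
      then show ?thesis using u(1)[of n m] that by (simp add: inf_commute)
    qed (use u in simp)
    then have "disjoint_vectors u"
      unfolding disjoint_vectors_def using u(3) by (simp add: abs_of_pos)
    then have thesis by (rule found) (use u in auto)
    then show False using * by contradiction
  qed
  have below: "\<exists>a\<le>u. lat_atom S a" if u: "u \<in> S" "0 < u" for u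
  proof (rule ccontr)
    assume bad: "\<not> (\<exists>a\<le>u. lat_atom S a)"
    \<comment> \<open>\<open>B\<close> marks the positive elements without atoms below them. Such an
      \<open>x\<close> is split into \<open>v\<close>, which becomes a term of the sequence, and
      \<open>y\<close>, on which the splitting continues. Later terms lie below this
      \<open>y\<close> and are therefore disjoint from \<open>v\<close>.\<close>
    define B where "B x \<longleftrightarrow> x \<in> S \<and> 0 < x \<and> \<not> (\<exists>a\<le>x. lat_atom S a)" for x
    define Q where "Q x y v \<longleftrightarrow> v \<in> S \<and> 0 < v \<and> v \<le> x \<and> y \<le> x \<and> inf v y = 0" for x y v
    have step: "\<exists>y. B y \<and> (\<exists>v. Q x y v)" if "B x" for x
    proof -
      have "\<not> lat_atom S x" "x \<in> S" "0 < x" using that by (auto simp: B_def)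
      then obtain v w where vw: "v \<in> S" "w \<in> S" "0 < v" "0 < w" "v \<le> x" "w \<le> x" "inf v w = 0"
        unfolding lat_atom_def by blast
      have "\<not> lat_atom S a" if "a \<le> w" for a
        using \<open>B x\<close> order_trans[OF that vw(6)] unfolding B_def by blast
      then have "B w" "Q x w v" using vw unfolding B_def Q_def by auto
      then show ?thesis by blast
    qed
    have Bu: "B u" using u bad by (simp add: B_def)
    have "\<exists>f. \<forall>n::nat. B (f n) \<and> (\<exists>v. Q (f n) (f (Suc n)) v)"
      using dependent_nat_choice[where P = "\<lambda>_. B" and Q = "\<lambda>_ x y. \<exists>v. Q x y v", OF exI step, OF Bu] by simp
    then obtain f where f0: "\<And>n::nat. B (f n)" "\<forall>n. \<exists>v. Q (f n) (f (Suc n)) v" by blast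
    obtain v where f: "\<And>n. Q (f n) (f (Suc n)) (v n)" using choice[OF f0(2)] by blast
    have step_le: "f (Suc n) \<le> f n" for n using f[of n] by (simp add: Q_def)
    have anti: "f n \<le> f m" if "m \<le> n" for m n
      using step_le that by (rule lift_Suc_antimono_le)
    have "inf (v m) (v n) = 0" if "m < n" for m n
    proof (rule antisym)
      have "v n \<le> f n" using f[of n] by (simp add: Q_def)
      also have "\<dots> \<le> f (Suc m)" using anti[of "Suc m" n] that by simp
      finally have "v n \<le> f (Suc m)" .
      then have "inf (v m) (v n) \<le> inf (v m) (f (Suc m))" by (rule inf_mono[OF order_refl])
      also have "\<dots> = 0" using f[of m] unfolding Q_def by blast
      finally show "inf (v m) (v n) \<le> 0" .
      show "0 \<le> inf (v m) (v n)" using f unfolding Q_def by (simp add: less_imp_le)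
    qed
    then show False using none[of v] f by (auto simp: Q_def)
  qed
  have "\<exists>a. lat_atom S a \<and> (\<forall>i<n. inf a (e i) = 0)"
    if e: "\<forall>i<n. lat_atom S (e i) \<and> (\<forall>j<i. inf (e i) (e j) = 0)" for e :: "nat \<Rightarrow> 'a" and n
  proof (rule ccontr)
    assume no: "\<not> ?thesis"
    have "S \<subseteq> span (e ` {..<n})"
    proof (rule span_atoms[OF S])
      show "lat_disjoint (e i) (e j)" if "i < n" "j < n" "i \<noteq> j" for i j
      proof -
        have "inf (e i) (e j) = 0"
        proof (cases "i < j")
          case True
          then have "inf (e j) (e i) = 0" using that e by blast
          then show ?thesis by (subst inf_commute)
        next
          case False
          then have "j < i" using that by simp
          then show ?thesis using that e by blast
        qed
        moreover have "0 < e i" "0 < e j"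
          using that e by (auto simp: lat_atom_def)
        ultimately show ?thesis by (simp add: lat_disjoint_def abs_of_pos)
      qed
    qed (use no that below in auto)
    then show False using inf unfolding infinite_dimensional_def by blast
  qed
  then have "\<exists>f. \<forall>n::nat. lat_atom S (f n) \<and> (\<forall>i<n. inf (f n) (f i) = 0)"
    by (intro dependent_wellorder_choice[of "\<lambda>f n a. lat_atom S a \<and> (\<forall>i<n. inf a (f i) = 0)"]) auto
  then obtain f where f: "\<And>n::nat. lat_atom S (f n)" "\<And>n i. i < n \<Longrightarrow> inf (f n) (f i) = 0" by blast
  show False
    by (rule none[of f]) (use f in \<open>auto simp: lat_atom_def inf_commute\<close>)
qed

section \<open>Equi-integrability\<close>

definition mass :: "'b measure \<Rightarrow> 'b set \<Rightarrow> ('b \<Rightarrow> real) \<Rightarrow> real" where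
  "mass M A f = (\<integral>x. indicator A x * \<bar>f x\<bar> \<partial>M)"

text \<open>Uniform absolute continuity of the integrals. Since \<open>measure\<close> is 0 on sets
  of infinite measure, this is the intended notion only for a finite measure.\<close>

definition equi_integrable :: "'b measure \<Rightarrow> ('b \<Rightarrow> real) set \<Rightarrow> bool" where
  "equi_integrable M F \<longleftrightarrow> (\<forall>d>0. \<exists>t>0. \<forall>f\<in>F. \<forall>A\<in>sets M. measure M A < t \<longrightarrow> mass M A f < d)"

lemma integrable_indicator_abs:
  "integrable M f \<Longrightarrow> A \<in> sets M \<Longrightarrow> integrable M (\<lambda>x. indicator A x * \<bar>f x\<bar> :: real)"
  using integrable_mult_indicator[of A M "\<lambda>x. \<bar>f x\<bar>"] by simp

lemma mass_mono:
  assumes "integrable M f" "integrable M g" "A \<in> sets M" "B \<in> sets M"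
    "\<And>x. x \<in> A \<Longrightarrow> x \<in> B" "\<And>x. x \<in> A \<Longrightarrow> \<bar>f x\<bar> \<le> \<bar>g x\<bar>"
  shows "mass M A f \<le> mass M B g"
  unfolding mass_def
  using assms by (intro integral_mono integrable_indicator_abs) (auto simp: indicator_def)

lemma mass_le_norm:
  assumes "integrable M f" "A \<in> sets M"
  shows "mass M A f \<le> (\<integral>x. \<bar>f x\<bar> \<partial>M)"
  unfolding mass_def
  using assms by (intro integral_mono integrable_indicator_abs) (auto simp: indicator_def)

lemma mass_add:
  assumes "integrable M f" "integrable M g" "A \<in> sets M"
  shows "mass M A (\<lambda>x. f x + g x) \<le> mass M A f + mass M A g"
proof -
  have "mass M A (\<lambda>x. f x + g x) \<le> (\<integral>x. indicator A x * \<bar>f x\<bar> + indicator A x * \<bar>g x\<bar> \<partial>M)"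
    unfolding mass_def
    using assms by (intro integral_mono Bochner_Integration.integrable_add integrable_indicator_abs)
      (auto simp: indicator_def)
  also have "\<dots> = mass M A f + mass M A g"
    unfolding mass_def using assms by (intro Bochner_Integration.integral_add integrable_indicator_abs) auto
  finally show ?thesis .
qed

lemma mass_cmult: "mass M A (\<lambda>x. c * f x) = \<bar>c\<bar> * mass M A f"
proof -
  have "mass M A (\<lambda>x. c * f x) = (\<integral>x. \<bar>c\<bar> * (indicator A x * \<bar>f x\<bar>) \<partial>M)"
    unfolding mass_def by (intro Bochner_Integration.integral_cong) (auto simp: abs_mult)
  then show ?thesis by (simp add: mass_def)
qed

lemma mass_Un:
  assumes "integrable M f" "A \<in> sets M" "B \<in> sets M"
  shows "mass M (A \<union> B) f \<le> mass M A f + mass M B f"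
proof -
  have "mass M (A \<union> B) f \<le> (\<integral>x. indicator A x * \<bar>f x\<bar> + indicator B x * \<bar>f x\<bar> \<partial>M)"
    unfolding mass_def
    using assms by (intro integral_mono Bochner_Integration.integrable_add integrable_indicator_abs)
      (auto simp: indicator_def)
  also have "\<dots> = mass M A f + mass M B f"
    unfolding mass_def using assms by (intro Bochner_Integration.integral_add integrable_indicator_abs) auto
  finally show ?thesis .
qed

lemma equi_integrable_diff:
  fixes f g :: "nat \<Rightarrow> 'b \<Rightarrow> real"
  assumes int: "\<And>n. integrable M (f n)" "\<And>n. integrable M (g n)"
    and equi: "equi_integrable M (range f)" "equi_integrable M (range g)"
  shows "equi_integrable M (range (\<lambda>n x. f n x - g n x))"
  unfolding equi_integrable_def
proof (intro allI impI)
  fix d :: real assume "0 < d"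
  then have d: "0 < d / 2" by simp
  obtain t where t: "t > 0" "\<forall>f\<in>range f. \<forall>A\<in>sets M. measure M A < t \<longrightarrow> mass M A f < d / 2"
    using equi(1) d unfolding equi_integrable_def by blast
  obtain s where s: "s > 0" "\<forall>f\<in>range g. \<forall>A\<in>sets M. measure M A < s \<longrightarrow> mass M A f < d / 2"
    using equi(2) d unfolding equi_integrable_def by blast
  show "\<exists>t>0. \<forall>f\<in>range (\<lambda>n x. f n x - g n x). \<forall>A\<in>sets M. measure M A < t \<longrightarrow> mass M A f < d"
  proof (intro exI[of _ "min t s"] conjI ballI impI)
    fix h A assume h: "h \<in> range (\<lambda>n x. f n x - g n x)" and A: "A \<in> sets M" "measure M A < min t s"
    then obtain n where n: "h = (\<lambda>x. f n x + (-1) * g n x)" by auto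
    have "mass M A h \<le> mass M A (f n) + mass M A (\<lambda>x. (-1) * g n x)"
      unfolding n using int A(1) by (intro mass_add) auto
    also have "mass M A (\<lambda>x. (-1) * g n x) = mass M A (g n)" by (subst mass_cmult) simp
    also have "mass M A (f n) + mass M A (g n) < d / 2 + d / 2" using t(2) s(2) A by (intro add_strict_mono) auto
    finally show "mass M A h < d" by simp
  qed (use t s in auto)
qed

text \<open>Truncation at a level \<open>n\<close>: the mass above it is small by dominated
  convergence. The condition on \<open>emeasure\<close> excludes the sets on which
  \<open>measure\<close> takes its default value 0.\<close>

lemma mass_absolutely_continuous:
  assumes f: "integrable M f" and d: "0 < d"
  shows "\<exists>t>0. \<forall>A\<in>sets M. emeasure M A < \<infinity> \<longrightarrow> measure M A < t \<longrightarrow> mass M A f < d"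
proof -
  have [measurable]: "f \<in> borel_measurable M" using f by auto
  define T where "T n = {x\<in>space M. real n < \<bar>f x\<bar>}" for n
  have T [measurable]: "T n \<in> sets M" for n unfolding T_def by measurable
  have "(\<lambda>n. mass M (T n) f) \<longlonglongrightarrow> (\<integral>x. 0 \<partial>M)"
    unfolding mass_def
  proof (rule integral_dominated_convergence[where w = "\<lambda>x. \<bar>f x\<bar>"])
    show "AE x in M. (\<lambda>n. indicator (T n) x * \<bar>f x\<bar>) \<longlonglongrightarrow> 0"
    proof (intro AE_I2 tendsto_eventually)
      fix x
      obtain N where N: "\<bar>f x\<bar> \<le> real N" using real_arch_simple by blast
      show "\<forall>\<^sub>F n in sequentially. indicator (T n) x * \<bar>f x\<bar> = 0"
        using eventually_ge_at_top[of N]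
      proof eventually_elim
        case (elim n)
        then have "\<bar>f x\<bar> \<le> real n" using N by linarith
        then show ?case by (auto simp: T_def)
      qed
    qed
  qed (use f in \<open>auto simp: indicator_def\<close>)
  then have "(\<lambda>n. mass M (T n) f) \<longlonglongrightarrow> 0" by simp
  then have "\<forall>\<^sub>F n in sequentially. mass M (T n) f < d / 2" by (rule order_tendstoD) (use d in simp)
  then obtain n where n: "mass M (T n) f < d / 2" by (auto simp: eventually_sequentially)
  show ?thesis
  \<comment> \<open>Below the level \<open>n\<close>, the set \<open>A\<close> contributes at most
    \<open>n\<close> times its measure; \<open>n + 1\<close> avoids a division by 0.\<close>
  proof (intro exI[of _ "d / (2 * (real n + 1))"] conjI ballI impI)
    fix A assume A: "A \<in> sets M" "emeasure M A < \<infinity>" "measure M A < d / (2 * (real n + 1))"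
    have iA: "integrable M (\<lambda>x. real n * indicator A x)"
      using A by (intro Bochner_Integration.integrable_mult_right integrable_real_indicator) auto
    have "mass M A f \<le> (\<integral>x. indicator (T n) x * \<bar>f x\<bar> + real n * indicator A x \<partial>M)"
      unfolding mass_def
    proof (rule integral_mono)
      show "integrable M (\<lambda>x. indicator (T n) x * \<bar>f x\<bar> + real n * indicator A x)"
        using f iA by (intro Bochner_Integration.integrable_add integrable_indicator_abs) auto
      show "integrable M (\<lambda>x. indicator A x * \<bar>f x\<bar>)" using f A by (intro integrable_indicator_abs) auto
    qed (auto simp: indicator_def T_def)
    also have "\<dots> = mass M (T n) f + real n * measure M A"
      unfolding mass_def using f A iA
      by (subst Bochner_Integration.integral_add) (auto intro!: integrable_indicator_abs)
    also have "real n * measure M A \<le> (real n + 1) * measure M A" by (intro mult_right_mono) auto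
    also have "\<dots> < d / 2" using A(3) by (simp add: field_simps)
    finally show "mass M A f < d" using n by simp
  qed (use d in auto)
qed

section \<open>Extraction of l_1 sequences, and its counterpart for equi-integrable
  sequences\<close>

context finite_measure
begin

lemma mass_absolutely_continuous_finite:
  assumes "integrable M f" "0 < d"
  shows "\<exists>t>0. \<forall>A\<in>sets M. measure M A < t \<longrightarrow> mass M A f < d"
  using mass_absolutely_continuous[OF assms] by (simp add: emeasure_finite less_top[symmetric])

lemma mass_markov:
  assumes f: "integrable M f" and K: "K > 0"
  shows "measure M {x\<in>space M. K \<le> \<bar>f x\<bar>} \<le> (\<integral>x. \<bar>f x\<bar> \<partial>M) / K"
proof -
  have [measurable]: "f \<in> borel_measurable M" using f by auto
  have "K * measure M {x\<in>space M. K \<le> \<bar>f x\<bar>} = (\<integral>x. K * indicator {x\<in>space M. K \<le> \<bar>f x\<bar>} x \<partial>M)"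
    by simp
  also have "\<dots> \<le> (\<integral>x. \<bar>f x\<bar> \<partial>M)"
  proof (rule integral_mono)
    show "integrable M (\<lambda>x. K * indicator {x\<in>space M. K \<le> \<bar>f x\<bar>} x)"
      by (intro Bochner_Integration.integrable_mult_right integrable_real_indicator)
        (auto simp: emeasure_finite less_top[symmetric])
  qed (use f K in \<open>auto simp: indicator_def\<close>)
  finally show ?thesis using K by (simp add: field_simps)
qed

text \<open>The level \<open>d\<close> of escaping mass is chosen within a factor 11/10 of the
  largest possible one, so that what escapes is known almost exactly. It exists because the levels
  are bounded by \<open>B\<close> and cannot be multiplied by 11/10 forever. Indices can be pushed
  beyond any \<open>N\<close>, since finitely many integrable functions are uniformly absolutely
  continuous.\<close>

lemma not_equi_integrable_critical_level:
  fixes h :: "nat \<Rightarrow> 'a \<Rightarrow> real"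
  assumes int: "\<And>k. integrable M (h k)" and bd: "\<And>k. (\<integral>x. \<bar>h k x\<bar> \<partial>M) \<le> B"
    and not_equi: "\<not> equi_integrable M (range h)"
  obtains d t where "d > 0" "t > 0" "\<And>k A. A \<in> sets M \<Longrightarrow> measure M A < t \<Longrightarrow> mass M A (h k) < 11/10 * d"
    "\<And>N t. t > 0 \<Longrightarrow> \<exists>k\<ge>N. \<exists>A\<in>sets M. measure M A < t \<and> d \<le> mass M A (h k)"
proof -
  define D where "D d \<longleftrightarrow> (\<forall>t>0. \<exists>k. \<exists>A\<in>sets M. measure M A < t \<and> d \<le> mass M A (h k))" for d
  have "\<exists>d0>0. D d0"
  proof -
    obtain d where "0 < d" "\<forall>t>0. \<exists>f\<in>range h. \<exists>A\<in>sets M. measure M A < t \<and> \<not> mass M A f < d"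
      using not_equi unfolding equi_integrable_def by blast
    then show ?thesis unfolding D_def by (intro exI[of _ d]) (simp add: not_less)
  qed
  then obtain d0 where d0: "d0 > 0" "D d0" by blast
  have DB: "d \<le> B" if D: "D d" for d
  proof -
    obtain k A where "A \<in> sets M" "d \<le> mass M A (h k)"
      using D unfolding D_def by (meson zero_less_one)
    then show ?thesis using mass_le_norm[OF int, of A k] bd[of k] by simp
  qed
  have "\<exists>d>0. D d \<and> \<not> D (11/10 * d)"
  proof (rule ccontr)
    assume *: "\<not> (\<exists>d>0. D d \<and> \<not> D (11/10 * d))"
    have "D ((11/10)^n * d0)" for n
    proof (induction n)
      case (Suc n)
      have "(11/10)^n * d0 > 0" using d0 by simp
      then have "D (11/10 * ((11/10)^n * d0))" using * Suc by blast
      then show ?case by (simp add: mult_ac)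
    qed (use d0 in simp)
    then have le: "(11/10)^n * d0 \<le> B" for n using DB by blast
    obtain n where "(11/10 :: real)^n > B / d0" using real_arch_pow[of "11/10" "B/d0"] by auto
    then show False using le[of n] d0 by (simp add: field_simps)
  qed
  then obtain d where d: "d > 0" "D d" "\<not> D (11/10 * d)" by blast
  then obtain t where t: "t > 0" "\<And>k A. A \<in> sets M \<Longrightarrow> measure M A < t \<Longrightarrow> mass M A (h k) < 11/10 * d"
    unfolding D_def by (auto simp: not_le)
  have small: "\<exists>s>0. \<forall>k<N. \<forall>A\<in>sets M. measure M A < s \<longrightarrow> mass M A (h k) < d" for N
  proof (induction N)
    case (Suc N)
    obtain s where s: "s > 0" "\<forall>k<N. \<forall>A\<in>sets M. measure M A < s \<longrightarrow> mass M A (h k) < d" using Suc by blast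
    obtain s' where s': "s' > 0" "\<forall>A\<in>sets M. measure M A < s' \<longrightarrow> mass M A (h N) < d"
      using mass_absolutely_continuous_finite[OF int d(1)] by blast
    show ?case
      using s s' by (intro exI[of _ "min s s'"]) (auto simp: less_Suc_eq)
  qed (auto intro: exI[of _ 1])
  have often: "\<exists>k\<ge>N. \<exists>A\<in>sets M. measure M A < t \<and> d \<le> mass M A (h k)" if "t > 0" for N t
  proof -
    obtain s where s: "s > 0" "\<forall>k<N. \<forall>A\<in>sets M. measure M A < s \<longrightarrow> mass M A (h k) < d" using small by blast
    have "min t s > 0" using that s(1) by simp
    then obtain k A where kA: "A \<in> sets M" "measure M A < min t s" "d \<le> mass M A (h k)"
      using d(2) unfolding D_def by blast
    have "k \<ge> N"
    proof (rule ccontr)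
      assume "\<not> N \<le> k"
      then have "mass M A (h k) < d" using s(2) kA(1,2) by simp
      then show False using kA(3) by simp
    qed
    moreover have "measure M A < t" using kA(2) by simp
    ultimately show ?thesis using kA by blast
  qed
  show ?thesis by (rule that[OF d(1) t]) (simp_all add: often)
qed

text \<open>Choose sets \<open>A n\<close> carrying mass \<open>d\<close> of \<open>h (r n)\<close>,
  each so small that the earlier functions have mass below \<open>d / 10\<close> on all later sets
  together. Removing the later sets gives disjoint \<open>W i\<close> still carrying
  \<open>9/10 * d\<close>, while no function has more than \<open>11/10 * d\<close> on the whole
  union. So each function has at most \<open>2/10 * d\<close> in the union outside its own set, and
  the diagonal dominates: \<open>9/10 - 2/10 = 7/10\<close>.\<close>

lemma l1_subsequence:
  fixes h :: "nat \<Rightarrow> 'a \<Rightarrow> real"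
  assumes int: "\<And>k. integrable M (h k)" and bd: "\<And>k. (\<integral>x. \<bar>h k x\<bar> \<partial>M) \<le> B"
    and not_equi: "\<not> equi_integrable M (range h)"
  shows "\<exists>r c. strict_mono (r :: nat \<Rightarrow> nat) \<and> c > 0 \<and>
    (\<forall>I a. finite I \<longrightarrow> c * (\<Sum>i\<in>I. \<bar>a i\<bar>) \<le> (\<integral>x. \<bar>\<Sum>i\<in>I. a i * h (r i) x\<bar> \<partial>M))"
proof -
  obtain d t where d: "d > 0" and t: "t > 0"
      "\<And>k A. A \<in> sets M \<Longrightarrow> measure M A < t \<Longrightarrow> mass M A (h k) < 11/10 * d"
    and inf: "\<And>N t. t > 0 \<Longrightarrow> \<exists>k\<ge>N. \<exists>A\<in>sets M. measure M A < t \<and> d \<le> mass M A (h k)"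
    using not_equi_integrable_critical_level[OF assms] by metis
  \<comment> \<open>\<open>s\<close> is a tolerance: \<open>h k\<close> has mass below
    \<open>d / 10\<close> on sets of measure less than \<open>s\<close>. \<open>Q\<close> makes the
    next set and the next tolerance at most half of it, and the bounds by \<open>t / 2\<close> keep
    the union of all sets below the critical size \<open>t\<close>.\<close>
  define P where "P = (\<lambda>(k, A, s). A \<in> sets M \<and> d \<le> mass M A (h k) \<and> 0 < s \<and> s \<le> t / 2 \<and> measure M A < t / 2 \<and>
    (\<forall>B\<in>sets M. measure M B < s \<longrightarrow> mass M B (h k) < d / 10))"
  define Q where "Q = (\<lambda>(k::nat, A::'a set, s::real) (k', A', s'). k < k' \<and> measure M A' \<le> s / 2 \<and> s' \<le> s / 2)"
  have step: "\<exists>k' A' s'. P (k', A', s') \<and> k0 < k' \<and> measure M A' \<le> s0 / 2 \<and> s' \<le> s0 / 2" if "s0 > 0" for k0 s0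
  proof -
    have "min (t / 2) (s0 / 2) > 0" using that t by simp
    from inf[OF this, of "Suc k0"] obtain k A where
      kA: "k \<ge> Suc k0" "A \<in> sets M" "measure M A < min (t / 2) (s0 / 2)" "d \<le> mass M A (h k)" by blast
    obtain s where s: "s > 0" "\<forall>A\<in>sets M. measure M A < s \<longrightarrow> mass M A (h k) < d / 10"
      using mass_absolutely_continuous_finite[OF int, of "d / 10" k] d by auto
    have "P (k, A, min s (min (t / 2) (s0 / 2)))" unfolding P_def using kA s that t by auto
    then show ?thesis using kA by (intro exI[of _ k] exI[of _ A] exI[of _ "min s (min (t / 2) (s0 / 2))"]) auto
  qed
  have "\<exists>f. \<forall>n::nat. P (f n) \<and> Q (f n) (f (Suc n))"
  proof (rule dependent_nat_choice)
    show "\<exists>x. P x" using step[of 1 0] by auto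
    show "\<exists>y. P y \<and> Q x y" if "P x" for x
    proof -
      obtain k0 A0 s0 where x: "x = (k0, A0, s0)" by (cases x)
      then have "s0 > 0" using that by (simp add: P_def)
      from step[OF this, of k0] show ?thesis unfolding x Q_def by auto
    qed
  qed
  then obtain f where f: "\<And>n::nat. P (f n)" "\<And>n. Q (f n) (f (Suc n))" by blast
  define r A s where "r n = fst (f n)" and "A n = fst (snd (f n))" and "s n = snd (snd (f n))" for n
  have feq: "f n = (r n, A n, s n)" for n by (simp add: r_def A_def s_def)
  have P: "A n \<in> sets M" "d \<le> mass M (A n) (h (r n))" "0 < s n" "s n \<le> t / 2" "measure M (A n) < t / 2"
    "\<And>B. B \<in> sets M \<Longrightarrow> measure M B < s n \<Longrightarrow> mass M B (h (r n)) < d / 10" for n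
    using f(1)[of n] unfolding feq P_def by auto
  have Q: "r n < r (Suc n)" "measure M (A (Suc n)) \<le> s n / 2" "s (Suc n) \<le> s n / 2" for n
    using f(2)[of n] unfolding feq P_def Q_def by auto
  have r: "strict_mono r" using Q(1) by (simp add: strict_mono_Suc_iff)
  \<comment> \<open>The sum telescopes: the measure of the next set is at most
    \<open>s n / 2\<close>, and the tolerance drops by at least as much.\<close>
  have tail: "(\<Sum>j\<in>{i<..i+n}. measure M (A j)) \<le> s i - s (i + n)" for i n
  proof (induction n)
    case (Suc n)
    have "{i<..i + Suc n} = insert (Suc (i + n)) {i<..i+n}" by auto
    then show ?case using Suc Q(2,3)[of "i + n"] by simp
  qed simp
  have tail_set: "measure M (\<Union>j\<in>{i<..n}. A j) < s i" for i n
  proof (cases "i \<le> n")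
    case True
    have "measure M (\<Union>j\<in>{i<..n}. A j) \<le> (\<Sum>j\<in>{i<..n}. measure M (A j))"
      using P(1) by (intro finite_measure_subadditive_finite) auto
    also have "\<dots> \<le> s i - s n" using tail[of i "n - i"] True by simp
    also have "\<dots> < s i" using P(3) by simp
    finally show ?thesis .
  qed (use P(3)[of i] in auto)
  have "7/10 * d * (\<Sum>i\<in>I. \<bar>a i\<bar>) \<le> (\<integral>x. \<bar>\<Sum>i\<in>I. a i * h (r i) x\<bar> \<partial>M)" if I: "finite I" for I a
  proof -
    obtain n where n: "I \<subseteq> {..n}" using I finite_nat_set_iff_bounded_le by auto
    define V where "V i = (\<Union>j\<in>{i<..n}. A j)" for i
    define W where "W i = A i - V i" for i
    define U where "U = (\<Union>j\<in>{..n}. A j)"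
    have V [measurable]: "V i \<in> sets M" for i unfolding V_def using P(1) by auto
    have W [measurable]: "W i \<in> sets M" for i unfolding W_def using P(1) V by auto
    have U [measurable]: "U \<in> sets M" unfolding U_def using P(1) by auto
    have "U = A 0 \<union> V 0"
    proof -
      have "{..n} = insert 0 {0<..n}" by auto
      then show ?thesis by (simp add: U_def V_def)
    qed
    then have "measure M U \<le> measure M (A 0) + measure M (V 0)" using P(1) V by (simp add: measure_Un_le)
    also have "measure M (V 0) < t / 2" using tail_set[of 0 n] P(4)[of 0] by (simp add: V_def)
    finally have Ut: "measure M U < t" using P(5)[of 0] by simp
    have Wmass: "9/10 * d \<le> mass M (W i) (h (r i))" for i
    proof -
      have "mass M (A i) (h (r i)) \<le> mass M (W i \<union> V i) (h (r i))"
        using int P(1) W V by (intro mass_mono) (auto simp: W_def)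
      also have "\<dots> \<le> mass M (W i) (h (r i)) + mass M (V i) (h (r i))" by (intro mass_Un int W V)
      also have "mass M (V i) (h (r i)) < d / 10" using P(6) V tail_set by (simp add: V_def)
      finally show ?thesis using P(2)[of i] by simp
    qed
    have Umass: "mass M U (h (r i)) \<le> 11/10 * d" for i using t(2)[OF U Ut, of "r i"] by simp
    have disj: "i = j" if "x \<in> W i" "x \<in> W j" "i \<in> I" "j \<in> I" for i j x
    proof (rule ccontr)
      assume "i \<noteq> j"
      then consider "i < j" | "j < i" by linarith
      then show False using that n unfolding W_def V_def by cases auto
    qed
    \<comment> \<open>On \<open>W i\<close> the triangle inequality gives the \<open>i\<close>-th
      term minus all others. Writing this with twice the indicator of \<open>W i\<close> minus that
      of \<open>U\<close> lets every index be integrated separately.\<close>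
    have pw: "(\<Sum>i\<in>I. \<bar>a i\<bar> * (2 * (indicator (W i) x * \<bar>h (r i) x\<bar>) - indicator U x * \<bar>h (r i) x\<bar>))
        \<le> \<bar>\<Sum>i\<in>I. a i * h (r i) x\<bar>" (is "?L \<le> ?R") for x
    proof (cases "\<exists>i\<in>I. x \<in> W i")
      case True
      then obtain i where i: "i \<in> I" "x \<in> W i" by blast
      then have xU: "x \<in> U" using n unfolding U_def W_def by auto
      have ind: "indicator (W j) x = (if j = i then 1 else 0 :: real)" if "j \<in> I" for j
      proof (cases "j = i")
        case False
        then have "x \<notin> W j" using disj[OF _ i(2) that i(1)] by blast
        then show ?thesis using False by simp
      qed (use i in simp)
      have "?L = (\<Sum>j\<in>I. (if j = i then \<bar>a i * h (r i) x\<bar> else - \<bar>a j * h (r j) x\<bar>))"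
        using xU by (intro sum.cong) (simp_all add: ind abs_mult)
      also have "\<dots> = \<bar>a i * h (r i) x\<bar> + (\<Sum>j\<in>I - {i}. - \<bar>a j * h (r j) x\<bar>)"
        unfolding sum.remove[OF I i(1)] by simp
      also have "\<dots> = \<bar>a i * h (r i) x\<bar> - (\<Sum>j\<in>I - {i}. \<bar>a j * h (r j) x\<bar>)"
        by (simp add: sum_negf)
      also have "\<dots> \<le> \<bar>a i * h (r i) x\<bar> - \<bar>\<Sum>j\<in>I - {i}. a j * h (r j) x\<bar>"
        using sum_abs[of "\<lambda>j. a j * h (r j) x" "I - {i}"] by simp
      also have "\<dots> \<le> \<bar>a i * h (r i) x + (\<Sum>j\<in>I - {i}. a j * h (r j) x)\<bar>" by linarith
      also have "\<dots> = ?R" using sum.remove[OF I i(1), of "\<lambda>j. a j * h (r j) x"] by simp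
      finally show ?thesis .
    next
      case False
      then have "?L \<le> 0" by (intro sum_nonpos) (auto simp: indicator_def mult_nonneg_nonpos)
      then show ?thesis by linarith
    qed
    have ii: "integrable M (\<lambda>x. \<bar>a i\<bar> * (2 * (indicator (W i) x * \<bar>h (r i) x\<bar>) - indicator U x * \<bar>h (r i) x\<bar>))" for i
      using int W U
      by (intro Bochner_Integration.integrable_mult_right Bochner_Integration.integrable_diff integrable_indicator_abs) auto
    have "7/10 * d * (\<Sum>i\<in>I. \<bar>a i\<bar>) = (\<Sum>i\<in>I. \<bar>a i\<bar> * (2 * (9/10 * d) - 11/10 * d))"
      by (simp add: sum_distrib_left mult_ac)
    also have "\<dots> \<le> (\<Sum>i\<in>I. \<bar>a i\<bar> * (2 * mass M (W i) (h (r i)) - mass M U (h (r i))))"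
    proof (intro sum_mono mult_left_mono)
      show "2 * (9/10 * d) - 11/10 * d \<le> 2 * mass M (W i) (h (r i)) - mass M U (h (r i))" for i
        using Wmass[of i] Umass[of i] by linarith
    qed auto
    also have "\<dots> = (\<integral>x. (\<Sum>i\<in>I. \<bar>a i\<bar> * (2 * (indicator (W i) x * \<bar>h (r i) x\<bar>) - indicator U x * \<bar>h (r i) x\<bar>)) \<partial>M)"
      using ii int W U unfolding mass_def
      by (subst Bochner_Integration.integral_sum) (auto simp: integrable_indicator_abs)
    also have "\<dots> \<le> (\<integral>x. \<bar>\<Sum>i\<in>I. a i * h (r i) x\<bar> \<partial>M)"
      using ii int pw by (intro integral_mono Bochner_Integration.integrable_sum integrable_abs
        Bochner_Integration.integrable_mult_right) auto
    finally show ?thesis .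
  qed
  then show ?thesis using r d by (intro exI[of _ r] exI[of _ "7/10 * d"]) simp
qed

text \<open>The signs are chosen one at a time so that the new cross term is not positive; the
  square integrals then merely add up. This replaces an average over random signs.\<close>

lemma signs_small_L2:
  assumes "finite F" and [measurable]: "\<And>k. h k \<in> borel_measurable M"
    and K: "\<And>k x. \<bar>h k x\<bar> \<le> (K::real)"
  shows "\<exists>s. (\<forall>k. \<bar>s k\<bar> = 1) \<and> (\<integral>x. (\<Sum>k\<in>F. s k * h k x)\<^sup>2 \<partial>M) \<le> real (card F) * (K\<^sup>2 * measure M (space M))"
  using assms(1)
proof (induction F)
  case empty
  show ?case by (rule exI[of _ "\<lambda>_. 1"]) simp
next
  case (insert j F)
  from insert.IH obtain s where s: "\<forall>k. \<bar>s k\<bar> = 1"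
    "(\<integral>x. (\<Sum>k\<in>F. s k * h k x)\<^sup>2 \<partial>M) \<le> real (card F) * (K\<^sup>2 * measure M (space M))" by metis
  define S where "S x = (\<Sum>k\<in>F. s k * h k x)" for x
  have [measurable]: "S \<in> borel_measurable M" unfolding S_def by measurable
  have K0: "K \<ge> 0" using K[of j undefined] by simp
  have SK: "\<bar>S x\<bar> \<le> real (card F) * K" for x
  proof -
    have "\<bar>S x\<bar> \<le> (\<Sum>k\<in>F. \<bar>s k * h k x\<bar>)" unfolding S_def by (rule sum_abs)
    also have "\<dots> \<le> (\<Sum>k\<in>F. K)" using s(1) K by (intro sum_mono) (simp add: abs_mult)
    finally show ?thesis by simp
  qed
  have iS: "integrable M (\<lambda>x. (S x)\<^sup>2)"
  proof (rule integrable_const_bound[of _ "(real (card F) * K)\<^sup>2"])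
    show "AE x in M. norm ((S x)\<^sup>2) \<le> (real (card F) * K)\<^sup>2" using SK by (auto simp: abs_le_square_iff[symmetric] K0)
  qed measurable
  have ih: "integrable M (\<lambda>x. (h j x)\<^sup>2)"
  proof (rule integrable_const_bound[of _ "K\<^sup>2"])
    show "AE x in M. norm ((h j x)\<^sup>2) \<le> K\<^sup>2" using K by (auto simp: abs_le_square_iff[symmetric] K0)
  qed measurable
  have iSh: "integrable M (\<lambda>x. S x * h j x)"
  proof (rule integrable_const_bound[of _ "real (card F) * K * K"])
    show "AE x in M. norm (S x * h j x) \<le> real (card F) * K * K"
      using SK K K0 by (auto simp: abs_mult intro!: mult_mono)
  qed measurable
  define e where "e = (if (\<integral>x. S x * h j x \<partial>M) \<le> 0 then 1 else - 1 :: real)"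
  have e: "\<bar>e\<bar> = 1" "e * (\<integral>x. S x * h j x \<partial>M) \<le> 0" "e\<^sup>2 = 1" by (auto simp: e_def)
  have "(\<integral>x. (\<Sum>k\<in>insert j F. (s(j := e)) k * h k x)\<^sup>2 \<partial>M) = (\<integral>x. (S x + e * h j x)\<^sup>2 \<partial>M)"
  proof -
    have "(\<Sum>k\<in>insert j F. (s(j := e)) k * h k x) = S x + e * h j x" for x
    proof -
      have "(\<Sum>k\<in>F. (s(j := e)) k * h k x) = S x"
        unfolding S_def using insert by (intro sum.cong) auto
      then show ?thesis using insert by simp
    qed
    then show ?thesis by (simp only:)
  qed
  also have "\<dots> = (\<integral>x. (S x)\<^sup>2 + 2 * e * (S x * h j x) + (h j x)\<^sup>2 \<partial>M)"
    using e(3) by (intro Bochner_Integration.integral_cong) (auto simp: power2_sum power_mult_distrib)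
  also have "\<dots> = (\<integral>x. (S x)\<^sup>2 \<partial>M) + 2 * (e * (\<integral>x. S x * h j x \<partial>M)) + (\<integral>x. (h j x)\<^sup>2 \<partial>M)"
    using iS ih iSh by simp
  also have "\<dots> \<le> real (card F) * (K\<^sup>2 * measure M (space M)) + 0 + K\<^sup>2 * measure M (space M)"
  proof (intro add_mono)
    have "(\<integral>x. (h j x)\<^sup>2 \<partial>M) \<le> (\<integral>x. K\<^sup>2 \<partial>M)"
      using ih K by (intro integral_mono) (auto simp: abs_le_square_iff[symmetric] K0)
    then show "(\<integral>x. (h j x)\<^sup>2 \<partial>M) \<le> K\<^sup>2 * measure M (space M)" by (simp add: mult.commute)
  qed (use e(2) s(2) in \<open>auto simp: S_def\<close>)
  finally have "(\<integral>x. (\<Sum>k\<in>insert j F. (s(j := e)) k * h k x)\<^sup>2 \<partial>M)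
    \<le> real (card (insert j F)) * (K\<^sup>2 * measure M (space M))"
    using insert by (simp add: distrib_right)
  then show ?case using s(1) e(1) by (intro exI[of _ "s(j := e)"]) auto
qed

text \<open>The parts of the functions above a level \<open>K\<close> contribute at most
  \<open>e / 2\<close> each. For the truncated functions, well chosen signs give an L_2 norm of the
  order of the square root of \<open>card F\<close>, negligible against \<open>card F\<close>. Hence
  such a sequence admits no l_1 lower estimate.\<close>

lemma equi_integrable_signs:
  fixes h :: "nat \<Rightarrow> 'a \<Rightarrow> real"
  assumes int: "\<And>k. integrable M (h k)" and bd: "\<And>k. (\<integral>x. \<bar>h k x\<bar> \<partial>M) \<le> B"
    and equi: "equi_integrable M (range h)" and e: "e > 0"
  shows "\<exists>C. \<forall>F. finite F \<longrightarrow> (\<exists>s. (\<forall>k. \<bar>s k\<bar> = 1) \<and>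
    (\<integral>x. \<bar>\<Sum>k\<in>F. s k * h k x\<bar> \<partial>M) \<le> e * real (card F) + C)"
proof -
  define m where "m = measure M (space M)"
  have m0: "m \<ge> 0" by (simp add: m_def)
  have [measurable]: "h k \<in> borel_measurable M" for k using int by auto
  have B0: "B \<ge> 0"
  proof -
    have "0 \<le> (\<integral>x. \<bar>h 0 x\<bar> \<partial>M)" by (rule integral_nonneg_AE) simp
    then show ?thesis using bd[of 0] by linarith
  qed
  have e2: "e / 2 > 0" using e by simp
  obtain t where t: "t > 0" "\<forall>f\<in>range h. \<forall>A\<in>sets M. measure M A < t \<longrightarrow> mass M A f < e / 2"
    using equi e2 unfolding equi_integrable_def by blast
  \<comment> \<open>The level for which the Markov bound \<open>B / K\<close> is less than
    \<open>t\<close>.\<close>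
  define K where "K = B / t + 1"
  have K: "K > 0" using B0 t by (simp add: K_def add_nonneg_pos)
  define A where "A k = {x\<in>space M. K \<le> \<bar>h k x\<bar>}" for k
  have A [measurable]: "A k \<in> sets M" for k unfolding A_def by measurable
  have massA: "mass M (A k) (h k) \<le> e / 2" for k
  proof -
    have "measure M (A k) \<le> B / K"
      unfolding A_def using mass_markov[OF int K, of k] bd[of k] K by (meson divide_right_mono less_imp_le order_trans)
    also have "\<dots> < t" using K t B0 by (simp add: K_def field_simps)
    finally show ?thesis using t(2) A by (auto simp: less_imp_le)
  qed
  define g where "g k x = (if \<bar>h k x\<bar> < K then h k x else 0)" for k x
  have g [measurable]: "g k \<in> borel_measurable M" for k unfolding g_def by measurable
  have gK: "\<bar>g k x\<bar> \<le> K" for k x using K by (auto simp: g_def)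
  \<comment> \<open>The weight in the inequality \<bar>S\<bar> \<le> S^2 / (q N) + q N. The second
    term integrates to at most \<open>N * (e / 2)\<close>, and the first one to at most the constant
    \<open>C\<close>, as the factor \<open>N\<close> of the L_2 bound cancels.\<close>
  define q where "q = e / (2 * (m + 1))"
  have q: "q > 0" using e m0 by (simp add: q_def)
  have qm: "q * m \<le> e / 2"
    using e m0 by (simp add: q_def field_simps)
  define C where "C = K\<^sup>2 * m / q"
  have C: "C \<ge> 0" using m0 q by (simp add: C_def)
  show ?thesis
  proof (intro exI[of _ C] allI impI)
    fix F :: "nat set" assume F: "finite F"
    show "\<exists>s. (\<forall>k. \<bar>s k\<bar> = 1) \<and> (\<integral>x. \<bar>\<Sum>k\<in>F. s k * h k x\<bar> \<partial>M) \<le> e * real (card F) + C"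
    proof (cases "F = {}")
      case True
      then show ?thesis using C by (intro exI[of _ "\<lambda>_. 1"]) simp
    next
      case False
      define N where "N = real (card F)"
      have N: "N > 0" using F False by (simp add: N_def card_gt_0_iff)
      obtain s where s: "\<forall>k. \<bar>s k\<bar> = 1" "(\<integral>x. (\<Sum>k\<in>F. s k * g k x)\<^sup>2 \<partial>M) \<le> N * (K\<^sup>2 * m)"
        using signs_small_L2[of F g, OF F g gK] unfolding N_def m_def by blast
      define S where "S x = (\<Sum>k\<in>F. s k * g k x)" for x
      have [measurable]: "S \<in> borel_measurable M" unfolding S_def by measurable
      have SK: "\<bar>S x\<bar> \<le> N * K" for x
      proof -
        have "\<bar>S x\<bar> \<le> (\<Sum>k\<in>F. \<bar>s k * g k x\<bar>)" unfolding S_def by (rule sum_abs)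
        also have "\<dots> \<le> (\<Sum>k\<in>F. K)" using s(1) gK by (intro sum_mono) (simp add: abs_mult)
        finally show ?thesis by (simp add: N_def)
      qed
      have iS: "integrable M (\<lambda>x. (S x)\<^sup>2)"
      proof (rule integrable_const_bound[of _ "(N * K)\<^sup>2"])
        show "AE x in M. norm ((S x)\<^sup>2) \<le> (N * K)\<^sup>2"
          using SK N K by (auto simp: abs_le_square_iff[symmetric] less_imp_le)
      qed measurable
      have pw: "\<bar>\<Sum>k\<in>F. s k * h k x\<bar> \<le> ((S x)\<^sup>2 / (q * N) + q * N) + (\<Sum>k\<in>F. indicator (A k) x * \<bar>h k x\<bar>)"
        if x: "x \<in> space M" for x
      proof -
        have eq: "h k x = g k x + indicator (A k) x * h k x" for k
          using x by (auto simp: g_def A_def indicator_def)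
        have "\<bar>\<Sum>k\<in>F. s k * h k x\<bar> = \<bar>S x + (\<Sum>k\<in>F. s k * (indicator (A k) x * h k x))\<bar>"
          unfolding S_def by (subst eq) (simp add: distrib_left sum.distrib)
        also have "\<dots> \<le> \<bar>S x\<bar> + (\<Sum>k\<in>F. \<bar>s k * (indicator (A k) x * h k x)\<bar>)"
          using sum_abs[of "\<lambda>k. s k * (indicator (A k) x * h k x)" F] by linarith
        also have "(\<Sum>k\<in>F. \<bar>s k * (indicator (A k) x * h k x)\<bar>) = (\<Sum>k\<in>F. indicator (A k) x * \<bar>h k x\<bar>)"
          using s(1) by (intro sum.cong) (auto simp: abs_mult)
        also have "\<bar>S x\<bar> \<le> (S x)\<^sup>2 / (q * N) + q * N"
        proof -
          have "(\<bar>S x\<bar> - q * N)\<^sup>2 = (S x)\<^sup>2 - 2 * (\<bar>S x\<bar> * (q * N)) + (q * N) * (q * N)"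
            by (simp add: power2_eq_square algebra_simps)
          then have "2 * (\<bar>S x\<bar> * (q * N)) \<le> (S x)\<^sup>2 + (q * N) * (q * N)"
            using zero_le_power2[of "\<bar>S x\<bar> - q * N"] by linarith
          moreover have "0 \<le> \<bar>S x\<bar> * (q * N)" using q N by simp
          ultimately have "\<bar>S x\<bar> * (q * N) \<le> (S x)\<^sup>2 + (q * N) * (q * N)" by linarith
          moreover have qN: "q * N > 0" using q N by simp
          ultimately have "\<bar>S x\<bar> \<le> ((S x)\<^sup>2 + (q * N) * (q * N)) / (q * N)"
            by (simp only: pos_le_divide_eq)
          also have "\<dots> = (S x)\<^sup>2 / (q * N) + q * N" unfolding add_divide_distrib using qN by simp
          finally show ?thesis .
        qed
        finally show ?thesis by simp
      qed
      have "(\<integral>x. \<bar>\<Sum>k\<in>F. s k * h k x\<bar> \<partial>M)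
          \<le> (\<integral>x. ((S x)\<^sup>2 / (q * N) + q * N) + (\<Sum>k\<in>F. indicator (A k) x * \<bar>h k x\<bar>) \<partial>M)"
        using int iS pw A by (intro integral_mono Bochner_Integration.integrable_add Bochner_Integration.integrable_sum
          integrable_abs integrable_indicator_abs Bochner_Integration.integrable_mult_right integrable_divide_zero) auto
      also have "\<dots> = (\<integral>x. (S x)\<^sup>2 \<partial>M) / (q * N) + q * N * m + (\<Sum>k\<in>F. mass M (A k) (h k))"
        using int iS A unfolding mass_def m_def
        by (simp add: integrable_indicator_abs Bochner_Integration.integral_sum)
      also have "\<dots> \<le> N * (K\<^sup>2 * m) / (q * N) + N * (e / 2) + (\<Sum>k\<in>F. e / 2)"
      proof (intro add_mono sum_mono massA divide_right_mono)
        show "q * N * m \<le> N * (e / 2)" using mult_left_mono[OF qm, of N] N by (simp add: mult_ac)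
      qed (use s(2) q N in \<open>auto simp: S_def\<close>)
      also have "\<dots> = e * real (card F) + C" using N q by (simp add: C_def N_def)
      finally show ?thesis using s(1) by blast
    qed
  qed
qed

end

section \<open>Burkholder's weak type inequality\<close>

text \<open>Burkholder's function dominates \<open>of_bool (2 \<le> \<bar>s - t\<bar>) - \<bar>s + t\<bar>\<close>, vanishes at the origin and is
  concave in each variable separately; a martingale transform by signs moves only one of the coordinates
  \<open>s\<close>, \<open>t\<close> at each step.\<close>

definition burkholder :: "real \<Rightarrow> real \<Rightarrow> real" where
  "burkholder s t = (if \<bar>s\<bar> < 1 \<and> \<bar>t\<bar> < 1 then - (s * t) else 1 - \<bar>s + t\<bar>)"

text \<open>A supergradient of \<open>burkholder\<close> in the first variable; by symmetry,
  exchanging the arguments gives one in the second. It is explicit so as to be measurable and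
  bounded by 1, hence usable as a test function against a weakly null sequence.\<close>

definition burkholder_slope :: "real \<Rightarrow> real \<Rightarrow> real" where
  "burkholder_slope s t = (if \<bar>s\<bar> < 1 \<and> \<bar>t\<bar> < 1 then - t else - sgn (s + t))"

lemma burkholder_sym: "burkholder s t = burkholder t s"
  by (simp add: burkholder_def mult.commute add.commute conj_commute)

lemma burkholder_slope_le_1: "\<bar>burkholder_slope s t\<bar> \<le> 1"
  by (auto simp: burkholder_slope_def sgn_if)

lemma burkholder_measurable [measurable]: "case_prod burkholder \<in> borel_measurable (borel \<Otimes>\<^sub>M borel)"
  unfolding burkholder_def by measurable

lemma burkholder_slope_measurable [measurable]: "case_prod burkholder_slope \<in> borel_measurable (borel \<Otimes>\<^sub>M borel)"
  unfolding burkholder_slope_def sgn_if by measurable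

lemma burkholder_bound: "\<bar>burkholder s t\<bar> \<le> 2 * (\<bar>s\<bar> + \<bar>t\<bar>)"
proof (cases "\<bar>s\<bar> < 1 \<and> \<bar>t\<bar> < 1")
  case True
  have "\<bar>s\<bar> * \<bar>t\<bar> \<le> \<bar>s\<bar> * 1" using True by (intro mult_left_mono) auto
  then show ?thesis using True by (simp add: burkholder_def abs_mult)
qed (auto simp: burkholder_def)

text \<open>Inside the square \<bar>s - t\<bar> is less than 2 and the left side vanishes; outside,
  the right side is exactly 1.\<close>

lemma burkholder_majorant: "of_bool (2 \<le> \<bar>s - t\<bar>) \<le> burkholder s t + \<bar>s + t\<bar>"
proof (cases "\<bar>s\<bar> < 1 \<and> \<bar>t\<bar> < 1")
  case True
  have "s * t \<le> \<bar>s + t\<bar>"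
  proof (cases "s * t > 0")
    case True
    have "s * t = \<bar>s\<bar> * \<bar>t\<bar>" using True by (simp add: abs_mult[symmetric])
    also have "\<dots> \<le> \<bar>s\<bar> * 1" using \<open>\<bar>s\<bar> < 1 \<and> \<bar>t\<bar> < 1\<close> by (intro mult_left_mono) auto
    also have "\<dots> \<le> \<bar>s + t\<bar>" using True by (auto simp: zero_less_mult_iff)
    finally show ?thesis .
  qed auto
  then show ?thesis using True by (auto simp: burkholder_def)
qed (auto simp: burkholder_def)

text \<open>For \<bar>t\<bar> < 1 the two formulas agree at \<open>s = 1\<close> and
  \<open>s = - 1\<close>, and the slope falls from 1 through \<open>- t\<close> to
  \<open>- 1\<close>. If only one of the two points lies in the square, the inequality reduces to
  the nonnegativity of a product such as \<open>(1 - u) * (1 - t)\<close>.\<close>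

lemma burkholder_supergradient: "burkholder (s + h) t \<le> burkholder s t + burkholder_slope s t * h"
proof (cases "\<bar>s\<bar> < 1 \<and> \<bar>t\<bar> < 1")
  case True
  then have base: "burkholder s t + burkholder_slope s t * h = - ((s + h) * t)"
    by (simp add: burkholder_def burkholder_slope_def algebra_simps)
  show ?thesis
  proof (cases "\<bar>s + h\<bar> < 1")
    case True
    then show ?thesis using \<open>\<bar>s\<bar> < 1 \<and> \<bar>t\<bar> < 1\<close> unfolding base by (simp add: burkholder_def)
  next
    case False
    define u where "u = s + h"
    have t: "\<bar>t\<bar> < 1" and u: "\<bar>u\<bar> \<ge> 1" using True False by (auto simp: u_def)
    have "1 - \<bar>u + t\<bar> \<le> - (u * t)"
    proof (cases "u \<ge> 1")
      case True
      then have "0 \<le> (u - 1) * (1 - t)" using t by (intro mult_nonneg_nonneg) auto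
      then show ?thesis using True t by (simp add: algebra_simps)
    next
      case False
      then have u1: "u \<le> - 1" using u by linarith
      then have "0 \<le> (- 1 - u) * (1 + t)" using t by (intro mult_nonneg_nonneg) auto
      then show ?thesis using u1 t by (simp add: algebra_simps)
    qed
    then show ?thesis using False unfolding base by (simp add: burkholder_def u_def)
  qed
next
  case False
  then have base: "burkholder s t + burkholder_slope s t * h = 1 - \<bar>s + t\<bar> - sgn (s + t) * h"
    by (auto simp: burkholder_def burkholder_slope_def)
  have out: "1 - \<bar>s + h + t\<bar> \<le> 1 - \<bar>s + t\<bar> - sgn (s + t) * h" by (auto simp: sgn_if)
  show ?thesis
  proof (cases "\<bar>s + h\<bar> < 1 \<and> \<bar>t\<bar> < 1")
    case True
    define u where "u = s + h"
    have t: "\<bar>t\<bar> < 1" and u: "\<bar>u\<bar> < 1" and s: "\<bar>s\<bar> \<ge> 1" using True False by (auto simp: u_def)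
    have "- (u * t) \<le> 1 - \<bar>s + t\<bar> - sgn (s + t) * h"
    proof (cases "s \<ge> 1")
      case True
      have "0 \<le> (1 - u) * (1 - t)" using t u by (intro mult_nonneg_nonneg) auto
      moreover have "s + t > 0" using True t by linarith
      ultimately show ?thesis by (simp add: algebra_simps u_def)
    next
      case False
      then have s1: "s \<le> - 1" using s by linarith
      have "0 \<le> (1 + u) * (1 + t)" using t u by (intro mult_nonneg_nonneg) auto
      moreover have "s + t < 0" using s1 t by linarith
      ultimately show ?thesis by (simp add: algebra_simps u_def)
    qed
    then show ?thesis using True unfolding base by (simp add: burkholder_def u_def)
  next
    case False
    then have "burkholder (s + h) t = 1 - \<bar>s + h + t\<bar>" unfolding burkholder_def by (rule if_not_P)
    then show ?thesis using out unfolding base by simp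
  qed
qed

section \<open>Sign transforms of finite sums\<close>

definition pos_sum :: "(nat \<Rightarrow> real) \<Rightarrow> (nat \<Rightarrow> 'b \<Rightarrow> real) \<Rightarrow> nat \<Rightarrow> 'b \<Rightarrow> real" where
  "pos_sum a f k x = (\<Sum>i<k. max (a i) 0 * f i x)"

definition neg_sum :: "(nat \<Rightarrow> real) \<Rightarrow> (nat \<Rightarrow> 'b \<Rightarrow> real) \<Rightarrow> nat \<Rightarrow> 'b \<Rightarrow> real" where
  "neg_sum a f k x = (\<Sum>i<k. min (a i) 0 * f i x)"

lemma pos_neg_sum:
  "pos_sum a f k x + neg_sum a f k x = (\<Sum>i<k. a i * f i x)"
  "pos_sum a f k x - neg_sum a f k x = (\<Sum>i<k. \<bar>a i\<bar> * f i x)"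
  unfolding pos_sum_def neg_sum_def
  by (auto simp: max_def min_def abs_if simp flip: sum.distrib sum_subtractf distrib_right left_diff_distrib
      intro!: sum.cong)

lemma (in finite_measure) integrable_bounded_mult:
  assumes "integrable M f" and [measurable]: "g \<in> borel_measurable M" and "\<And>x. \<bar>g x\<bar> \<le> (1::real)"
  shows "integrable M (\<lambda>x. g x * f x)"
proof (rule Bochner_Integration.integrable_bound[OF assms(1)])
  have [measurable]: "f \<in> borel_measurable M" using assms(1) by auto
  show "(\<lambda>x. g x * f x) \<in> borel_measurable M" by measurable
  show "AE x in M. norm (g x * f x) \<le> norm (f x)"
    using mult_right_mono[OF assms(3), of "\<bar>f _\<bar>"] by (auto simp: abs_mult)
qed

text \<open>The integral of \<open>burkholder\<close> along the partial sums scaled by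
  \<open>l\<close> starts at 0 and behaves like an approximate supermartingale: \<open>f k\<close>
  is almost orthogonal to the slope, so step \<open>k\<close> adds at most \<bar>a k\<bar> * e k /
  l. The majorant converts the final value into a measure bound, its threshold 2 becoming
  \<open>2 * l\<close>. Coefficients up to 2 leave room for rounding numbers of [-1,1] to a
  net.\<close>

lemma (in finite_measure) burkholder_weak_type:
  fixes f :: "nat \<Rightarrow> 'a \<Rightarrow> real"
  assumes int: "\<And>k. integrable M (f k)" and a: "\<And>k. k < n \<Longrightarrow> \<bar>a k\<bar> \<le> 2" and l: "l > 0"
    and small: "\<And>k. k < n \<Longrightarrow>
        \<bar>\<integral>x. burkholder_slope (pos_sum a f k x / l) (neg_sum a f k x / l) * f k x \<partial>M\<bar> \<le> e k"
      "\<And>k. k < n \<Longrightarrow>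
        \<bar>\<integral>x. burkholder_slope (neg_sum a f k x / l) (pos_sum a f k x / l) * f k x \<partial>M\<bar> \<le> e k"
  shows "measure M {x\<in>space M. 2 * l \<le> \<bar>\<Sum>i<n. \<bar>a i\<bar> * f i x\<bar>}
    \<le> ((\<integral>x. \<bar>\<Sum>i<n. a i * f i x\<bar> \<partial>M) + 2 * (\<Sum>k<n. e k)) / l"
proof -
  define S N where "S k x = pos_sum a f k x / l" and "N k x = neg_sum a f k x / l" for k x
  have [measurable]: "f k \<in> borel_measurable M" for k using int by auto
  have iS: "integrable M (S k)" for k unfolding S_def pos_sum_def
    using int by (intro integrable_divide_zero Bochner_Integration.integrable_sum Bochner_Integration.integrable_mult_right) auto
  have iN: "integrable M (N k)" for k unfolding N_def neg_sum_def
    using int by (intro integrable_divide_zero Bochner_Integration.integrable_sum Bochner_Integration.integrable_mult_right) auto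
  have [measurable]: "S k \<in> borel_measurable M" "N k \<in> borel_measurable M" for k using iS iN by auto
  have iU: "integrable M (\<lambda>x. burkholder (S k x) (N k x))" for k
  proof (rule Bochner_Integration.integrable_bound)
    show "integrable M (\<lambda>x. 2 * (\<bar>S k x\<bar> + \<bar>N k x\<bar>))" using iS iN by auto
    show "AE x in M. norm (burkholder (S k x) (N k x)) \<le> norm (2 * (\<bar>S k x\<bar> + \<bar>N k x\<bar>))"
      using burkholder_bound by (auto intro: order_trans)
  qed measurable
  have iD: "integrable M (\<lambda>x. burkholder_slope (S k x) (N k x) * f k x)"
    "integrable M (\<lambda>x. burkholder_slope (N k x) (S k x) * f k x)" for k
    by (intro integrable_bounded_mult int burkholder_slope_le_1; measurable)+
  have bound: "(\<integral>x. burkholder (S k x) (N k x) \<partial>M) \<le> 2 * (\<Sum>i<k. e i) / l" if "k \<le> n" for k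
    using that
  proof (induction k)
    case 0
    then show ?case by (simp add: S_def N_def pos_sum_def neg_sum_def burkholder_def)
  next
    case (Suc k)
    then have k: "k < n" by simp
    define c where "c = \<bar>a k\<bar> / l"
    have c: "0 \<le> c" "c \<le> 2 / l" using a[OF k] l by (auto simp: c_def divide_right_mono)
    have e0: "0 \<le> e k" using small(1)[OF k] by linarith
    have "(\<integral>x. burkholder (S (Suc k) x) (N (Suc k) x) \<partial>M) \<le> (\<integral>x. burkholder (S k x) (N k x) \<partial>M) + c * e k"
    proof (cases "a k \<ge> 0")
      case True
      have "S (Suc k) x = S k x + c * f k x" "N (Suc k) x = N k x" for x
        using True by (auto simp: S_def N_def pos_sum_def neg_sum_def c_def add_divide_distrib)
      then have "burkholder (S (Suc k) x) (N (Suc k) x) \<le> burkholder (S k x) (N k x) + c * (burkholder_slope (S k x) (N k x) * f k x)" for x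
        using burkholder_supergradient[of "S k x" "c * f k x" "N k x"] by (simp add: mult_ac)
      then have "(\<integral>x. burkholder (S (Suc k) x) (N (Suc k) x) \<partial>M)
          \<le> (\<integral>x. burkholder (S k x) (N k x) + c * (burkholder_slope (S k x) (N k x) * f k x) \<partial>M)"
        using iU iD by (intro integral_mono) auto
      also have "\<dots> = (\<integral>x. burkholder (S k x) (N k x) \<partial>M) + c * (\<integral>x. burkholder_slope (S k x) (N k x) * f k x \<partial>M)"
        using iU iD by simp
      also have "\<dots> \<le> (\<integral>x. burkholder (S k x) (N k x) \<partial>M) + c * e k"
        using small(1)[OF k] c(1) by (intro add_left_mono mult_left_mono) (auto simp: S_def N_def)
      finally show ?thesis .
    next
      case False
      have "S (Suc k) x = S k x" "N (Suc k) x = N k x + - (c * f k x)" for x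
        using False by (auto simp: S_def N_def pos_sum_def neg_sum_def c_def add_divide_distrib)
      then have "burkholder (S (Suc k) x) (N (Suc k) x) \<le> burkholder (S k x) (N k x) + - c * (burkholder_slope (N k x) (S k x) * f k x)" for x
        using burkholder_supergradient[of "N k x" "- (c * f k x)" "S k x"] by (simp add: mult_ac burkholder_sym)
      then have "(\<integral>x. burkholder (S (Suc k) x) (N (Suc k) x) \<partial>M)
          \<le> (\<integral>x. burkholder (S k x) (N k x) + - c * (burkholder_slope (N k x) (S k x) * f k x) \<partial>M)"
        using iU iD by (intro integral_mono) auto
      also have "\<dots> = (\<integral>x. burkholder (S k x) (N k x) \<partial>M) + c * (- (\<integral>x. burkholder_slope (N k x) (S k x) * f k x \<partial>M))"
        using iU iD by simp
      also have "\<dots> \<le> (\<integral>x. burkholder (S k x) (N k x) \<partial>M) + c * e k"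
        using small(2)[OF k] c(1) by (intro add_left_mono mult_left_mono) (auto simp: S_def N_def)
      finally show ?thesis .
    qed
    also have "\<dots> \<le> 2 * (\<Sum>i<k. e i) / l + 2 / l * e k"
      using Suc c e0 by (intro add_mono mult_right_mono) auto
    also have "\<dots> = 2 * (\<Sum>i<Suc k. e i) / l" by (simp add: add_divide_distrib distrib_left)
    finally show ?case .
  qed
  define A where "A = {x\<in>space M. 2 * l \<le> \<bar>\<Sum>i<n. \<bar>a i\<bar> * f i x\<bar>}"
  have [measurable]: "A \<in> sets M" unfolding A_def by measurable
  have Aeq: "indicator A x \<le> burkholder (S n x) (N n x) + \<bar>\<Sum>i<n. a i * f i x\<bar> / l" if "x \<in> space M" for x
  proof -
    have "\<bar>\<Sum>i<n. \<bar>a i\<bar> * f i x\<bar> = l * \<bar>S n x - N n x\<bar>"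
      using l unfolding pos_neg_sum(2)[symmetric] S_def N_def by (simp add: diff_divide_distrib[symmetric] abs_divide)
    then have "indicator A x = (of_bool (2 \<le> \<bar>S n x - N n x\<bar>) :: real)"
      using l that by (auto simp: A_def indicator_def mult.commute)
    also have "\<dots> \<le> burkholder (S n x) (N n x) + \<bar>S n x + N n x\<bar>" by (rule burkholder_majorant)
    also have "\<bar>S n x + N n x\<bar> = \<bar>\<Sum>i<n. a i * f i x\<bar> / l"
      using l unfolding pos_neg_sum(1)[symmetric] S_def N_def by (simp add: add_divide_distrib[symmetric] abs_divide)
    finally show ?thesis .
  qed
  have iF: "integrable M (\<lambda>x. \<bar>\<Sum>i<n. a i * f i x\<bar> / l)"
    using int by (intro integrable_divide_zero integrable_abs Bochner_Integration.integrable_sum Bochner_Integration.integrable_mult_right) auto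
  have "measure M A = (\<integral>x. indicator A x \<partial>M)" by simp
  also have "\<dots> \<le> (\<integral>x. burkholder (S n x) (N n x) + \<bar>\<Sum>i<n. a i * f i x\<bar> / l \<partial>M)"
  proof (rule integral_mono)
    show "integrable M (indicator A :: 'a \<Rightarrow> real)"
      by (intro integrable_real_indicator) (auto simp: emeasure_finite less_top[symmetric])
  qed (use iU iF Aeq in auto)
  also have "\<dots> = (\<integral>x. burkholder (S n x) (N n x) \<partial>M) + (\<integral>x. \<bar>\<Sum>i<n. a i * f i x\<bar> \<partial>M) / l"
    using iU iF by simp
  also have "\<dots> \<le> 2 * (\<Sum>i<n. e i) / l + (\<integral>x. \<bar>\<Sum>i<n. a i * f i x\<bar> \<partial>M) / l"
    using bound[of n] by simp
  finally show ?thesis unfolding A_def by (simp add: add_divide_distrib)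
qed

section \<open>Thinning a weakly null sequence\<close>

lemma (in finite_measure) norm_sum_coeff_le:
  fixes f :: "nat \<Rightarrow> 'a \<Rightarrow> real"
  assumes int: "\<And>k. integrable M (f k)" and bd: "\<And>k. (\<integral>x. \<bar>f k x\<bar> \<partial>M) \<le> B"
    and c: "\<And>k. k < n \<Longrightarrow> \<bar>c k\<bar> \<le> d k"
  shows "(\<integral>x. \<bar>\<Sum>k<n. c k * f k x\<bar> \<partial>M) \<le> (\<Sum>k<n. d k) * B"
proof -
  have "(\<integral>x. \<bar>\<Sum>k<n. c k * f k x\<bar> \<partial>M) \<le> (\<integral>x. (\<Sum>k<n. \<bar>c k\<bar> * \<bar>f k x\<bar>) \<partial>M)"
    using int sum_abs[of "\<lambda>k. c k * f k _" "{..<n}"]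
    by (intro integral_mono integrable_abs Bochner_Integration.integrable_sum Bochner_Integration.integrable_mult_right)
      (auto simp: abs_mult)
  also have "\<dots> = (\<Sum>k<n. \<bar>c k\<bar> * (\<integral>x. \<bar>f k x\<bar> \<partial>M))"
    using int by (subst Bochner_Integration.integral_sum) auto
  also have "\<dots> \<le> (\<Sum>k<n. d k * B)"
  proof (intro sum_mono mult_mono)
    fix k assume "k \<in> {..<n}"
    then show "\<bar>c k\<bar> \<le> d k" "0 \<le> d k" using c[of k] by auto
    show "0 \<le> (\<integral>x. \<bar>f k x\<bar> \<partial>M)" by (rule integral_nonneg_AE) simp
  qed (use bd in auto)
  finally show ?thesis by (simp add: sum_distrib_right)
qed

text \<open>The slopes to be tested at step \<open>k\<close> involve only the functions and
  coefficients with index below \<open>k\<close>. With coefficients from finite sets these are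
  finitely many bounded functions, so weak nullness makes all late \<open>f n\<close> almost
  orthogonal to all of them at once.\<close>

lemma (in finite_measure) thinning_grid:
  fixes f :: "nat \<Rightarrow> 'a \<Rightarrow> real" and G :: "nat \<Rightarrow> real set"
  assumes int: "\<And>k. integrable M (f k)"
    and weak: "\<And>g. g \<in> borel_measurable M \<Longrightarrow> (\<And>x. \<bar>g x\<bar> \<le> 1) \<Longrightarrow> (\<lambda>n. \<integral>x. g x * f n x \<partial>M) \<longlonglongrightarrow> 0"
    and G: "\<And>k. finite (G k)" and e: "\<And>k. e k > 0"
  shows "\<exists>r. strict_mono (r :: nat \<Rightarrow> nat) \<and> (\<forall>k a. (\<forall>i<k. a i \<in> G i) \<longrightarrow>
      \<bar>\<integral>x. burkholder_slope (pos_sum a (\<lambda>i. f (r i)) k x / l) (neg_sum a (\<lambda>i. f (r i)) k x / l) * f (r k) x \<partial>M\<bar> \<le> e k \<and>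
      \<bar>\<integral>x. burkholder_slope (neg_sum a (\<lambda>i. f (r i)) k x / l) (pos_sum a (\<lambda>i. f (r i)) k x / l) * f (r k) x \<partial>M\<bar> \<le> e k)"
proof -
  have [measurable]: "f k \<in> borel_measurable M" for k using int by auto
  have sum_cong: "pos_sum a (\<lambda>i. f (r i)) k = pos_sum b (\<lambda>i. f (q i)) k"
    "neg_sum a (\<lambda>i. f (r i)) k = neg_sum b (\<lambda>i. f (q i)) k"
    if "\<And>i. i < k \<Longrightarrow> a i = b i" "\<And>i. i < k \<Longrightarrow> r i = q i" for a b r q k
    using that by (auto simp: pos_sum_def neg_sum_def fun_eq_iff intro!: sum.cong)
  define B where "B r k a n \<longleftrightarrow>
      \<bar>\<integral>x. burkholder_slope (pos_sum a (\<lambda>i. f (r i)) k x / l) (neg_sum a (\<lambda>i. f (r i)) k x / l) * f n x \<partial>M\<bar> \<le> e k \<and>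
      \<bar>\<integral>x. burkholder_slope (neg_sum a (\<lambda>i. f (r i)) k x / l) (pos_sum a (\<lambda>i. f (r i)) k x / l) * f n x \<partial>M\<bar> \<le> e k"
    for r :: "nat \<Rightarrow> nat" and k a n
  have B_cong: "B r k a n = B q k b n"
    if "\<And>i. i < k \<Longrightarrow> a i = b i" "\<And>i. i < k \<Longrightarrow> r i = q i" for r q k a b n
  proof -
    note c = sum_cong[where k = k and a = a and b = b and r = r and q = q, OF that]
    show ?thesis unfolding B_def by (simp only: c)
  qed
  have ev: "\<forall>\<^sub>F n in sequentially. B r k a n" for r k a
  proof -
    have "\<forall>\<^sub>F n in sequentially. \<bar>\<integral>x. g x * f n x \<partial>M\<bar> \<le> e k"
      if "g \<in> borel_measurable M" "\<And>x. \<bar>g x\<bar> \<le> 1" for g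
    proof -
      have "\<forall>\<^sub>F n in sequentially. dist (\<integral>x. g x * f n x \<partial>M) 0 < e k"
        using weak[OF that] e by (rule tendstoD)
      then show ?thesis by eventually_elim simp
    qed
    note * = this
    have [measurable]: "pos_sum a (\<lambda>i. f (r i)) k \<in> borel_measurable M"
      "neg_sum a (\<lambda>i. f (r i)) k \<in> borel_measurable M"
      unfolding pos_sum_def neg_sum_def by measurable
    show ?thesis unfolding B_def
      by (intro eventually_conj *[of "\<lambda>x. burkholder_slope (_ x) (_ x)"] burkholder_slope_le_1; measurable)
  qed
  \<comment> \<open>\<open>Pi\<^sub>E\<close> fixes the values from \<open>k\<close> on, which makes
    the set of coefficient sequences finite; \<open>B_cong\<close> shows that nothing is
    lost.\<close>
  define P where "P r k n \<longleftrightarrow> (\<forall>i<k. r i < n) \<and> (\<forall>a\<in>Pi\<^sub>E {..<k} G. B r k a n)" for r k n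
  have "\<exists>r. \<forall>k. P r k (r k)"
  proof (rule dependent_wellorder_choice)
    show "P r k n = P q k n" if "\<And>y. y < k \<Longrightarrow> r y = q y" for n r q k
    proof -
      have "B r k a n = B q k a n" for a using that by (intro B_cong) auto
      then show ?thesis unfolding P_def using that by simp
    qed
    show "\<exists>n. P r k n" for k r
    proof -
      have "finite (Pi\<^sub>E {..<k} G)" using G by (intro finite_PiE) auto
      then have "\<forall>\<^sub>F n in sequentially. \<forall>a\<in>Pi\<^sub>E {..<k} G. B r k a n"
        by (intro eventually_ball_finite) (auto intro: ev)
      moreover have "\<forall>\<^sub>F n in sequentially. \<forall>i\<in>{..<k}. r i < n"
        by (intro eventually_ball_finite) (auto intro: eventually_gt_at_top)
      ultimately have "\<forall>\<^sub>F n in sequentially. P r k n" by eventually_elim (simp add: P_def)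
      then show ?thesis by (auto simp: eventually_sequentially)
    qed
  qed
  then obtain r where r: "\<And>k. P r k (r k)" by blast
  have "strict_mono r"
    using r unfolding P_def strict_mono_def by blast
  moreover have "B r k a (r k)" if "\<forall>i<k. a i \<in> G i" for k a
  proof -
    have "restrict a {..<k} \<in> Pi\<^sub>E {..<k} G" using that by auto
    then have "B r k (restrict a {..<k}) (r k)" using r unfolding P_def by blast
    moreover have "B r k (restrict a {..<k}) (r k) = B r k a (r k)" by (intro B_cong) auto
    ultimately show ?thesis by simp
  qed
  ultimately show ?thesis unfolding B_def by blast
qed

text \<open>Total boundedness yields centres that may lie outside [-1,1]. A radius of at most 1
  keeps those that matter within the coefficient bound 2 of
  \<open>burkholder_weak_type\<close>.\<close>

lemma finite_net_interval:
  assumes "r > (0::real)" "r \<le> 1"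
  shows "\<exists>G. finite G \<and> (\<forall>y\<in>G. \<bar>y\<bar> \<le> 2) \<and> (\<forall>y. \<bar>y\<bar> \<le> 1 \<longrightarrow> (\<exists>z\<in>G. \<bar>y - z\<bar> \<le> r))"
proof -
  obtain k where k: "finite k" "{-1..1::real} \<subseteq> (\<Union>x\<in>k. ball x r)"
    using compact_Icc[of "-1::real" 1] assms(1) unfolding compact_eq_totally_bounded by blast
  show ?thesis
  proof (intro exI[of _ "{z\<in>k. \<bar>z\<bar> \<le> 2}"] conjI allI impI)
    fix y :: real assume y: "\<bar>y\<bar> \<le> 1"
    then obtain z where z: "z \<in> k" "dist z y < r" using k(2) by (auto simp: abs_le_iff subset_iff)
    then show "\<exists>z\<in>{z\<in>k. \<bar>z\<bar> \<le> 2}. \<bar>y - z\<bar> \<le> r"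
      using y assms(2) by (intro bexI[of _ z]) (auto simp: dist_real_def)
  qed (use k in auto)
qed

text \<open>The thinned sequence behaves like a martingale difference sequence up to the error \<open>e\<close>, so that
  Burkholder's weak type inequality for the transform by the signs of the coefficients is available.\<close>

lemma (in finite_measure) weakly_null_thinning:
  fixes f :: "nat \<Rightarrow> 'a \<Rightarrow> real"
  assumes int: "\<And>k. integrable M (f k)" and bd: "\<And>k. (\<integral>x. \<bar>f k x\<bar> \<partial>M) \<le> B"
    and weak: "\<And>g. g \<in> borel_measurable M \<Longrightarrow> (\<And>x. \<bar>g x\<bar> \<le> 1) \<Longrightarrow> (\<lambda>n. \<integral>x. g x * f n x \<partial>M) \<longlonglongrightarrow> 0"
    and l: "l > 0" and e: "e > 0"
  shows "\<exists>r. strict_mono (r :: nat \<Rightarrow> nat) \<and>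
    (\<forall>n a. (\<forall>i<n. \<bar>a i\<bar> \<le> 1) \<longrightarrow> measure M {x\<in>space M. 3 * l \<le> \<bar>\<Sum>i<n. \<bar>a i\<bar> * f (r i) x\<bar>}
      \<le> ((\<integral>x. \<bar>\<Sum>i<n. a i * f (r i) x\<bar> \<partial>M) + e) / l)"
proof -
  have "0 \<le> (\<integral>x. \<bar>f 0 x\<bar> \<partial>M)" by (rule integral_nonneg_AE) simp
  then have B: "B \<ge> 0" using bd[of 0] by linarith
  \<comment> \<open>Rounding costs at most \<open>2 * q * B\<close> twice, in the norm of the
    rounded sum and in the measure of \<open>Y\<close>. The choice keeps both together below
    \<open>e / 2\<close>; the other half of \<open>e\<close> is left for the
    \<open>e' k\<close>.\<close>
  define q where "q = min 1 (e / (8 * (B + 1)))"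
  have q: "0 < q" "q \<le> 1" using e B by (auto simp: q_def)
  have qB: "4 * q * B \<le> e / 2"
  proof -
    have "4 * q * B \<le> 4 * (e / (8 * (B + 1))) * B"
      using B by (intro mult_right_mono mult_left_mono) (auto simp: q_def)
    also have "\<dots> = e / 2 * (B / (B + 1))" using B by (simp add: field_simps)
    also have "\<dots> \<le> e / 2 * 1" using B e by (intro mult_left_mono) (auto simp: field_simps)
    finally show ?thesis by simp
  qed
  have geo: "(\<Sum>k<n. (1/2::real)^k) \<le> 2" for n
    by (subst geometric_sum) (auto simp: field_simps)
  define d where "d k = q * (1/2)^k" for k
  have d: "0 < d k" "d k \<le> 1" for k
  proof -
    show "0 < d k" using q by (simp add: d_def)
    have "q * (1/2)^k \<le> 1 * 1" using q by (intro mult_mono) (auto simp: power_le_one)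
    then show "d k \<le> 1" by (simp add: d_def)
  qed
  have dsum: "(\<Sum>k<n. d k) \<le> 2 * q" for n
    using mult_left_mono[OF geo[of n], of q] q by (simp add: d_def sum_distrib_left mult.commute)
  define G where "G k = (SOME G. finite G \<and> (\<forall>y\<in>G. \<bar>y\<bar> \<le> 2) \<and> (\<forall>y. \<bar>y\<bar> \<le> 1 \<longrightarrow> (\<exists>z\<in>G. \<bar>y - z\<bar> \<le> d k)))" for k
  have G: "finite (G k)" "\<And>y. y \<in> G k \<Longrightarrow> \<bar>y\<bar> \<le> 2" "\<And>y. \<bar>y\<bar> \<le> 1 \<Longrightarrow> \<exists>z\<in>G k. \<bar>y - z\<bar> \<le> d k" for k
    using someI_ex[OF finite_net_interval[OF d(1,2)[of k]]] unfolding G_def[symmetric] by blast+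
  define e' where "e' k = e / 8 * (1/2)^k" for k
  have e': "e' k > 0" for k using e by (simp add: e'_def)
  have e'sum: "2 * (\<Sum>k<n. e' k) \<le> e / 2" for n
    using mult_left_mono[OF geo[of n], of "e/4"] e by (simp add: e'_def sum_distrib_left mult.commute)
  obtain r where r: "strict_mono r" "\<And>k a. \<forall>i<k. a i \<in> G i \<Longrightarrow>
      \<bar>\<integral>x. burkholder_slope (pos_sum a (\<lambda>i. f (r i)) k x / l) (neg_sum a (\<lambda>i. f (r i)) k x / l) * f (r k) x \<partial>M\<bar> \<le> e' k \<and>
      \<bar>\<integral>x. burkholder_slope (neg_sum a (\<lambda>i. f (r i)) k x / l) (pos_sum a (\<lambda>i. f (r i)) k x / l) * f (r k) x \<partial>M\<bar> \<le> e' k"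
    using thinning_grid[where l = l and f = f and G = G and e = e', OF int weak G(1) e'] by blast
  have "measure M {x\<in>space M. 3 * l \<le> \<bar>\<Sum>i<n. \<bar>a i\<bar> * f (r i) x\<bar>}
      \<le> ((\<integral>x. \<bar>\<Sum>i<n. a i * f (r i) x\<bar> \<partial>M) + e) / l"
    if a: "\<And>i. i < n \<Longrightarrow> \<bar>a i\<bar> \<le> 1" for n a
  proof -
    have [measurable]: "f k \<in> borel_measurable M" for k using int by auto
    have "\<exists>z. i < n \<longrightarrow> z \<in> G i \<and> \<bar>a i - z\<bar> \<le> d i" for i
      using G(3)[OF a, of i] by blast
    then obtain b where b: "\<And>i. i < n \<Longrightarrow> b i \<in> G i" "\<And>i. i < n \<Longrightarrow> \<bar>a i - b i\<bar> \<le> d i" by metis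
    \<comment> \<open>The threshold \<open>3 * l\<close> is shared: \<open>2 * l\<close> for the sum
      with rounded coefficients, handled by the weak type bound, and \<open>l\<close> for the
      rounding error, handled by Markov's inequality.\<close>
    define X where "X = {x\<in>space M. 2 * l \<le> \<bar>\<Sum>i<n. \<bar>b i\<bar> * f (r i) x\<bar>}"
    define Y where "Y = {x\<in>space M. l \<le> \<bar>\<Sum>i<n. (\<bar>a i\<bar> - \<bar>b i\<bar>) * f (r i) x\<bar>}"
    define Z where "Z = {x\<in>space M. 3 * l \<le> \<bar>\<Sum>i<n. \<bar>a i\<bar> * f (r i) x\<bar>}"
    have [measurable]: "X \<in> sets M" "Y \<in> sets M" "Z \<in> sets M" unfolding X_def Y_def Z_def by measurable
    have isum: "integrable M (\<lambda>x. \<Sum>i<n. c i * f (r i) x)" for c :: "nat \<Rightarrow> real"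
      using int by (intro Bochner_Integration.integrable_sum Bochner_Integration.integrable_mult_right)
    have "measure M X \<le> ((\<integral>x. \<bar>\<Sum>i<n. b i * f (r i) x\<bar> \<partial>M) + 2 * (\<Sum>k<n. e' k)) / l"
      unfolding X_def
    proof (rule burkholder_weak_type)
      show "\<bar>b k\<bar> \<le> 2" if "k < n" for k using G(2) b(1) that by blast
    qed (use int l r(2) b(1) in auto)
    also have "(\<integral>x. \<bar>\<Sum>i<n. b i * f (r i) x\<bar> \<partial>M)
        \<le> (\<integral>x. \<bar>\<Sum>i<n. a i * f (r i) x\<bar> \<partial>M) + (\<integral>x. \<bar>\<Sum>i<n. (b i - a i) * f (r i) x\<bar> \<partial>M)"
    proof -
      have "(\<integral>x. \<bar>\<Sum>i<n. b i * f (r i) x\<bar> \<partial>M)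
          \<le> (\<integral>x. \<bar>\<Sum>i<n. a i * f (r i) x\<bar> + \<bar>\<Sum>i<n. (b i - a i) * f (r i) x\<bar> \<partial>M)"
      proof (rule integral_mono)
        fix x
        have "(\<Sum>i<n. b i * f (r i) x) = (\<Sum>i<n. a i * f (r i) x) + (\<Sum>i<n. (b i - a i) * f (r i) x)"
          by (simp add: left_diff_distrib sum_subtractf)
        then show "\<bar>\<Sum>i<n. b i * f (r i) x\<bar> \<le> \<bar>\<Sum>i<n. a i * f (r i) x\<bar> + \<bar>\<Sum>i<n. (b i - a i) * f (r i) x\<bar>"
          by linarith
      qed (intro integrable_abs Bochner_Integration.integrable_add isum)+
      then show ?thesis using isum by simp
    qed
    also have "(\<integral>x. \<bar>\<Sum>i<n. (b i - a i) * f (r i) x\<bar> \<partial>M) \<le> (\<Sum>k<n. d k) * B"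
      using int bd b(2) by (intro norm_sum_coeff_le) (auto simp: abs_minus_commute)
    finally have X: "measure M X \<le> ((\<integral>x. \<bar>\<Sum>i<n. a i * f (r i) x\<bar> \<partial>M) + (\<Sum>k<n. d k) * B + 2 * (\<Sum>k<n. e' k)) / l"
      using l by (simp add: divide_right_mono)
    have "l * measure M Y = (\<integral>x. l * indicator Y x \<partial>M)" by simp
    also have "\<dots> \<le> (\<integral>x. \<bar>\<Sum>i<n. (\<bar>a i\<bar> - \<bar>b i\<bar>) * f (r i) x\<bar> \<partial>M)"
    proof (rule integral_mono)
      show "integrable M (\<lambda>x. l * indicator Y x)"
        by (intro Bochner_Integration.integrable_mult_right integrable_real_indicator)
          (auto simp: emeasure_finite less_top[symmetric])
      show "integrable M (\<lambda>x. \<bar>\<Sum>i<n. (\<bar>a i\<bar> - \<bar>b i\<bar>) * f (r i) x\<bar>)" by (intro integrable_abs isum)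
    qed (use l in \<open>auto simp: indicator_def Y_def\<close>)
    also have "\<dots> \<le> (\<Sum>k<n. d k) * B"
    proof (rule norm_sum_coeff_le)
      show "\<bar>\<bar>a k\<bar> - \<bar>b k\<bar>\<bar> \<le> d k" if "k < n" for k using b(2)[OF that] by linarith
    qed (use int bd in auto)
    finally have Y: "measure M Y \<le> (\<Sum>k<n. d k) * B / l" using l by (simp add: field_simps)
    have "Z \<subseteq> X \<union> Y"
    proof
      fix x assume x: "x \<in> Z"
      have "(\<Sum>i<n. \<bar>a i\<bar> * f (r i) x) = (\<Sum>i<n. \<bar>b i\<bar> * f (r i) x) + (\<Sum>i<n. (\<bar>a i\<bar> - \<bar>b i\<bar>) * f (r i) x)"
        by (simp add: left_diff_distrib sum_subtractf)
      then show "x \<in> X \<union> Y" using x unfolding X_def Y_def Z_def by auto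
    qed
    then have "measure M Z \<le> measure M (X \<union> Y)" by (intro finite_measure_mono) auto
    also have "\<dots> \<le> measure M X + measure M Y" by (intro measure_Un_le) auto
    also have "\<dots> \<le> ((\<integral>x. \<bar>\<Sum>i<n. a i * f (r i) x\<bar> \<partial>M) + (\<Sum>k<n. d k) * B + 2 * (\<Sum>k<n. e' k)) / l + (\<Sum>k<n. d k) * B / l"
      using X Y by (rule add_mono)
    also have "\<dots> = ((\<integral>x. \<bar>\<Sum>i<n. a i * f (r i) x\<bar> \<partial>M) + (2 * ((\<Sum>k<n. d k) * B) + 2 * (\<Sum>k<n. e' k))) / l"
      by (simp add: add_divide_distrib[symmetric])
    also have "\<dots> \<le> ((\<integral>x. \<bar>\<Sum>i<n. a i * f (r i) x\<bar> \<partial>M) + e) / l"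
    proof -
      have "(\<Sum>k<n. d k) * B \<le> 2 * q * B" using dsum B by (intro mult_right_mono) auto
      then have "2 * ((\<Sum>k<n. d k) * B) + 2 * (\<Sum>k<n. e' k) \<le> e" using qB e'sum[of n] by linarith
      then show ?thesis using l by (intro divide_right_mono) auto
    qed
    finally show ?thesis unfolding Z_def .
  qed
  then show ?thesis using r(1) by (intro exI[of _ r]) simp
qed

section \<open>Operators into \<open>L\<^sub>1\<close> of a finite measure\<close>

text \<open>\<open>singular\<close> is all that lattice strict singularity contributes; \<open>W\<close> collects the vectors whose
  images are carried by the support of the finite measure.\<close>

locale l1_operator = finite_measure M for M :: "'b measure" +
  fixes t :: "'a::banach_lattice \<Rightarrow> 'b \<Rightarrow> real" and W :: "'a set" and K :: real
  assumes lin: "linear (\<lambda>x. t x b)"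
    and int: "integrable M (t x)"
    and bound: "(\<integral>b. \<bar>t x b\<bar> \<partial>M) \<le> K * norm x"
    and K_pos: "K > 0"
    and W: "subspace W"
    and singular: "\<lbrakk>\<And>n. u n \<in> W; \<And>n. 0 \<le> u n; \<And>n. u n \<noteq> 0; disjoint_vectors u; (c::real) > 0\<rbrakk>
      \<Longrightarrow> \<exists>v\<in>span (range u). (\<integral>b. \<bar>t v b\<bar> \<partial>M) < c * norm v"
begin

lemma t_sum: "t (\<Sum>i\<in>I. a i *\<^sub>R x i) b = (\<Sum>i\<in>I. a i * t (x i) b)"
  by (simp add: linear_sum[OF lin] linear_cmul[OF lin])

lemma t_add: "t (x + y) b = t x b + t y b"
  using linear_add[OF lin] by simp

lemma t_diff: "t (x - y) b = t x b - t y b"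
  using linear_diff[OF lin] by simp

lemma t_scale: "t (c *\<^sub>R x) b = c * t x b"
  using linear_cmul[OF lin] by simp

lemma t_0: "t 0 b = 0"
  using linear_0[OF lin] by simp

abbreviation L1t :: "'a \<Rightarrow> real" where "L1t x \<equiv> (\<integral>b. \<bar>t x b\<bar> \<partial>M)"

lemma L1t_nonneg: "0 \<le> L1t x"
  by (rule integral_nonneg_AE) simp

lemma L1t_le_K: "norm x \<le> 1 \<Longrightarrow> L1t x \<le> K"
  by (rule order_trans[OF bound]) (use mult_left_mono[of "norm x" 1 K] K_pos in simp)

lemma L1t_scale: "L1t (c *\<^sub>R x) = \<bar>c\<bar> * L1t x"
  by (simp add: t_scale abs_mult)

lemma L1t_triangle: "L1t (x + y) \<le> L1t x + L1t y"
proof -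
  have "L1t (x + y) \<le> (\<integral>b. \<bar>t x b\<bar> + \<bar>t y b\<bar> \<partial>M)"
    using int by (intro integral_mono) (auto simp: t_add)
  then show ?thesis using int by simp
qed

lemma L1t_sum: "L1t (\<Sum>i\<in>I. x i) \<le> (\<Sum>i\<in>I. L1t (x i))"
proof (induction I rule: infinite_finite_induct)
  case (insert i I)
  then show ?case using L1t_triangle[of "x i" "\<Sum>i\<in>I. x i"] by simp
qed (simp_all add: t_0)

text \<open>Otherwise the images of a subsequence satisfy an l_1 lower estimate. Vectors of norm at
  most 1 satisfy the l_1 upper estimate trivially, so \<open>t\<close> would be bounded below on
  their span, against \<open>singular\<close>.\<close>

lemma equi_integrable_disjoint_positive:
  fixes u :: "nat \<Rightarrow> 'a"
  assumes u: "\<And>n. u n \<in> W" "\<And>n. 0 \<le> u n" "disjoint_vectors u" "\<And>n. norm (u n) \<le> 1"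
  shows "equi_integrable M (range (\<lambda>n. t (u n)))"
proof (rule ccontr)
  assume not: "\<not> ?thesis"
  have bd: "L1t (u n) \<le> K" for n using u(4) by (rule L1t_le_K)
  obtain r c where r: "strict_mono (r :: nat \<Rightarrow> nat)" and c: "c > 0"
    "\<forall>I a. finite I \<longrightarrow> c * (\<Sum>i\<in>I. \<bar>a i\<bar>) \<le> (\<integral>b. \<bar>\<Sum>i\<in>I. a i * t (u (r i)) b\<bar> \<partial>M)"
    using l1_subsequence[OF int bd not] by blast
  have nz: "u (r n) \<noteq> 0" for n
    using c(2)[rule_format, of "{n}" "\<lambda>_. 1"] c(1) by (auto simp: t_0)
  have dv: "disjoint_vectors (\<lambda>n. u (r n))"
    using u(3) strict_mono_imp_inj_on[OF r] by (rule disjoint_vectors_comp)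
  have "\<exists>v\<in>span (range (\<lambda>n. u (r n))). L1t v < c * norm v"
    by (rule singular) (rule u nz dv c)+
  then obtain v where v: "v \<in> span (range (\<lambda>n. u (r n)))" "L1t v < c * norm v" by blast
  obtain I a where I: "finite I" "v = (\<Sum>i\<in>I. a i *\<^sub>R u (r i))"
    using span_range_finite_sum[OF v(1) disjoint_nonzero_inj[OF dv nz]] by blast
  have "norm v \<le> (\<Sum>i\<in>I. norm (a i *\<^sub>R u (r i)))" unfolding I(2) by (rule norm_sum)
  also have "\<dots> \<le> (\<Sum>i\<in>I. \<bar>a i\<bar>)" using u(4) by (intro sum_mono) (simp add: mult_left_le)
  finally have "c * norm v \<le> c * (\<Sum>i\<in>I. \<bar>a i\<bar>)" using c(1) by simp
  also have "\<dots> \<le> L1t v" using c(2)[rule_format, OF I(1), of a] by (simp add: I(2) t_sum)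
  finally show False using v(2) by simp
qed

text \<open>\<open>p n\<close> and \<open>q n\<close> stand for the two parts of a normalised
  disjoint sequence \<open>p n - q n\<close>, and \<open>p n + q n\<close> for its modulus. The
  notion is symmetric, which allows the parts to be exchanged.\<close>

definition splitting :: "(nat \<Rightarrow> 'a) \<Rightarrow> (nat \<Rightarrow> 'a) \<Rightarrow> bool" where
  "splitting p q \<longleftrightarrow> (\<forall>n. p n \<in> W \<and> q n \<in> W \<and> 0 \<le> p n \<and> 0 \<le> q n \<and> norm (p n + q n) = 1) \<and>
    disjoint_vectors (\<lambda>n. p n + q n)"

text \<open>The norm is taken of the moduli \<open>p i + q i\<close>: for a disjoint sequence,
  combinations of the vectors and of their moduli have the same norm, and positive sums can be
  compared termwise.\<close>

definition lower_bound :: "(nat \<Rightarrow> 'a) \<Rightarrow> (nat \<Rightarrow> 'a) \<Rightarrow> real \<Rightarrow> bool" where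
  "lower_bound p q c \<longleftrightarrow> (\<forall>I a. finite I \<longrightarrow>
    c * norm (\<Sum>i\<in>I. a i *\<^sub>R (p i + q i)) \<le> L1t (\<Sum>i\<in>I. a i *\<^sub>R (p i - q i)))"

lemma splittingD:
  assumes "splitting p q"
  shows "p n \<in> W" "q n \<in> W" "0 \<le> p n" "0 \<le> q n" "norm (p n + q n) = 1"
    "disjoint_vectors (\<lambda>n. p n + q n)" "disjoint_vectors p" "disjoint_vectors q"
    "\<bar>p n\<bar> \<le> \<bar>p n + q n\<bar>" "\<bar>q n\<bar> \<le> \<bar>p n + q n\<bar>" "norm (p n) \<le> 1" "norm (q n) \<le> 1"
proof -
  show *: "p n \<in> W" "q n \<in> W" "0 \<le> p n" "0 \<le> q n" "norm (p n + q n) = 1"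
    "disjoint_vectors (\<lambda>n. p n + q n)" for n
    using assms unfolding splitting_def by auto
  have le: "\<bar>p n\<bar> \<le> \<bar>p n + q n\<bar>" "\<bar>q n\<bar> \<le> \<bar>p n + q n\<bar>" for n
    using *(3,4)[of n] by (simp_all add: abs_of_nonneg)
  then show "\<bar>p n\<bar> \<le> \<bar>p n + q n\<bar>" "\<bar>q n\<bar> \<le> \<bar>p n + q n\<bar>" by auto
  show "disjoint_vectors p" "disjoint_vectors q"
    using le by (auto intro: disjoint_vectors_mono[OF *(6)])
  show "norm (p n) \<le> 1" "norm (q n) \<le> 1"
    using norm_mono_abs[OF le(1)[of n]] norm_mono_abs[OF le(2)[of n]] *(5) by auto
qed

lemma splitting_comp:
  assumes "splitting p q" "inj r"
  shows "splitting (\<lambda>n. p (r n)) (\<lambda>n. q (r n))"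
  using splittingD[OF assms(1)] disjoint_vectors_comp[OF _ assms(2), of "\<lambda>n. p n + q n"]
  unfolding splitting_def by auto

lemma sum_reindex_inv:
  fixes x :: "nat \<Rightarrow> 'a"
  assumes "inj r"
  shows "(\<Sum>j\<in>r ` I. a (inv r j) *\<^sub>R x j) = (\<Sum>i\<in>I. a i *\<^sub>R x (r i))"
  using assms by (subst sum.reindex) (auto intro: inj_on_subset)

lemma lower_bound_comp:
  assumes "lower_bound p q c" "inj r"
  shows "lower_bound (\<lambda>n. p (r n)) (\<lambda>n. q (r n)) c"
  unfolding lower_bound_def
proof (intro allI impI)
  fix I :: "nat set" and a assume "finite I"
  then have "c * norm (\<Sum>j\<in>r ` I. a (inv r j) *\<^sub>R (p j + q j)) \<le> L1t (\<Sum>j\<in>r ` I. a (inv r j) *\<^sub>R (p j - q j))"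
    using assms(1)[unfolded lower_bound_def, rule_format, of "r ` I" "\<lambda>j. a (inv r j)"] by simp
  then show "c * norm (\<Sum>i\<in>I. a i *\<^sub>R (p (r i) + q (r i))) \<le> L1t (\<Sum>i\<in>I. a i *\<^sub>R (p (r i) - q (r i)))"
    using sum_reindex_inv[OF assms(2), where x = "\<lambda>j. p j + q j" and a = a and I = I]
      sum_reindex_inv[OF assms(2), where x = "\<lambda>j. p j - q j" and a = a and I = I] by simp
qed

text \<open>The terms with index below \<open>N\<close> have coefficients at most 1, so they are
  dominated by the single integrable function \<open>F\<close>, which has little mass on small sets.
  Dropping them costs at most half of \<open>d\<close>.\<close>

lemma disjoint_tail_large_mass:
  assumes pq: "splitting p q" and d: "d > 0"
    and large: "\<And>s. s > 0 \<Longrightarrow> \<exists>I a A. finite I \<and> (\<forall>i. 0 \<le> a i) \<and> norm (\<Sum>i\<in>I. a i *\<^sub>R (p i + q i)) \<le> 1 \<and>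
      A \<in> sets M \<and> measure M A < s \<and> d \<le> mass M A (t (\<Sum>i\<in>I. a i *\<^sub>R p i))"
    and s: "s > 0"
  shows "\<exists>I a A. finite I \<and> I \<subseteq> {N..} \<and> (\<forall>i. 0 \<le> a i) \<and> norm (\<Sum>i\<in>I. a i *\<^sub>R (p i + q i)) \<le> 1 \<and>
      A \<in> sets M \<and> measure M A < s \<and> d / 2 \<le> mass M A (t (\<Sum>i\<in>I. a i *\<^sub>R p i))"
proof -
  note D = splittingD[OF pq]
  define F where "F b = (\<Sum>i<N. \<bar>t (p i) b\<bar>)" for b
  have iF: "integrable M F" unfolding F_def using int by (intro Bochner_Integration.integrable_sum integrable_abs)
  have "d / 2 > 0" using d by simp
  from mass_absolutely_continuous_finite[OF iF this] obtain s' where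
    s': "s' > 0" "\<forall>A\<in>sets M. measure M A < s' \<longrightarrow> mass M A F < d / 2" by blast
  have "min s s' > 0" using s s' by simp
  from large[OF this] obtain I a A where I: "finite I" "\<And>i. 0 \<le> a i" "norm (\<Sum>i\<in>I. a i *\<^sub>R (p i + q i)) \<le> 1"
    "A \<in> sets M" "measure M A < min s s'" "d \<le> mass M A (t (\<Sum>i\<in>I. a i *\<^sub>R p i))" by blast
  define J J' where "J = I \<inter> {N..}" and "J' = I \<inter> {..<N}"
  have "I = J' \<union> J" "J' \<inter> J = {}" by (auto simp: J_def J'_def)
  then have split: "(\<Sum>i\<in>I. a i *\<^sub>R p i) = (\<Sum>i\<in>J'. a i *\<^sub>R p i) + (\<Sum>i\<in>J. a i *\<^sub>R p i)"
    using I(1) by (simp add: sum.union_disjoint)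
  have a1: "a i \<le> 1" if "i \<in> I" for i
    using norm_coeff_le_norm_sum[OF D(6) I(1) that, of a] I(2)[of i] I(3) D(5)[of i] by simp
  have "mass M A (t (\<Sum>i\<in>I. a i *\<^sub>R p i)) \<le> mass M A (t (\<Sum>i\<in>J'. a i *\<^sub>R p i)) + mass M A (t (\<Sum>i\<in>J. a i *\<^sub>R p i))"
    using mass_add[OF int int I(4)] unfolding split t_add[abs_def] by blast
  also have "mass M A (t (\<Sum>i\<in>J'. a i *\<^sub>R p i)) \<le> mass M A F"
  proof (rule mass_mono)
    fix b
    have "\<bar>t (\<Sum>i\<in>J'. a i *\<^sub>R p i) b\<bar> \<le> (\<Sum>i\<in>J'. \<bar>a i * t (p i) b\<bar>)" unfolding t_sum by (rule sum_abs)
    also have "\<dots> \<le> (\<Sum>i\<in>J'. \<bar>t (p i) b\<bar>)"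
      using a1 I(2) by (intro sum_mono) (auto simp: abs_mult J'_def intro!: mult_left_le_one_le)
    also have "\<dots> \<le> F b" unfolding F_def by (intro sum_mono2) (auto simp: J'_def)
    also have "\<dots> \<le> \<bar>F b\<bar>" by simp
    finally show "\<bar>t (\<Sum>i\<in>J'. a i *\<^sub>R p i) b\<bar> \<le> \<bar>F b\<bar>" .
  qed (use int iF I in auto)
  also have "mass M A F < d / 2" using s'(2) I(4,5) by simp
  finally have "d / 2 \<le> mass M A (t (\<Sum>i\<in>J. a i *\<^sub>R p i))" using I(6) by simp
  moreover have "norm (\<Sum>i\<in>J. a i *\<^sub>R (p i + q i)) \<le> 1"
    using norm_sum_disjoint_mono_subset[OF D(6) I(1), of J a] I(3) by (auto simp: J_def)
  ultimately show ?thesis using I by (intro exI[of _ J] exI[of _ a] exI[of _ A]) (auto simp: J_def)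
qed

text \<open>A gliding hump: if the masses were not uniformly small, successive blocks of indices
  would give a bounded disjoint positive sequence in \<open>W\<close> whose images keep mass
  \<open>d / 2\<close> on sets of measure tending to 0.\<close>

lemma equi_integrable_positive_combinations:
  assumes pq: "splitting p q" and d: "d > 0"
  shows "\<exists>s>0. \<forall>I a A. finite I \<longrightarrow> (\<forall>i. 0 \<le> a i) \<longrightarrow> norm (\<Sum>i\<in>I. a i *\<^sub>R (p i + q i)) \<le> 1 \<longrightarrow>
      A \<in> sets M \<longrightarrow> measure M A < s \<longrightarrow> mass M A (t (\<Sum>i\<in>I. a i *\<^sub>R p i)) < d"
proof (rule ccontr)
  assume neg: "\<not> ?thesis"
  note D = splittingD[OF pq]
  have large: "\<exists>I a A. finite I \<and> (\<forall>i. 0 \<le> a i) \<and> norm (\<Sum>i\<in>I. a i *\<^sub>R (p i + q i)) \<le> 1 \<and>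
      A \<in> sets M \<and> measure M A < s \<and> d \<le> mass M A (t (\<Sum>i\<in>I. a i *\<^sub>R p i))" if "s > 0" for s
  proof -
    have "\<not> (\<forall>I a A. finite I \<longrightarrow> (\<forall>i. 0 \<le> a i) \<longrightarrow> norm (\<Sum>i\<in>I. a i *\<^sub>R (p i + q i)) \<le> 1 \<longrightarrow>
      A \<in> sets M \<longrightarrow> measure M A < s \<longrightarrow> mass M A (t (\<Sum>i\<in>I. a i *\<^sub>R p i)) < d)"
      using neg that by blast
    then show ?thesis by (simp only: not_all not_imp not_less)
  qed
  note tail = disjoint_tail_large_mass[OF pq d large]
  \<comment> \<open>\<open>N\<close> bounds the indices used so far; by \<open>Q\<close> the next
    block starts at \<open>N\<close> or later.\<close>
  define P where "P n = (\<lambda>(N, I, a, A). finite I \<and> I \<subseteq> {..<N} \<and> (\<forall>i. 0 \<le> a i) \<and>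
    norm (\<Sum>i\<in>I. a i *\<^sub>R (p i + q i)) \<le> 1 \<and> A \<in> sets M \<and> measure M A < 1 / real (Suc n) \<and>
    d / 2 \<le> mass M A (t (\<Sum>i\<in>I. a i *\<^sub>R p i)))" for n
  define Q where "Q = (\<lambda>(N :: nat, I :: nat set, a :: nat \<Rightarrow> real, A :: 'b set) (N', I', a' :: nat \<Rightarrow> real, A' :: 'b set).
    I' \<subseteq> {N..} \<and> N \<le> (N' :: nat))"
  have step: "\<exists>x. P n x \<and> (\<exists>N' I' a' A'. x = (N', I', a', A') \<and> I' \<subseteq> {N..} \<and> N \<le> N')" for n N :: nat
  proof -
    obtain I a A where I: "finite I" "I \<subseteq> {N..}" "\<forall>i. 0 \<le> a i" "norm (\<Sum>i\<in>I. a i *\<^sub>R (p i + q i)) \<le> 1"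
      "A \<in> sets M" "measure M A < 1 / real (Suc n)" "d / 2 \<le> mass M A (t (\<Sum>i\<in>I. a i *\<^sub>R p i))"
      using tail[of "1 / real (Suc n)" N] by auto
    obtain N' where "I \<subseteq> {..<N'}" using finite_nat_iff_bounded I(1) by blast
    then have "P n (max N N', I, a, A)" using I unfolding P_def by (auto simp: subset_iff)
    then show ?thesis using I(2) by (intro exI[of _ "(max N N', I, a, A)"]) auto
  qed
  have "\<exists>f. \<forall>n::nat. P n (f n) \<and> Q (f n) (f (Suc n))"
  proof (rule dependent_nat_choice)
    show "\<exists>x. P 0 x" using step[of 0 0] by blast
    fix x :: "nat \<times> nat set \<times> (nat \<Rightarrow> real) \<times> 'b set" and n
    obtain N I a A where x: "x = (N, I, a, A)" by (cases x)
    from step[of "Suc n" N] show "\<exists>y. P (Suc n) y \<and> Q x y" unfolding x Q_def by auto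
  qed
  then obtain f where f: "\<And>n::nat. P n (f n)" "\<And>n. Q (f n) (f (Suc n))" by blast
  define N I a A where "N n = fst (f n)" and "I n = fst (snd (f n))" and "a n = fst (snd (snd (f n)))"
    and "A n = snd (snd (snd (f n)))" for n
  have feq: "f n = (N n, I n, a n, A n)" for n by (simp add: N_def I_def a_def A_def)
  have P: "finite (I n)" "I n \<subseteq> {..<N n}" "\<And>i. 0 \<le> a n i" "norm (\<Sum>i\<in>I n. a n i *\<^sub>R (p i + q i)) \<le> 1"
    "A n \<in> sets M" "measure M (A n) < 1 / real (Suc n)" "d / 2 \<le> mass M (A n) (t (\<Sum>i\<in>I n. a n i *\<^sub>R p i))" for n
    using f(1)[of n] unfolding feq P_def by auto
  have Q: "I (Suc n) \<subseteq> {N n..}" "N n \<le> N (Suc n)" for n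
    using f(2)[of n] unfolding feq Q_def by auto
  have disj: "I k \<inter> I l = {}" if "k < l" for k l
  proof -
    define l' where "l' = l - 1"
    have l': "l = Suc l'" "k \<le> l'" using that by (auto simp: l'_def)
    have "N k \<le> N l'" using Q(2) l'(2) by (rule lift_Suc_mono_le)
    then show ?thesis using P(2)[of k] Q(1)[of l'] l'(1) by force
  qed
  define u where "u n = (\<Sum>i\<in>I n. a n i *\<^sub>R p i)" for n
  have "equi_integrable M (range (\<lambda>n. t (u n)))"
  proof (rule equi_integrable_disjoint_positive)
    show "u n \<in> W" for n unfolding u_def using D(1) W by (intro subspace_sum subspace_scale)
    show "0 \<le> u n" for n unfolding u_def using D(3) P(3) by (intro sum_nonneg scaleR_nonneg_nonneg)
    show "disjoint_vectors u" unfolding u_def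
    proof (rule disjoint_vectors_blocks[OF D(7)])
      show "I k \<inter> I l = {}" if "k \<noteq> l" for k l
        using disj[of k l] disj[of l k] that by (cases "k < l") auto
    qed
    show "norm (u n) \<le> 1" for n
      unfolding u_def using norm_sum_disjoint_mono[OF D(6) P(1), of n p "a n" "a n"] D(9) P(4)[of n] by simp
  qed
  moreover have "d / 2 > 0" using d by simp
  ultimately obtain s where s: "s > 0"
    "\<forall>f\<in>range (\<lambda>n. t (u n)). \<forall>A\<in>sets M. measure M A < s \<longrightarrow> mass M A f < d / 2"
    unfolding equi_integrable_def by blast
  obtain n where "1 / real (Suc n) < s" using s(1) nat_approx_posE by blast
  then have "measure M (A n) < s" using P(6)[of n] by simp
  then have "mass M (A n) (t (u n)) < d / 2" using s(2) P(5) by blast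
  then show False using P(7)[of n] by (simp add: u_def)
qed

text \<open>If the integrals stayed above \<open>d\<close> on \<open>n\<close> indices, the
  combination of the \<open>p k\<close> with matching signs would have norm at least
  \<open>d * n / K\<close>. By unconditionality so would the combination of the
  \<open>p k + q k\<close> with any signs, and the lower bound would give images of norm at least
  \<open>c * d * n / K\<close> for every choice of signs. \<open>equi_integrable_signs\<close>
  provides signs with only half this growth rate.\<close>

lemma weakly_null_part:
  assumes pq: "splitting p q" and c: "c > 0" and lower: "lower_bound p q c"
    and g: "g \<in> borel_measurable M" "\<And>b. \<bar>g b\<bar> \<le> 1"
  shows "(\<lambda>n. \<integral>b. g b * t (p n) b \<partial>M) \<longlonglongrightarrow> 0"
proof -
  note D = splittingD[OF pq]
  define h where "h n = t (p n - q n)" for n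
  define G where "G n = (\<integral>b. g b * t (p n) b \<partial>M)" for n
  have equi: "equi_integrable M (range h)"
  proof -
    have "h = (\<lambda>n b. t (p n) b - t (q n) b)" by (simp add: h_def t_diff fun_eq_iff)
    then show ?thesis
      using equi_integrable_diff[OF int int equi_integrable_disjoint_positive[OF D(1,3,7,11)]
        equi_integrable_disjoint_positive[OF D(2,4,8,12)]] by simp
  qed
  have hint: "integrable M (h n)" for n unfolding h_def by (rule int)
  have hbd: "(\<integral>b. \<bar>h n b\<bar> \<partial>M) \<le> K * 2" for n
  proof -
    have "norm (p n - q n) \<le> 2" using norm_triangle_ineq4[of "p n" "q n"] D(11,12)[of n] by simp
    then show ?thesis unfolding h_def using bound[of "p n - q n"] mult_left_mono[of "norm (p n - q n)" 2 K] K_pos by linarith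
  qed
  have gint: "integrable M (\<lambda>b. g b * t x b)" for x by (rule integrable_bounded_mult[OF int g])
  have fin: "finite {n. d \<le> \<bar>G n\<bar>}" if d: "d > 0" for d
  proof (rule ccontr)
    assume inf: "infinite {n. d \<le> \<bar>G n\<bar>}"
    define e where "e = c * d / (2 * K)"
    have e: "e > 0" using c d K_pos by (simp add: e_def)
    obtain C where C: "\<And>F. finite F \<Longrightarrow> \<exists>s. (\<forall>k. \<bar>s k\<bar> = 1) \<and>
        (\<integral>b. \<bar>\<Sum>k\<in>F. s k * h k b\<bar> \<partial>M) \<le> e * real (card F) + C"
      using equi_integrable_signs[OF hint hbd equi e] by blast
    obtain n :: nat where n: "real n > C / e" using reals_Archimedean2 by blast
    obtain F where F: "F \<subseteq> {n. d \<le> \<bar>G n\<bar>}" "finite F" "card F = n"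
      using infinite_arbitrarily_large[OF inf] by blast
    obtain s where s: "\<And>k. \<bar>s k\<bar> = 1" "(\<integral>b. \<bar>\<Sum>k\<in>F. s k * h k b\<bar> \<partial>M) \<le> e * real n + C"
      using C[OF F(2)] F(3) by blast
    have "d * real n = (\<Sum>k\<in>F. d)" using F by simp
    also have "\<dots> \<le> (\<Sum>k\<in>F. sgn (G k) * G k)"
      using F(1) by (intro sum_mono) (auto simp: sgn_mult_abs[symmetric] abs_sgn mult.commute)
    also have "\<dots> = (\<integral>b. g b * t (\<Sum>k\<in>F. sgn (G k) *\<^sub>R p k) b \<partial>M)"
    proof -
      have "(\<integral>b. g b * t (\<Sum>k\<in>F. sgn (G k) *\<^sub>R p k) b \<partial>M)
          = (\<integral>b. (\<Sum>k\<in>F. sgn (G k) * (g b * t (p k) b)) \<partial>M)"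
        by (simp add: t_sum sum_distrib_left mult_ac)
      also have "\<dots> = (\<Sum>k\<in>F. sgn (G k) * G k)"
        using gint by (subst Bochner_Integration.integral_sum) (auto simp: G_def)
      finally show ?thesis ..
    qed
    also have "\<dots> \<le> L1t (\<Sum>k\<in>F. sgn (G k) *\<^sub>R p k)"
    proof (rule integral_mono[OF gint])
      fix b
      show "g b * t (\<Sum>k\<in>F. sgn (G k) *\<^sub>R p k) b \<le> \<bar>t (\<Sum>k\<in>F. sgn (G k) *\<^sub>R p k) b\<bar>"
        using mult_right_mono[OF g(2)[of b], of "\<bar>t (\<Sum>k\<in>F. sgn (G k) *\<^sub>R p k) b\<bar>"]
        by (simp flip: abs_mult)
    qed (use int in auto)
    also have "\<dots> \<le> K * norm (\<Sum>k\<in>F. sgn (G k) *\<^sub>R p k)" by (rule bound)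
    also have "\<dots> \<le> K * norm (\<Sum>k\<in>F. s k *\<^sub>R (p k + q k))"
    proof (rule mult_left_mono)
      show "norm (\<Sum>k\<in>F. sgn (G k) *\<^sub>R p k) \<le> norm (\<Sum>k\<in>F. s k *\<^sub>R (p k + q k))"
        using D(9) s(1) by (intro norm_sum_disjoint_mono[OF D(6) F(2)]) (auto simp: sgn_if)
    qed (use K_pos in simp)
    also have "\<dots> \<le> K * ((e * real n + C) / c)"
    proof (rule mult_left_mono)
      have "c * norm (\<Sum>k\<in>F. s k *\<^sub>R (p k + q k)) \<le> e * real n + C"
        using lower[unfolded lower_bound_def, rule_format, OF F(2), of s] s(2) by (simp add: t_sum h_def)
      then show "norm (\<Sum>k\<in>F. s k *\<^sub>R (p k + q k)) \<le> (e * real n + C) / c" using c by (simp add: field_simps)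
    qed (use K_pos in simp)
    finally have "d * real n \<le> K * ((e * real n + C) / c)" .
    then have "c * d * real n \<le> K * (e * real n + C)" using c by (simp add: field_simps)
    moreover have "K * e = c * d / 2" using K_pos by (simp add: e_def)
    ultimately have "2 * (K * e) * real n \<le> K * e * real n + K * C" by (simp add: algebra_simps)
    then have "K * (e * real n) \<le> K * C" by (simp add: algebra_simps)
    then have "e * real n \<le> C" using K_pos by simp
    then show False using n e by (simp add: field_simps)
  qed
  have "G \<longlonglongrightarrow> 0"
  proof (rule LIMSEQ_I)
    fix d :: real assume "d > 0"
    from fin[OF this] obtain N where N: "{n. d \<le> \<bar>G n\<bar>} \<subseteq> {..<N}" using finite_nat_iff_bounded by blast
    have "norm (G n - 0) < d" if "N \<le> n" for n
    proof (rule ccontr)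
      assume "\<not> ?thesis"
      then have "n \<in> {n. d \<le> \<bar>G n\<bar>}" by simp
      then show False using N that by auto
    qed
    then show "\<exists>N. \<forall>n\<ge>N. norm (G n - 0) < d" by blast
  qed
  then show ?thesis unfolding G_def .
qed

text \<open>Signed combinations of the \<open>p i\<close> with small image exist by singularity; after thinning, taking absolute
  values of the coefficients keeps the image small in measure, hence in \<open>L\<^sub>1\<close> by equi-integrability.\<close>

lemma small_positive_combination:
  assumes pq: "splitting p q" and c: "c > 0" and lower: "lower_bound p q c" and eps: "\<epsilon> > 0"
  shows "\<exists>I a. finite I \<and> (\<forall>i. 0 \<le> a i) \<and> norm (\<Sum>i\<in>I. a i *\<^sub>R (p i + q i)) = 1 \<and> L1t (\<Sum>i\<in>I. a i *\<^sub>R p i) \<le> \<epsilon>"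
proof (rule ccontr)
  assume "\<not> ?thesis"
  then have large: "\<epsilon> < L1t (\<Sum>i\<in>I. a i *\<^sub>R p i)"
    if "finite I" "\<And>i. 0 \<le> a i" "norm (\<Sum>i\<in>I. a i *\<^sub>R (p i + q i)) = 1" for I a
    using that by (meson not_le)
  note D = splittingD[OF pq]
  \<comment> \<open>A vanishing \<open>p n\<close> would itself be a combination of the desired
    kind.\<close>
  have nz: "p n \<noteq> 0" for n
    using large[of "{n}" "\<lambda>_. 1"] D(5)[of n] eps by (auto simp: t_0)
  define m where "m = measure M (space M)"
  have m: "m \<ge> 0" by (simp add: m_def)
  \<comment> \<open>Where the image is below \<open>3 * l\<close> it contributes at most
    \<open>3 * l * m\<close>, a quarter of \<epsilon>; the mass on the exceptional set takes another
    quarter.\<close>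
  define l where "l = \<epsilon> / (12 * (m + 1))"
  have l: "l > 0" using eps m by (simp add: l_def)
  have lm: "3 * l * m \<le> \<epsilon> / 4"
  proof -
    have "3 * l * m \<le> 3 * l * (m + 1)" using l by (intro mult_left_mono) auto
    also have "\<dots> = \<epsilon> / 4" using m by (simp add: l_def field_simps)
    finally show ?thesis .
  qed
  have "\<epsilon> / 4 > 0" using eps by simp
  from equi_integrable_positive_combinations[OF pq this] obtain s where s: "s > 0"
    "\<And>I a A. finite I \<Longrightarrow> (\<And>i. 0 \<le> a i) \<Longrightarrow> norm (\<Sum>i\<in>I. a i *\<^sub>R (p i + q i)) \<le> 1 \<Longrightarrow>
      A \<in> sets M \<Longrightarrow> measure M A < s \<Longrightarrow> mass M A (t (\<Sum>i\<in>I. a i *\<^sub>R p i)) < \<epsilon> / 4" by blast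
  \<comment> \<open>Chosen so that the measure bound \<open>(e + e) / l\<close> of the thinning is
    \<open>s / 2\<close>, below the threshold of equi-integrability.\<close>
  define e where "e = s * l / 4"
  have e: "e > 0" using s l by (simp add: e_def)
  have bd: "L1t (p n) \<le> K" for n using D(11) by (rule L1t_le_K)
  have "\<exists>r. strict_mono (r :: nat \<Rightarrow> nat) \<and>
    (\<forall>n a. (\<forall>i<n. \<bar>a i\<bar> \<le> 1) \<longrightarrow> measure M {x\<in>space M. 3 * l \<le> \<bar>\<Sum>i<n. \<bar>a i\<bar> * t (p (r i)) x\<bar>}
      \<le> ((\<integral>x. \<bar>\<Sum>i<n. a i * t (p (r i)) x\<bar> \<partial>M) + e) / l)"
    by (rule weakly_null_thinning[OF int bd weakly_null_part[OF pq c lower] l e])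
  then obtain r where r: "strict_mono (r :: nat \<Rightarrow> nat)" and thin:
    "\<forall>n a. (\<forall>i<n. \<bar>a i\<bar> \<le> 1) \<longrightarrow> measure M {x\<in>space M. 3 * l \<le> \<bar>\<Sum>i<n. \<bar>a i\<bar> * t (p (r i)) x\<bar>}
      \<le> ((\<integral>x. \<bar>\<Sum>i<n. a i * t (p (r i)) x\<bar> \<partial>M) + e) / l" by blast
  have inj: "inj r" using r by (rule strict_mono_imp_inj_on)
  note Dr = splittingD[OF splitting_comp[OF pq inj]]
  have "\<exists>v\<in>span (range (\<lambda>n. p (r n))). L1t v < e * norm v"
    by (rule singular) (rule Dr nz e)+
  then obtain v where v: "v \<in> span (range (\<lambda>n. p (r n)))" "L1t v < e * norm v" by blast
  obtain I a where I: "finite I" "v = (\<Sum>i\<in>I. a i *\<^sub>R p (r i))"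
    using span_range_finite_sum[OF v(1) disjoint_nonzero_inj[OF Dr(7) nz]] by blast
  obtain n where n: "I \<subseteq> {..<n}" using finite_nat_iff_bounded I(1) by blast
  \<comment> \<open>The coefficients are normalised with respect to \<open>p + q\<close>. As
    \<open>norm v \<le> E\<close>, an image that is small relative to \<open>norm v\<close> stays
    small after division by \<open>E\<close>.\<close>
  define E where "E = norm (\<Sum>i\<in>I. a i *\<^sub>R (p (r i) + q (r i)))"
  have vE: "norm v \<le> E" unfolding I(2) E_def
    using Dr(9) by (intro norm_sum_disjoint_mono[OF Dr(6) I(1)]) auto
  have E: "E > 0"
  proof -
    have "0 < e * norm v" using L1t_nonneg[of v] v(2) by linarith
    then have "0 < norm v" using e by (simp only: zero_less_mult_iff) auto
    then show ?thesis using vE by (rule less_le_trans)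
  qed
  define b where "b i = (if i \<in> I then a i / E else 0)" for i
  have bsum: "(\<Sum>i<n. b i *\<^sub>R x i) = (1 / E) *\<^sub>R (\<Sum>i\<in>I. a i *\<^sub>R x i)" for x :: "nat \<Rightarrow> 'a"
  proof -
    have "(\<Sum>i<n. b i *\<^sub>R x i) = (\<Sum>i\<in>I. b i *\<^sub>R x i)"
      using n by (intro sum.mono_neutral_right) (auto simp: b_def)
    also have "\<dots> = (\<Sum>i\<in>I. (1 / E) *\<^sub>R (a i *\<^sub>R x i))" by (intro sum.cong) (auto simp: b_def)
    finally show ?thesis by (simp add: scaleR_sum_right)
  qed
  have b1: "norm (\<Sum>i<n. b i *\<^sub>R (p (r i) + q (r i))) = 1"
    unfolding bsum using E by (simp add: E_def[symmetric])
  have bb: "\<bar>b i\<bar> \<le> 1" if "i < n" for i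
    using norm_coeff_le_norm_sum[OF Dr(6), of "{..<n}" i b] that b1 Dr(5)[of i] by simp
  have "(\<integral>x. \<bar>\<Sum>i<n. b i * t (p (r i)) x\<bar> \<partial>M) = L1t ((1 / E) *\<^sub>R v)"
    unfolding I(2) bsum[symmetric] t_sum ..
  also have "\<dots> = L1t v / E" unfolding L1t_scale using E by simp
  also have "\<dots> < e"
  proof -
    have "L1t v < e * E" using v(2) mult_left_mono[OF vE, of e] e by linarith
    then show ?thesis using E by (simp add: field_simps)
  qed
  finally have Fsmall: "(\<integral>x. \<bar>\<Sum>i<n. b i * t (p (r i)) x\<bar> \<partial>M) < e" .
  define y where "y = (\<Sum>i<n. \<bar>b i\<bar> *\<^sub>R p (r i))"
  define A where "A = {x\<in>space M. 3 * l \<le> \<bar>t y x\<bar>}"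
  have [measurable]: "t y \<in> borel_measurable M" using int by auto
  have A: "A \<in> sets M" unfolding A_def by measurable
  have "measure M A \<le> ((\<integral>x. \<bar>\<Sum>i<n. b i * t (p (r i)) x\<bar> \<partial>M) + e) / l"
    using thin[rule_format, of n b, OF bb] unfolding A_def y_def t_sum by simp
  also have "\<dots> \<le> (e + e) / l" using Fsmall l by (intro divide_right_mono) auto
  also have "\<dots> < s" using s(1) l by (simp add: e_def)
  finally have As: "measure M A < s" .
  have y: "y = (\<Sum>j\<in>r ` {..<n}. \<bar>b (inv r j)\<bar> *\<^sub>R p j)"
    unfolding y_def using sum_reindex_inv[OF inj, where a = "\<lambda>i. \<bar>b i\<bar>" and I = "{..<n}" and x = p] by simp
  have ynorm: "norm (\<Sum>j\<in>r ` {..<n}. \<bar>b (inv r j)\<bar> *\<^sub>R (p j + q j)) = 1"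
  proof -
    have "norm (\<Sum>i<n. \<bar>b i\<bar> *\<^sub>R (p (r i) + q (r i))) = norm (\<Sum>i<n. b i *\<^sub>R (p (r i) + q (r i)))"
      by (intro antisym norm_sum_disjoint_mono[OF Dr(6)]) auto
    then show ?thesis
      using b1 sum_reindex_inv[OF inj, where a = "\<lambda>i. \<bar>b i\<bar>" and I = "{..<n}" and x = "\<lambda>j. p j + q j"] by simp
  qed
  have "mass M A (t y) < \<epsilon> / 4" unfolding y
    using ynorm by (intro s(2) A As) auto
  moreover have "L1t y \<le> mass M A (t y) + 3 * l * m"
  proof -
    have "L1t y \<le> (\<integral>x. indicator A x * \<bar>t y x\<bar> + 3 * l \<partial>M)"
      using int A l by (intro integral_mono Bochner_Integration.integrable_add integrable_indicator_abs)
        (auto simp: A_def indicator_def)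
    also have "\<dots> = mass M A (t y) + 3 * l * m"
      unfolding mass_def m_def using int A
      by (subst Bochner_Integration.integral_add) (auto intro: integrable_indicator_abs)
    finally show ?thesis .
  qed
  moreover have "\<epsilon> < L1t y" unfolding y using ynorm by (intro large) auto
  ultimately show False using lm eps by linarith
qed

text \<open>\<open>p\<close> and \<open>q\<close> change places, so that the next application of
  \<open>small_positive_combination\<close> acts on the \<open>q\<close> part; the resulting minus
  sign is invisible to \<open>L1t\<close>. The coefficients \<open>e\<close> flatten a combination
  of blocks.\<close>

lemma lower_bound_blocks:
  assumes lower: "lower_bound p q c" and I: "\<And>k. finite (I k)"
  shows "lower_bound (\<lambda>k. \<Sum>i\<in>I k. a k i *\<^sub>R q i) (\<lambda>k. \<Sum>i\<in>I k. a k i *\<^sub>R p i) c"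
  unfolding lower_bound_def
proof (intro allI impI)
  fix F :: "nat set" and b assume F: "finite F"
  define J where "J = (\<Union>k\<in>F. I k)"
  define e where "e i = (\<Sum>k\<in>F. if i \<in> I k then b k * a k i else 0)" for i
  have J: "finite J" using F I by (simp add: J_def)
  have flat: "(\<Sum>k\<in>F. b k *\<^sub>R (\<Sum>i\<in>I k. a k i *\<^sub>R x i)) = (\<Sum>i\<in>J. e i *\<^sub>R x i)" for x :: "nat \<Rightarrow> 'a"
  proof -
    have "(\<Sum>i\<in>J. e i *\<^sub>R x i) = (\<Sum>i\<in>J. \<Sum>k\<in>F. (if i \<in> I k then (b k * a k i) *\<^sub>R x i else 0))"
      unfolding e_def scaleR_sum_left by (intro sum.cong) auto
    also have "\<dots> = (\<Sum>k\<in>F. \<Sum>i\<in>J. (if i \<in> I k then (b k * a k i) *\<^sub>R x i else 0))"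
      by (rule sum.swap)
    also have "\<dots> = (\<Sum>k\<in>F. \<Sum>i\<in>I k. (b k * a k i) *\<^sub>R x i)"
    proof (rule sum.cong[OF refl])
      fix k assume "k \<in> F"
      then have "I k \<subseteq> J" by (auto simp: J_def)
      then have "(\<Sum>i\<in>I k. (b k * a k i) *\<^sub>R x i) = (\<Sum>i\<in>J \<inter> I k. (b k * a k i) *\<^sub>R x i)"
        by (simp add: Int_absorb1)
      then show "(\<Sum>i\<in>J. (if i \<in> I k then (b k * a k i) *\<^sub>R x i else 0)) = (\<Sum>i\<in>I k. (b k * a k i) *\<^sub>R x i)"
        using J by (simp add: sum.inter_restrict)
    qed
    finally show ?thesis by (simp add: scaleR_sum_right)
  qed
  have comb: "(\<Sum>i\<in>I k. a k i *\<^sub>R q i) + (\<Sum>i\<in>I k. a k i *\<^sub>R p i) = (\<Sum>i\<in>I k. a k i *\<^sub>R (p i + q i))"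
    "(\<Sum>i\<in>I k. a k i *\<^sub>R q i) - (\<Sum>i\<in>I k. a k i *\<^sub>R p i) = (\<Sum>i\<in>I k. a k i *\<^sub>R (-(p i - q i)))" for k
    by (simp_all add: sum.distrib sum_subtractf scaleR_add_right scaleR_diff_right add.commute sum_negf)
  have "L1t (\<Sum>i\<in>J. e i *\<^sub>R (-(p i - q i))) = L1t (\<Sum>i\<in>J. e i *\<^sub>R (p i - q i))"
  proof -
    have "(\<Sum>i\<in>J. e i *\<^sub>R (-(p i - q i))) = (-1) *\<^sub>R (\<Sum>i\<in>J. e i *\<^sub>R (p i - q i))"
      by (simp only: scaleR_minus_right sum_negf scaleR_minus_left scaleR_one)
    then show ?thesis by (simp only: L1t_scale)
  qed
  then show "c * norm (\<Sum>k\<in>F. b k *\<^sub>R ((\<Sum>i\<in>I k. a k i *\<^sub>R q i) + (\<Sum>i\<in>I k. a k i *\<^sub>R p i)))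
      \<le> L1t (\<Sum>k\<in>F. b k *\<^sub>R ((\<Sum>i\<in>I k. a k i *\<^sub>R q i) - (\<Sum>i\<in>I k. a k i *\<^sub>R p i)))"
    unfolding comb flat using lower J unfolding lower_bound_def by metis
qed

text \<open>The blocks are chosen so that the images of their \<open>p\<close> parts have norms
  summing to at most \<open>c / 4\<close>, which any later coefficients in [0,1] preserve. A
  combination of the blocks makes the \<open>q\<close> part at most \<open>c / 4\<close> too,
  whereas the lower bound demands \<open>c\<close>.\<close>

lemma no_lower_bound:
  assumes pq: "splitting p q" and c: "c > 0" and lower: "lower_bound p q c"
  shows False
proof -
  note D = splittingD[OF pq]
  define P where "P n = (\<lambda>(N, I, a). finite I \<and> I \<subseteq> {..<N} \<and> (\<forall>i. 0 \<le> a i) \<and>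
    norm (\<Sum>i\<in>I. a i *\<^sub>R (p i + q i)) = 1 \<and> L1t (\<Sum>i\<in>I. a i *\<^sub>R p i) \<le> c / 8 * (1/2)^n)" for n :: nat
  define Q where "Q = (\<lambda>(N :: nat, I :: nat set, a :: nat \<Rightarrow> real) (N', I', a' :: nat \<Rightarrow> real). I' \<subseteq> {N..} \<and> N \<le> (N' :: nat))"
  have step: "\<exists>x. P n x \<and> (\<exists>N' I' a'. x = (N', I', a') \<and> I' \<subseteq> {N..} \<and> N \<le> N')" for n N :: nat
  proof -
    \<comment> \<open>Shifting the sequences by \<open>N\<close> forces the new block beyond the
      indices already used.\<close>
    have inj: "inj (\<lambda>i. i + N)" by simp
    have "c / 8 * (1/2)^n > 0" using c by simp
    from small_positive_combination[OF splitting_comp[OF pq inj] c lower_bound_comp[OF lower inj] this]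
    obtain I a where I: "finite I" "\<And>i. 0 \<le> a i" "norm (\<Sum>i\<in>I. a i *\<^sub>R (p (i + N) + q (i + N))) = 1"
      "L1t (\<Sum>i\<in>I. a i *\<^sub>R p (i + N)) \<le> c / 8 * (1/2)^n" by blast
    define J where "J = (\<lambda>i. i + N) ` I"
    define b where "b j = a (inv (\<lambda>i. i + N) j)" for j
    have re: "(\<Sum>i\<in>I. a i *\<^sub>R x (i + N)) = (\<Sum>j\<in>J. b j *\<^sub>R x j)" for x :: "nat \<Rightarrow> 'a"
      unfolding J_def b_def using sum_reindex_inv[OF inj] by metis
    have J: "finite J" using I(1) by (simp add: J_def)
    then obtain N' where "J \<subseteq> {..<N'}" using finite_nat_iff_bounded by blast
    then have "P n (max N N', J, b)" using I J unfolding P_def re[of p] re[of "\<lambda>j. p j + q j"] by (auto simp: subset_iff b_def)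
    moreover have "J \<subseteq> {N..}" by (auto simp: J_def)
    ultimately show ?thesis by (intro exI[of _ "(max N N', J, b)"]) auto
  qed
  have "\<exists>f. \<forall>n::nat. P n (f n) \<and> Q (f n) (f (Suc n))"
  proof (rule dependent_nat_choice)
    show "\<exists>x. P 0 x" using step[of 0 0] by blast
    fix x :: "nat \<times> nat set \<times> (nat \<Rightarrow> real)" and n
    obtain N I a where x: "x = (N, I, a)" by (cases x)
    from step[of "Suc n" N] show "\<exists>y. P (Suc n) y \<and> Q x y" unfolding x Q_def by auto
  qed
  then obtain f where f: "\<And>n::nat. P n (f n)" "\<And>n. Q (f n) (f (Suc n))" by blast
  define N I a where "N n = fst (f n)" and "I n = fst (snd (f n))" and "a n = snd (snd (f n))" for n
  have feq: "f n = (N n, I n, a n)" for n by (simp add: N_def I_def a_def)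
  have P: "finite (I n)" "I n \<subseteq> {..<N n}" "\<And>i. 0 \<le> a n i" "norm (\<Sum>i\<in>I n. a n i *\<^sub>R (p i + q i)) = 1"
    "L1t (\<Sum>i\<in>I n. a n i *\<^sub>R p i) \<le> c / 8 * (1/2)^n" for n
    using f(1)[of n] unfolding feq P_def by auto
  have Q: "I (Suc n) \<subseteq> {N n..}" "N n \<le> N (Suc n)" for n
    using f(2)[of n] unfolding feq Q_def by auto
  have disj: "I k \<inter> I l = {}" if "k < l" for k l
  proof -
    define l' where "l' = l - 1"
    have l': "l = Suc l'" "k \<le> l'" using that by (auto simp: l'_def)
    have "N k \<le> N l'" using Q(2) l'(2) by (rule lift_Suc_mono_le)
    then show ?thesis using P(2)[of k] Q(1)[of l'] l'(1) by force
  qed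
  define p' q' where "p' k = (\<Sum>i\<in>I k. a k i *\<^sub>R p i)" and "q' k = (\<Sum>i\<in>I k. a k i *\<^sub>R q i)" for k
  have sum: "q' k + p' k = (\<Sum>i\<in>I k. a k i *\<^sub>R (p i + q i))" for k
    by (simp add: p'_def q'_def sum.distrib scaleR_add_right add.commute)
  have "splitting q' p'"
    unfolding splitting_def
  proof (intro conjI allI)
    show "q' n \<in> W" "p' n \<in> W" for n unfolding p'_def q'_def using D W by (auto intro!: subspace_sum subspace_scale)
    show "0 \<le> q' n" "0 \<le> p' n" for n unfolding p'_def q'_def using D P(3) by (auto intro!: sum_nonneg scaleR_nonneg_nonneg)
    show "norm (q' n + p' n) = 1" for n unfolding sum by (rule P)
    show "disjoint_vectors (\<lambda>n. q' n + p' n)" unfolding sum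
    proof (rule disjoint_vectors_blocks[OF D(6)])
      show "I k \<inter> I l = {}" if "k \<noteq> l" for k l
        using disj[of k l] disj[of l k] that by (cases "k < l") auto
    qed
  qed
  note D' = splittingD[OF this]
  have lower': "lower_bound q' p' c"
    unfolding p'_def[abs_def] q'_def[abs_def] by (rule lower_bound_blocks[OF lower P(1)])
  have "c / 4 > 0" using c by simp
  from small_positive_combination[OF \<open>splitting q' p'\<close> c lower' this]
  obtain F b where F: "finite F" "\<And>k. 0 \<le> b k" "norm (\<Sum>k\<in>F. b k *\<^sub>R (q' k + p' k)) = 1"
    "L1t (\<Sum>k\<in>F. b k *\<^sub>R q' k) \<le> c / 4" by blast
  have b1: "b k \<le> 1" if "k \<in> F" for k
    using norm_coeff_le_norm_sum[OF D'(6) F(1) that, of b] F(2)[of k] F(3) D'(5)[of k] by simp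
  have "c * norm (\<Sum>k\<in>F. b k *\<^sub>R (q' k + p' k)) \<le> L1t (\<Sum>k\<in>F. b k *\<^sub>R (q' k - p' k))"
    using lower' F(1) unfolding lower_bound_def by blast
  then have "c \<le> L1t ((\<Sum>k\<in>F. b k *\<^sub>R q' k) + (-1) *\<^sub>R (\<Sum>k\<in>F. b k *\<^sub>R p' k))"
    by (simp add: F(3) scaleR_diff_right sum_subtractf)
  also have "\<dots> \<le> L1t (\<Sum>k\<in>F. b k *\<^sub>R q' k) + L1t ((-1) *\<^sub>R (\<Sum>k\<in>F. b k *\<^sub>R p' k))" by (rule L1t_triangle)
  also have "L1t ((-1) *\<^sub>R (\<Sum>k\<in>F. b k *\<^sub>R p' k)) = L1t (\<Sum>k\<in>F. b k *\<^sub>R p' k)" by (simp only: L1t_scale)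
  also have "\<dots> \<le> (\<Sum>k\<in>F. L1t (b k *\<^sub>R p' k))" by (rule L1t_sum)
  also have "\<dots> \<le> (\<Sum>k\<in>F. c / 8 * (1/2)^k)"
  proof (rule sum_mono)
    fix k assume k: "k \<in> F"
    have "L1t (b k *\<^sub>R p' k) = b k * L1t (p' k)" using F(2)[of k] by (simp only: L1t_scale abs_of_nonneg)
    also have "\<dots> \<le> L1t (p' k)" using b1[OF k] F(2) L1t_nonneg by (intro mult_left_le_one_le) auto
    also have "\<dots> \<le> c / 8 * (1/2)^k" using P(5)[of k] by (simp add: p'_def)
    finally show "L1t (b k *\<^sub>R p' k) \<le> c / 8 * (1/2)^k" .
  qed
  also have "\<dots> \<le> c / 4"
  proof -
    have "(\<Sum>k\<in>F. (1/2::real)^k) \<le> (\<Sum>k. (1/2)^k)"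
      using F(1) by (intro sum_le_suminf) (auto simp: summable_geometric)
    also have "\<dots> = 2" by (subst suminf_geometric) auto
    finally have "c / 8 * (\<Sum>k\<in>F. (1/2::real)^k) \<le> c / 8 * 2" using c by (intro mult_left_mono) auto
    then show ?thesis by (simp add: sum_distrib_left)
  qed
  finally show False using F(4) c by simp
qed

end

section \<open>Reduction to a finite measure\<close>

text \<open>Representatives are chosen on a Hamel basis and extended linearly. Linearity then holds
  at every point, not merely off null sets depending on the vectors.\<close>

lemma L1_linear_representatives:
  fixes T :: "'a::banach_lattice \<Rightarrow> ('b \<Rightarrow> real) set"
  assumes "bounded_linear_L1 \<mu> T"
  shows "\<exists>t. (\<forall>b. linear (\<lambda>x. t x b)) \<and> (\<forall>x. integrable \<mu> (t x)) \<and> (\<forall>x. T x = L1_rel \<mu> `` {t x})"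
proof -
  have T: "T x \<in> L1 \<mu>" "T (x + y) = L1_add \<mu> (T x) (T y)" "T (c *\<^sub>R x) = L1_scale \<mu> c (T x)" for x y c
    using assms by (auto simp: bounded_linear_L1_def)
  have ex: "\<forall>x. \<exists>f. integrable \<mu> f \<and> T x = L1_rel \<mu> `` {f}"
  proof
    show "\<exists>f. integrable \<mu> f \<and> T x = L1_rel \<mu> `` {f}" for x
      using T(1)[of x] unfolding L1_def by (auto elim!: quotientE)
  qed
  obtain rep where rep0: "\<forall>x. integrable \<mu> (rep x) \<and> T x = L1_rel \<mu> `` {rep x}"
    using choice[OF ex] by (elim exE) (rule that)
  have rep: "integrable \<mu> (rep x)" "T x = L1_rel \<mu> `` {rep x}" for x using rep0 by blast+
  obtain B :: "'a set" where "B \<subseteq> UNIV" and B: "independent B" "UNIV \<subseteq> span B" and "card B = dim (UNIV :: 'a set)"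
    by (rule basis_exists[of "UNIV :: 'a set"])
  have "\<forall>b. \<exists>g. linear g \<and> (\<forall>v\<in>B. g v = rep v b)"
    using linear_independent_extend[OF B(1)] by (intro allI)
  from choice[OF this] obtain G where G0: "\<forall>b. linear (G b) \<and> (\<forall>v\<in>B. G b v = rep v b)"
    by (elim exE) (rule that)
  have G: "linear (G b)" "v \<in> B \<Longrightarrow> G b v = rep v b" for b v using G0 by blast+
  define t where "t x b = G b x" for x b
  have lin: "linear (\<lambda>x. t x b)" for b using G(1) by (simp add: t_def[abs_def])
  have "integrable \<mu> (t x) \<and> T x = L1_rel \<mu> `` {t x}" for x
  proof -
    have "x \<in> span B" using B(2) by auto
    then show ?thesis
    proof (induction x rule: span_induct_alt)
      case base
      have "T 0 = L1_scale \<mu> 0 (T 0)" using T(3)[of 0 0] by simp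
      also have "\<dots> = L1_rel \<mu> `` {\<lambda>b. 0 * rep 0 b}" unfolding rep(2)[of 0] by (rule L1_scale_class[OF rep(1)])
      also have "(\<lambda>b. 0 * rep 0 b) = t 0" using linear_0[OF lin] by (simp add: fun_eq_iff)
      finally have "T 0 = L1_rel \<mu> `` {t 0}" .
      moreover have "t 0 = (\<lambda>b. 0)" using linear_0[OF lin] by (simp add: fun_eq_iff)
      ultimately show ?case by simp
    next
      case (step c x y)
      have tx: "t x = rep x" using step by (simp add: t_def G fun_eq_iff)
      have sx: "T (c *\<^sub>R x) = L1_rel \<mu> `` {\<lambda>b. c * rep x b}"
        unfolding T(3) rep(2)[of x] by (rule L1_scale_class[OF rep(1)])
      have "T (c *\<^sub>R x + y) = L1_add \<mu> (L1_rel \<mu> `` {\<lambda>b. c * rep x b}) (L1_rel \<mu> `` {t y})"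
        unfolding T(2) sx using step by simp
      also have "\<dots> = L1_rel \<mu> `` {\<lambda>b. c * rep x b + t y b}"
        using step rep(1) by (intro L1_add_class) auto
      also have "(\<lambda>b. c * rep x b + t y b) = t (c *\<^sub>R x + y)"
        using linear_add[OF lin] linear_cmul[OF lin] by (simp add: fun_eq_iff tx)
      finally have "T (c *\<^sub>R x + y) = L1_rel \<mu> `` {t (c *\<^sub>R x + y)}" .
      moreover have "t (c *\<^sub>R x + y) = (\<lambda>b. c * rep x b + t y b)"
        using linear_add[OF lin] linear_cmul[OF lin] by (simp add: fun_eq_iff tx)
      ultimately show ?case using step rep(1) by simp
    qed
  qed
  then show ?thesis using lin by (intro exI[of _ t]) simp
qed

text \<open>A weighted sum of the \<open>min 1 \<bar>f n b\<bar>\<close>: the truncation makes the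
  series converge at every point, and the division by \<open>s n\<close> makes it converge in L_1.
  All terms being nonnegative, the sum vanishes only where every \<open>f n\<close> does.\<close>

lemma common_support_density:
  fixes f :: "nat \<Rightarrow> 'b \<Rightarrow> real"
  assumes int: "\<And>n. integrable \<mu> (f n)"
  obtains \<phi> where "integrable \<mu> \<phi>" "\<And>b. 0 \<le> (\<phi> b :: real)" "\<And>n b. \<phi> b = 0 \<Longrightarrow> f n b = 0"
proof -
  define s where "s n = 1 + (\<integral>b. \<bar>f n b\<bar> \<partial>\<mu>)" for n
  have nn: "0 \<le> (\<integral>b. \<bar>f n b\<bar> \<partial>\<mu>)" for n by (rule integral_nonneg_AE) simp
  then have s: "1 \<le> s n" "s n > 0" for n by (simp_all add: s_def add_pos_nonneg)
  define g where "g n b = (1/2)^n * (min 1 \<bar>f n b\<bar> / s n)" for n b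
  have [measurable]: "f n \<in> borel_measurable \<mu>" for n using int by auto
  have g0: "0 \<le> g n b" for n b using s(2)[of n] by (simp add: g_def)
  have g1: "g n b \<le> (1/2)^n" for n b
  proof -
    have "min 1 \<bar>f n b\<bar> / s n \<le> 1" using s[of n] by (simp add: min_def)
    then have "(1/2)^n * (min 1 \<bar>f n b\<bar> / s n) \<le> (1/2::real)^n * 1" by (rule mult_left_mono) simp
    then show ?thesis by (simp add: g_def)
  qed
  have gf: "g n b \<le> (1/2)^n * (\<bar>f n b\<bar> / s n)" for n b
    unfolding g_def using s(2)[of n] by (intro mult_left_mono divide_right_mono) auto
  have geo: "summable (\<lambda>n. (1/2::real)^n)" by (simp add: summable_geometric)
  have sg: "summable (\<lambda>n. g n b)" for b
    by (rule summable_comparison_test'[OF geo, of 0]) (use g0 g1 in auto)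
  have ig: "integrable \<mu> (g n)" for n
  proof (rule Bochner_Integration.integrable_bound)
    show "integrable \<mu> (\<lambda>b. (1/2)^n * (\<bar>f n b\<bar> / s n))" using int by auto
    show "g n \<in> borel_measurable \<mu>" unfolding g_def by measurable
    show "AE b in \<mu>. norm (g n b) \<le> norm ((1/2)^n * (\<bar>f n b\<bar> / s n))"
    proof (rule AE_I2)
      fix b
      have "norm (g n b) = g n b" using g0 by simp
      also have "\<dots> \<le> (1/2)^n * (\<bar>f n b\<bar> / s n)" by (rule gf)
      also have "\<dots> \<le> norm \<dots>" unfolding real_norm_def by (rule abs_ge_self)
      finally show "norm (g n b) \<le> norm ((1/2)^n * (\<bar>f n b\<bar> / s n))" .
    qed
  qed
  have ng: "(\<integral>b. norm (g n b) \<partial>\<mu>) \<le> (1/2)^n" for n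
  proof -
    have "(\<integral>b. norm (g n b) \<partial>\<mu>) \<le> (\<integral>b. (1/2)^n * (\<bar>f n b\<bar> / s n) \<partial>\<mu>)"
      using ig int g0 gf by (intro integral_mono) auto
    also have "\<dots> = (1/2)^n * ((\<integral>b. \<bar>f n b\<bar> \<partial>\<mu>) / s n)" by simp
    also have "\<dots> \<le> (1/2)^n * 1" using s(2)[of n] by (intro mult_left_mono) (auto simp: s_def)
    finally show ?thesis by simp
  qed
  define \<phi> where "\<phi> b = (\<Sum>n. g n b)" for b
  show ?thesis
  proof (rule that)
    show "integrable \<mu> \<phi>" unfolding \<phi>_def
    proof (rule integrable_suminf[OF ig])
      show "AE b in \<mu>. summable (\<lambda>n. norm (g n b))" using sg g0 by auto
      show "summable (\<lambda>n. \<integral>b. norm (g n b) \<partial>\<mu>)"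
        by (rule summable_comparison_test'[OF geo, of 0]) (use ng in \<open>auto simp: integral_nonneg_AE\<close>)
    qed
    show "0 \<le> \<phi> b" for b unfolding \<phi>_def using sg g0 by (intro suminf_nonneg) auto
    show "f n b = 0" if "\<phi> b = 0" for n b
    proof -
      have "g n b = 0" using that suminf_eq_zero_iff[OF sg g0] unfolding \<phi>_def by blast
      then show ?thesis using s(2)[of n] by (auto simp: g_def min_def split: if_splits)
    qed
  qed
qed

section \<open>Lower bounds on subspaces and the two implications\<close>

lemma isomorphism_onto_image_L1_iff:
  fixes T :: "'a::banach_lattice \<Rightarrow> ('b \<Rightarrow> real) set"
  assumes bl: "bounded_linear_L1 \<mu> T"
    and t: "\<And>b. linear (\<lambda>x. t x b)" "\<And>x. integrable \<mu> (t x)" "\<And>x. T x = L1_rel \<mu> `` {t x}"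
    and Y: "subspace Y"
  shows "isomorphism_onto_image (L1_norm \<mu>) Y T \<longleftrightarrow> (\<exists>c>0. \<forall>x\<in>Y. c * norm x \<le> (\<integral>b. \<bar>t x b\<bar> \<partial>\<mu>))"
    (is "?iso \<longleftrightarrow> ?low")
proof
  have nrm: "L1_norm \<mu> (T x) = (\<integral>b. \<bar>t x b\<bar> \<partial>\<mu>)" for x
    unfolding t(3) by (rule L1_norm_class[OF t(2)])
  show ?low if iso: ?iso
  proof -
    obtain K where K: "inj_on T Y" "\<forall>z\<in>T ` Y. norm (inv_into Y T z) \<le> K * L1_norm \<mu> z"
      using iso unfolding isomorphism_onto_image_def by blast
    show ?low
    \<comment> \<open>The bound \<open>K\<close> for the inverse may be nonpositive; the maximum
      makes the reciprocal a positive constant.\<close>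
    proof (intro exI[of _ "1 / max K 1"] conjI ballI)
      fix x assume x: "x \<in> Y"
      then have "norm x \<le> K * (\<integral>b. \<bar>t x b\<bar> \<partial>\<mu>)"
        using K(2)[rule_format, of "T x"] inv_into_f_f[OF K(1) x] by (simp add: nrm)
      also have "\<dots> \<le> max K 1 * (\<integral>b. \<bar>t x b\<bar> \<partial>\<mu>)"
        by (intro mult_right_mono integral_nonneg_AE) auto
      finally show "1 / max K 1 * norm x \<le> (\<integral>b. \<bar>t x b\<bar> \<partial>\<mu>)" by (simp add: field_simps)
    qed auto
  qed
  show ?iso if low: ?low
  proof -
    obtain c where c: "c > 0" "\<And>x. x \<in> Y \<Longrightarrow> c * norm x \<le> (\<integral>b. \<bar>t x b\<bar> \<partial>\<mu>)" using low by blast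
    have inj: "inj_on T Y"
    proof (rule inj_onI)
      fix x y assume xy: "x \<in> Y" "y \<in> Y" "T x = T y"
      then have "(t x, t y) \<in> L1_rel \<mu>"
        using eq_equiv_class[OF _ equiv_L1_rel, of \<mu> "t x" "t y"] t(2,3) by auto
      then have "AE b in \<mu>. t x b = t y b" by (simp add: L1_rel_def)
      then have "AE b in \<mu>. \<bar>t (x - y) b\<bar> = 0"
        by eventually_elim (simp add: linear_diff[OF t(1)])
      then have "(\<integral>b. \<bar>t (x - y) b\<bar> \<partial>\<mu>) = (\<integral>b. 0 \<partial>\<mu>)"
        using t(2) by (intro integral_cong_AE) auto
      then have "c * norm (x - y) \<le> 0" using c(2)[of "x - y"] Y xy by (simp add: subspace_diff)
      then show "x = y" using c(1) by (simp add: mult_le_0_iff)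
    qed
    have "norm (inv_into Y T z) \<le> 1 / c * L1_norm \<mu> z" if "z \<in> T ` Y" for z
      using that c inv_into_f_f[OF inj] by (auto simp: nrm field_simps)
    then show ?iso
      using inj bl unfolding isomorphism_onto_image_def bounded_linear_L1_def by blast
  qed
qed

text \<open>Both sides are Lipschitz, with constants \<open>c\<close> and \<open>K\<close>. This
  links the finite combinations in \<open>singular\<close> to the closed spans.\<close>

lemma lower_bound_closure:
  fixes f :: "'a::real_normed_vector \<Rightarrow> real"
  assumes f: "\<And>v w. f v \<le> f w + K * norm (v - w)" and K: "K > 0" and c: "c > 0"
    and low: "\<And>v. v \<in> S \<Longrightarrow> c * norm v \<le> f v" and v: "v \<in> closure S"
  shows "c * norm v \<le> f v"
proof (rule field_le_epsilon)
  fix e :: real assume e: "e > 0"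
  then have "e / (K + c) > 0" using K c by simp
  then obtain w where w: "w \<in> S" "dist w v < e / (K + c)"
    using v unfolding closure_approachable by blast
  have "c * norm v \<le> c * (norm w + norm (v - w))"
    using c norm_triangle_sub[of v w] by (intro mult_left_mono) auto
  also have "\<dots> \<le> f w + c * norm (v - w)" using low[OF w(1)] by (simp add: distrib_left)
  also have "\<dots> \<le> f v + (K + c) * norm (v - w)"
    using f[of w v] by (simp add: distrib_right norm_minus_commute)
  also have "(K + c) * norm (v - w) \<le> e"
    using w(2) K c by (simp add: dist_norm norm_minus_commute field_simps)
  finally show "c * norm v \<le> f v + e" by simp
qed

text \<open>The closed span of a disjoint sequence in \<open>S\<close> stays in \<open>S\<close> and
  inherits the lower bound.\<close>

lemma DSS_imp_LSS:
  fixes T :: "'a::banach_lattice \<Rightarrow> ('b \<Rightarrow> real) set"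
  assumes bl: "bounded_linear_L1 \<mu> T" and dss: "disjointly_strictly_singular (L1_norm \<mu>) T"
  shows "lattice_strictly_singular (L1_norm \<mu>) T"
  unfolding lattice_strictly_singular_def
proof (intro allI impI notI)
  fix S :: "'a set"
  assume S: "closed_sublattice S" "infinite_dimensional S" "isomorphism_onto_image (L1_norm \<mu>) S T"
  obtain t where "\<forall>b. linear (\<lambda>x. t x b)" "\<forall>x. integrable \<mu> (t x)" "\<forall>x. T x = L1_rel \<mu> `` {t x}"
    using L1_linear_representatives[OF bl] by (elim exE conjE) (rule that)
  note t = this[rule_format]
  have S': "closed S" "subspace S" "\<And>x y. x \<in> S \<Longrightarrow> y \<in> S \<Longrightarrow> sup x y \<in> S"
    "\<And>x y. x \<in> S \<Longrightarrow> y \<in> S \<Longrightarrow> inf x y \<in> S"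
    using S(1) by (auto simp: closed_sublattice_def)
  obtain u :: "nat \<Rightarrow> 'a" where u: "disjoint_vectors u" "\<And>n. u n \<in> S" "\<And>n. 0 < u n"
    using infinite_dimensional_disjoint_sequence[OF S'(2-4) S(2)] by blast
  have "closed_span (range u) \<subseteq> S"
    unfolding closed_span_def using S' u by (intro closure_minimal span_minimal) auto
  then have "isomorphism_onto_image (L1_norm \<mu>) (closed_span (range u)) T"
    using S(3) unfolding isomorphism_onto_image_L1_iff[OF bl t S'(2)]
      isomorphism_onto_image_L1_iff[OF bl t subspace_closure_span, folded closed_span_def] by blast
  then show False
    using dss u unfolding disjointly_strictly_singular_def by (metis less_irrefl)
qed

lemma LSS_imp_DSS:
  fixes T :: "'a::banach_lattice \<Rightarrow> ('b \<Rightarrow> real) set"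
  assumes bl: "bounded_linear_L1 \<mu> T" and lss: "lattice_strictly_singular (L1_norm \<mu>) T"
  shows "disjointly_strictly_singular (L1_norm \<mu>) T"
  unfolding disjointly_strictly_singular_def
proof (intro notI, elim exE conjE)
  fix x :: "nat \<Rightarrow> 'a"
  assume x: "\<forall>n. x n \<noteq> 0" "disjoint_vectors x"
    and iso: "isomorphism_onto_image (L1_norm \<mu>) (closed_span (range x)) T"
  obtain t where "\<forall>b. linear (\<lambda>x. t x b)" "\<forall>x. integrable \<mu> (t x)" "\<forall>x. T x = L1_rel \<mu> `` {t x}"
    using L1_linear_representatives[OF bl] by (elim exE conjE) (rule that)
  note t = this[rule_format]
  note iso_iff = isomorphism_onto_image_L1_iff[OF bl t subspace_closure_span, folded closed_span_def]
  have "\<exists>c>0. \<forall>v\<in>closed_span (range x). c * norm v \<le> (\<integral>b. \<bar>t v b\<bar> \<partial>\<mu>)"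
    using iso unfolding iso_iff .
  then obtain c where c: "c > 0" "\<And>v. v \<in> closed_span (range x) \<Longrightarrow> c * norm v \<le> (\<integral>b. \<bar>t v b\<bar> \<partial>\<mu>)"
    by auto
  obtain K0 where K0: "\<And>v. L1_norm \<mu> (T v) \<le> K0 * norm v"
    using bl unfolding bounded_linear_L1_def by blast
  define K where "K = max K0 1"
  have K: "K > 0" by (simp add: K_def)
  have bound: "(\<integral>b. \<bar>t v b\<bar> \<partial>\<mu>) \<le> K * norm v" for v
  proof -
    have "(\<integral>b. \<bar>t v b\<bar> \<partial>\<mu>) \<le> K0 * norm v"
      using K0[of v] unfolding t(3) L1_norm_class[OF t(2)] .
    also have "\<dots> \<le> K * norm v" by (intro mult_right_mono) (auto simp: K_def)
    finally show ?thesis .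
  qed
  define z where "z n = x n /\<^sub>R norm (x n)" for n
  define p q where "p n = pprt (z n)" and "q n = - nprt (z n)" for n
  have zpq: "z n = p n - q n" "\<bar>z n\<bar> = p n + q n" for n
    using prts[of "z n"] by (simp_all add: p_def q_def abs_prts)
  have pos: "0 \<le> p n" "0 \<le> q n" for n by (simp_all add: p_def q_def)
  have zx: "z n \<in> span (range x)" for n unfolding z_def by (intro span_scale span_base) auto
  have znorm: "norm (z n) = 1" for n using x(1) by (simp add: z_def)
  have zdisj: "disjoint_vectors z"
    using x(2) unfolding disjoint_vectors_iff z_def by (auto intro: lat_disjoint_scaleR2)
  have zadisj: "disjoint_vectors (\<lambda>n. p n + q n)"
    using disjoint_vectors_mono[OF zdisj, of "\<lambda>n. p n + q n"] by (simp flip: zpq(2))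
  have zabs: "norm (\<Sum>i\<in>I. a i *\<^sub>R (p i + q i)) \<le> norm (\<Sum>i\<in>I. a i *\<^sub>R z i)" if "finite I" for I a
    using norm_sum_disjoint_mono[OF zdisj that, of "\<lambda>i. \<bar>z i\<bar>" a a] by (simp add: zpq(2) pos)
  \<comment> \<open>The two sequences are interleaved to obtain one density for both.\<close>
  define f where "f n = (if even n then t (p (n div 2)) else t (q (n div 2)))" for n
  have "integrable \<mu> (f n)" for n using t(2) by (simp add: f_def)
  then obtain \<phi> where \<phi>: "integrable \<mu> \<phi>" "\<And>b. 0 \<le> (\<phi> b :: real)" "\<And>n b. \<phi> b = 0 \<Longrightarrow> f n b = 0"
    using common_support_density by blast
  have supp: "t (p n) b = 0" "t (q n) b = 0" if "\<phi> b = 0" for n b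
    using \<phi>(3)[OF that, of "2 * n"] \<phi>(3)[OF that, of "2 * n + 1"] by (simp_all add: f_def)
  have [measurable]: "\<phi> \<in> borel_measurable \<mu>" "t v \<in> borel_measurable \<mu>" for v using \<phi>(1) t(2) by auto
  define N where "N = density \<mu> (\<lambda>b. ennreal (\<phi> b))"
  \<comment> \<open>Dividing by the density preserves the L_1 norm of functions carried by its
    support. Where \<phi> vanishes the quotient is 0, so in general the norm can only decrease and
    the bound \<open>K\<close> is kept.\<close>
  define t' where "t' v b = t v b / \<phi> b" for v b
  have [measurable]: "t' v \<in> borel_measurable \<mu>" for v unfolding t'_def[abs_def] by measurable
  define W where "W = {v. \<forall>b. \<phi> b = 0 \<longrightarrow> t v b = 0}"
  have finN: "finite_measure N"
  proof (rule finite_measureI)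
    have "emeasure N (space N) = (\<integral>\<^sup>+b. ennreal (\<phi> b) \<partial>\<mu>)"
      unfolding N_def by (simp add: emeasure_density)
    also have "\<dots> = ennreal (\<integral>b. \<phi> b \<partial>\<mu>)" using \<phi> by (intro nn_integral_eq_integral) auto
    finally show "emeasure N (space N) \<noteq> \<infinity>" by simp
  qed
  have t'int: "integrable N (t' v)" for v
  proof -
    have "integrable \<mu> (\<lambda>b. \<phi> b *\<^sub>R t' v b)"
      by (rule Bochner_Integration.integrable_bound[OF t(2)[of v]]) (auto simp: t'_def)
    then show ?thesis unfolding N_def
      by (subst integrable_density) (auto simp: \<phi>(2))
  qed
  have t'eq: "(\<integral>b. \<bar>t' v b\<bar> \<partial>N) = (\<integral>b. (if \<phi> b = 0 then 0 else \<bar>t v b\<bar>) \<partial>\<mu>)" for v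
  proof -
    have "(\<integral>b. \<bar>t' v b\<bar> \<partial>N) = (\<integral>b. \<phi> b *\<^sub>R \<bar>t' v b\<bar> \<partial>\<mu>)"
      unfolding N_def by (rule integral_density) (auto simp: \<phi>(2))
    also have "\<dots> = (\<integral>b. (if \<phi> b = 0 then 0 else \<bar>t v b\<bar>) \<partial>\<mu>)"
      using \<phi>(2) by (intro Bochner_Integration.integral_cong) (auto simp: t'_def abs_divide)
    finally show ?thesis .
  qed
  have t'W: "(\<integral>b. \<bar>t' v b\<bar> \<partial>N) = (\<integral>b. \<bar>t v b\<bar> \<partial>\<mu>)" if "v \<in> W" for v
    unfolding t'eq using that by (intro Bochner_Integration.integral_cong) (auto simp: W_def)
  have Wsub: "subspace W"
    unfolding subspace_def W_def by (auto simp: linear_0[OF t(1)] linear_add[OF t(1)] linear_cmul[OF t(1)])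
  interpret l1_operator N t' W K
  proof (intro l1_operator.intro l1_operator_axioms.intro)
    show "finite_measure N" by (rule finN)
    show "linear (\<lambda>v. t' v b)" for b
      using linear_compose[OF t(1)[of b] bounded_linear.linear[OF bounded_linear_divide[of "\<phi> b"]]]
      by (simp add: t'_def o_def)
    show "integrable N (t' v)" for v by (rule t'int)
    show "(\<integral>b. \<bar>t' v b\<bar> \<partial>N) \<le> K * norm v" for v
    proof -
      have "(\<integral>b. \<bar>t' v b\<bar> \<partial>N) \<le> (\<integral>b. \<bar>t v b\<bar> \<partial>\<mu>)"
        unfolding t'eq
      proof (rule integral_mono)
        show "integrable \<mu> (\<lambda>b. if \<phi> b = 0 then 0 else \<bar>t v b\<bar>)"
          by (rule Bochner_Integration.integrable_bound[OF t(2)[of v]]) auto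
      qed (use t(2) in auto)
      then show ?thesis using bound[of v] by simp
    qed
    show "K > 0" by (rule K)
    show "subspace W" by (rule Wsub)
    fix u :: "nat \<Rightarrow> 'a" and d :: real
    assume u: "\<And>n. u n \<in> W" "\<And>n. 0 \<le> u n" "\<And>n. u n \<noteq> 0" "disjoint_vectors u" "d > 0"
    show "\<exists>v\<in>span (range u). (\<integral>b. \<bar>t' v b\<bar> \<partial>N) < d * norm v"
    \<comment> \<open>A lower bound on the span would extend to its closure, an infinite-dimensional
      closed sublattice because the \<open>u n\<close> are positive and disjoint; this contradicts
      lattice strict singularity.\<close>
    proof (rule ccontr)
      assume neg: "\<not> ?thesis"
      have "span (range u) \<subseteq> W" using u(1) Wsub by (intro span_minimal) auto
      have low: "d * norm v \<le> (\<integral>b. \<bar>t v b\<bar> \<partial>\<mu>)" if "v \<in> span (range u)" for v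
      proof -
        have "v \<in> W" using \<open>span (range u) \<subseteq> W\<close> that by blast
        then show ?thesis using neg that t'W[of v] by (auto simp: not_less)
      qed
      have lip: "(\<integral>b. \<bar>t v b\<bar> \<partial>\<mu>) \<le> (\<integral>b. \<bar>t w b\<bar> \<partial>\<mu>) + K * norm (v - w)" for v w
      proof -
        have "(\<integral>b. \<bar>t v b\<bar> \<partial>\<mu>) \<le> (\<integral>b. \<bar>t w b\<bar> + \<bar>t (v - w) b\<bar> \<partial>\<mu>)"
          using t(2) by (intro integral_mono) (auto simp: linear_diff[OF t(1)])
        also have "\<dots> = (\<integral>b. \<bar>t w b\<bar> \<partial>\<mu>) + (\<integral>b. \<bar>t (v - w) b\<bar> \<partial>\<mu>)"
          using t(2) by simp
        finally show ?thesis using bound[of "v - w"] by simp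
      qed
      have "d * norm v \<le> (\<integral>b. \<bar>t v b\<bar> \<partial>\<mu>)" if v: "v \<in> closed_span (range u)" for v
        by (rule lower_bound_closure[where f = "\<lambda>v. \<integral>b. \<bar>t v b\<bar> \<partial>\<mu>",
            OF lip K u(5) low v[unfolded closed_span_def]])
      then have "isomorphism_onto_image (L1_norm \<mu>) (closed_span (range u)) T"
        unfolding iso_iff using u(5) by blast
      moreover have "closed_sublattice (closed_span (range u))"
        using u by (intro closed_sublattice_span_disjoint)
      moreover have "infinite_dimensional (closed_span (range u))"
      proof (rule infinite_dimensional_span_disjoint[OF u(4,3)])
        show "range u \<subseteq> closed_span (range u)"
          unfolding closed_span_def by (rule order_trans[OF span_superset closure_subset])
      qed
      ultimately show False using lss unfolding lattice_strictly_singular_def by blast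
    qed
  qed
  have "splitting p q"
    unfolding splitting_def
  proof (intro conjI allI)
    show "p n \<in> W" "q n \<in> W" for n using supp by (auto simp: W_def)
    show "norm (p n + q n) = 1" for n using znorm by (simp flip: zpq(2))
  qed (use pos zadisj in auto)
  moreover have "lower_bound p q c"
    unfolding lower_bound_def
  proof (intro allI impI)
    fix I :: "nat set" and a assume I: "finite I"
    have "(\<Sum>i\<in>I. a i *\<^sub>R z i) \<in> span (range x)" by (intro span_sum span_scale zx)
    then have "(\<Sum>i\<in>I. a i *\<^sub>R z i) \<in> closed_span (range x)"
      unfolding closed_span_def using closure_subset by blast
    then have "c * norm (\<Sum>i\<in>I. a i *\<^sub>R z i) \<le> (\<integral>b. \<bar>t (\<Sum>i\<in>I. a i *\<^sub>R z i) b\<bar> \<partial>\<mu>)" by (rule c)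
    also have "\<dots> = (\<integral>b. \<bar>t' (\<Sum>i\<in>I. a i *\<^sub>R z i) b\<bar> \<partial>N)"
    proof (rule t'W[symmetric])
      show "(\<Sum>i\<in>I. a i *\<^sub>R z i) \<in> W"
        unfolding zpq(1) using supp by (intro subspace_sum subspace_scale subspace_diff Wsub) (auto simp: W_def)
    qed
    finally have "c * norm (\<Sum>i\<in>I. a i *\<^sub>R z i) \<le> L1t (\<Sum>i\<in>I. a i *\<^sub>R z i)" .
    moreover have "c * norm (\<Sum>i\<in>I. a i *\<^sub>R (p i + q i)) \<le> c * norm (\<Sum>i\<in>I. a i *\<^sub>R z i)"
      using zabs[OF I, of a] c(1) by simp
    ultimately show "c * norm (\<Sum>i\<in>I. a i *\<^sub>R (p i + q i)) \<le> L1t (\<Sum>i\<in>I. a i *\<^sub>R (p i - q i))"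
      by (simp add: zpq(1))
  qed
  ultimately show False using c(1) no_lower_bound by blast
qed

theorem theorem3p4:
  fixes \<mu> :: "'b measure"
    and T :: "'a::banach_lattice \<Rightarrow> ('b \<Rightarrow> real) set"
  assumes "bounded_linear_L1 \<mu> T"
  shows "lattice_strictly_singular (L1_norm \<mu>) T \<longleftrightarrow> disjointly_strictly_singular (L1_norm \<mu>) T"
  using LSS_imp_DSS[OF assms] DSS_imp_LSS[OF assms] by blast

end
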